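(* For every $\epsilon > 0$ there exists a constant $c$ such that for all positive rationals $\alpha = \frac{p}{q}$ (with $p, q$ positive integers) we have $$n_{\alpha} < \frac{c\, q \log^3 q}{\min(\alpha, 1) \log \log q} + c\,(e + \epsilon)^{2\alpha}.$$
   Context: For a positive rational $\alpha$ and a positive integer $n$, an $\alpha$-partition of $n$ is a finite set $\{a_1, \ldots, a_r\}$ of distinct positive integers with $a_1 + \cdots + a_r = n$ and $\frac{1}{a_1} + \cdots + \frac{1}{a_r} = \alpha$. The quantity $n_{\alpha}$ is the smallest positive integer such that for every integer $n \ge n_{\alpha}$ an $\alpha$-partition of $n$ exists (it is known, by a theorem of Graham, that $n_\alpha$ exists for every positive rational $\alpha$). Convention on logarithms: $\log$ is the natural logarithm, except that $\log(x)$ is interpreted as $1$ whenever $x < e$ (this applies also to each logarithm in an iterated expression such as $\log\log q$). Here $\log^3 q = (\log q)^3$, and $e$ is the base of the natural logarithm. *)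

theory Defs
  imports Complex_Main
begin

definition alpha_partition :: "rat \<Rightarrow> nat \<Rightarrow> nat set \<Rightarrow> bool" where
  "alpha_partition \<alpha> n A \<longleftrightarrow>
     finite A \<and> (\<forall>a\<in>A. 0 < a) \<and> (\<Sum>a\<in>A. a) = n \<and> (\<Sum>a\<in>A. 1 / of_nat a) = \<alpha>"

definition alpha_threshold :: "rat \<Rightarrow> nat \<Rightarrow> bool" where
  "alpha_threshold \<alpha> N \<longleftrightarrow> 0 < N \<and> (\<forall>n\<ge>N. \<exists>A. alpha_partition \<alpha> n A)"

text \<open>The value is meaningful only if some threshold exists (by a theorem of Graham, this holds for
  every positive rational); otherwise \<open>LEAST\<close> is unspecified.\<close>
definition n_alpha :: "rat \<Rightarrow> nat" where
  "n_alpha \<alpha> = (LEAST N. alpha_threshold \<alpha> N)"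

text \<open>Natural logarithm with the convention that it is \<open>1\<close> below \<open>e\<close>; iterated logarithms apply the
  convention at each level.\<close>
definition clog :: "real \<Rightarrow> real" where
  "clog x = (if x < exp 1 then 1 else ln x)"

end

theory Submission imports Defs "HOL-Analysis.Harmonic_Numbers" "HOL-Number_Theory.Number_Theory" "HOL-Real_Asymp.Real_Asymp"
begin

text \<open>
  Eliminating one prime power \<open>p ^ j\<close> from the denominator of a fraction costs a single unit fraction
  \<open>1 / (p ^ j * 2 ^ a * m)\<close> with \<open>m < p\<close>. Processing the odd primes up to \<open>x\<close> in decreasing order
  therefore writes any \<open>r / L\<close> in \<open>[1, 2)\<close>, where \<open>L\<close> is the odd part of \<open>lcm(1, ..., x)\<close>, as a sum of
  distinct unit fractions (the dyadic remainder being a binary expansion) whose denominators add up to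
  \<open>O(x ^ 3 / log x)\<close>. With \<open>x\<close> of order \<open>log q\<close> we have \<open>L \<ge> q\<close>, so \<open>r\<close> can be chosen modulo \<open>q\<close>
  such that subtracting the fractions \<open>1 / (q * e)\<close> removes \<open>q\<close> from the denominator of \<open>\<alpha>\<close>;
  this is the source of \<open>q log^3 q / log log q\<close>.

  For large \<open>\<alpha>\<close> almost all of \<open>[1, N]\<close> with \<open>log N\<close> close to \<open>\<alpha>\<close> has to be used. We group the integers
  up to \<open>N\<close> as \<open>d * s\<close> with \<open>d\<close> free of primes below \<open>x\<close> (\<open>x\<close> of order \<open>log N\<close>) and \<open>s\<close> composed of such
  primes, and delete from each block \<open>d * {s}\<close> the few elements that are needed to remove \<open>d\<close> from the
  denominator of the sum of reciprocals.

  Every large \<open>n\<close> is reached because each \<open>m \<ge> 78\<close> is the sum of a set \<open>A\<close> with reciprocal sum \<open>1\<close>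
  (Graham): two scaled copies \<open>K * A1\<close> and \<open>D * A2\<close> with coprime \<open>K = 17 * 2 ^ c\<close> and \<open>D = 3 ^ b\<close>
  contribute the fixed amount \<open>1 / K + 1 / D\<close> to the reciprocals, while \<open>K * m1 + D * m2\<close> takes all large
  values. Multiples of \<open>17\<close> are avoided in \<open>A\<close>, so that 17-adic valuations separate these copies from
  each other and from the rest of the partition.
\<close>

text \<open>The two terms of the bound have different sources. An elimination up to \<open>x\<close>
  uses at most one fraction per odd prime power up to \<open>x\<close>, each with denominator
  O(x^2); the number of these prime powers is O(x / log x), and this saving becomes the
  \<open>log log q\<close>. The filled interval [1, N] costs at most N^2, where log N is about (1 +
  \<delta>) * \<alpha>; this is the exponent 2\<alpha>. For \<alpha> < 1 everything except the two
  Graham copies is multiplied by an integer k close to 1 / \<alpha>, whence the factor 1 /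
  min(\<alpha>, 1). The obstacle throughout is distinctness. Inside one elimination, each new
  denominator carries a full prime power that no later denominator can contain. A lower bound X on
  these denominators serves twice: it keeps the total that is subtracted below the target, so that
  the dyadic remainder is not negative, and it keeps the denominators away from the filled
  interval.\<close>

definition rsum :: "nat set \<Rightarrow> real" where
  "rsum A = (\<Sum>a\<in>A. 1 / real a)"

lemma rsum_nonneg: "rsum A \<ge> 0"
  by (simp add: rsum_def sum_nonneg)

lemma rsum_empty [simp]: "rsum {} = 0"
  by (simp add: rsum_def)

lemma rsum_Un: "finite A \<Longrightarrow> finite B \<Longrightarrow> A \<inter> B = {} \<Longrightarrow> rsum (A \<union> B) = rsum A + rsum B"
  by (simp add: rsum_def sum.union_disjoint)

lemma rsum_insert: "finite A \<Longrightarrow> a \<notin> A \<Longrightarrow> rsum (insert a A) = 1 / real a + rsum A"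
  by (simp add: rsum_def)

lemma rsum_mono: "finite B \<Longrightarrow> A \<subseteq> B \<Longrightarrow> rsum A \<le> rsum B"
  by (simp add: rsum_def sum_mono2)

lemma rsum_Diff: "finite A \<Longrightarrow> B \<subseteq> A \<Longrightarrow> rsum (A - B) = rsum A - rsum B"
  by (simp add: rsum_def sum_diff)

lemma rsum_scale:
  assumes "k > 0"
  shows "rsum ((*) k ` A) = rsum A / real k"
proof -
  have "inj_on ((*) k) A" using assms by (auto simp: inj_on_def)
  then show ?thesis
    by (simp add: rsum_def sum.reindex sum_divide_distrib, simp add: mult.commute)
qed

lemma sum_scale:
  fixes k :: nat
  assumes "k > 0"
  shows "\<Sum>((*) k ` A) = k * \<Sum>A"
proof -
  have "inj_on ((*) k) A" using assms by (auto simp: inj_on_def)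
  then show ?thesis
    by (simp add: sum.reindex sum_distrib_left)
qed

lemma member_le_sum_nat: "finite A \<Longrightarrow> a \<in> A \<Longrightarrow> a \<le> \<Sum>(A :: nat set)"
  using member_le_sum[of a A "\<lambda>x. x"] by simp

section \<open>Partitions of reciprocal sum one\<close>

text \<open>Base cases of the doubling recursion, ordered by their sums. All entries divide 27720 =
  2^3 * 3^2 * 5 * 7 * 11, so a reciprocal sum of 1 is an identity between integers, and neither 17
  nor 39 can occur.\<close>

definition graham_table :: "nat list list" where
  "graham_table = [
   [3,4,5,9,12,45], [2,3,10,24,40], [2,4,10,15,21,28], [3,4,5,7,20,42], [2,6,7,10,15,42],
   [2,4,9,18,20,30], [2,6,7,9,18,42], [2,5,8,10,20,40], [2,5,9,10,15,45], [2,4,6,15,60],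
   [2,5,7,12,20,42], [2,3,9,30,45], [3,4,6,9,18,20,30], [3,4,6,11,12,22,33], [2,4,5,36,45],
   [2,5,8,9,24,45], [3,4,6,8,21,24,28], [2,4,8,9,72], [2,5,7,10,30,42], [2,6,9,12,18,20,30],
   [3,4,5,12,18,20,36], [3,4,5,6,36,45], [2,6,7,8,21,56], [2,4,5,30,60], [3,4,6,8,9,72],
   [2,4,8,14,35,40], [2,4,7,21,28,42], [2,4,7,20,30,42], [2,5,6,12,36,45], [2,6,7,14,20,28,30],
   [3,4,5,6,30,60], [2,4,5,28,70], [2,4,6,14,84], [2,3,8,42,56], [2,4,8,14,28,56], [2,3,8,40,60],
   [2,4,7,21,24,56], [2,3,12,14,84], [3,4,5,6,28,70], [3,5,6,7,9,42,45], [2,5,6,14,21,70],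
   [3,4,6,8,14,28,56], [3,4,6,8,15,24,60], [2,3,8,36,72], [2,4,7,18,28,63], [2,3,10,18,90],
   [2,4,8,12,42,56], [3,4,5,8,24,36,45], [2,4,8,12,40,60], [2,3,14,24,28,56], [2,3,12,30,36,45],
   [2,4,10,14,15,84], [2,4,9,10,45,60], [2,5,6,14,20,84], [2,6,7,14,15,28,60], [3,4,6,8,12,40,60],
   [2,4,8,12,36,72], [3,4,5,10,15,28,70], [2,5,6,15,18,90], [2,4,9,10,40,72], [2,3,15,20,28,70],
   [2,3,12,24,42,56], [2,4,6,28,30,70], [2,5,6,8,120], [2,3,14,18,42,63], [3,4,6,10,12,18,90],
   [2,4,6,24,36,72], [2,3,12,28,30,70], [2,6,8,9,21,28,72], [2,4,7,15,35,84], [2,5,7,8,56,70],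
   [2,3,12,24,36,72], [2,5,7,10,21,105], [2,4,9,10,36,90], [3,4,5,8,12,120], [2,4,7,14,42,84],
   [3,4,6,7,15,35,84], [2,4,5,24,120], [2,3,10,36,45,60], [2,3,14,18,36,84], [2,4,7,20,21,105],
   [2,3,9,21,126], [2,4,7,10,140], [2,6,9,10,12,36,90], [2,4,6,20,45,90], [2,5,6,12,24,120],
   [2,5,9,12,14,45,84], [2,3,10,28,60,70], [3,4,7,9,12,14,126], [2,6,7,10,12,140],
   [2,4,6,20,42,105], [2,5,7,12,15,140], [2,5,6,10,40,120], [2,3,12,18,60,90], [2,3,7,70,105],
   [2,4,7,14,36,126], [2,3,12,24,30,120], [3,4,6,8,10,72,90], [2,4,6,21,36,126],
   [2,3,12,20,40,120], [2,5,8,14,15,35,120], [2,3,7,63,126], [2,4,5,45,63,84], [2,3,10,30,40,120],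
   [2,4,5,42,70,84], [2,3,8,28,168], [3,4,5,9,10,180], [2,4,5,40,72,90], [3,4,5,8,15,60,120],
   [2,4,8,14,21,168], [2,3,10,24,60,120], [3,4,6,7,12,63,126], [3,4,5,7,24,40,140],
   [2,4,7,12,60,140], [2,4,9,12,20,180], [2,4,5,42,56,120], [2,4,5,40,60,120], [2,6,7,8,30,40,140],
   [2,4,9,10,30,180], [2,3,12,24,28,168], [2,5,6,10,36,180], [2,5,8,10,20,56,140],
   [2,4,5,36,70,126], [2,5,8,12,14,84,120], [2,4,5,40,56,140], [2,4,7,12,56,168],
   [2,3,10,28,40,168], [2,3,12,20,36,180], [2,4,6,18,45,180], [2,5,9,12,14,35,180],
   [2,5,7,14,15,90,126], [2,3,10,30,36,180], [3,4,5,7,20,56,168], [2,5,8,10,24,36,180],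
   [3,4,5,7,18,90,140], [2,3,8,56,60,140], [2,6,7,8,24,56,168], [3,4,6,7,15,28,210],
   [2,3,9,36,45,180], [2,4,6,20,35,210], [3,4,5,10,12,35,210], [2,5,9,10,15,60,180],
   [2,6,7,10,20,28,210], [2,4,8,15,36,40,180], [2,4,5,36,60,180], [2,4,5,35,63,180],
   [2,5,8,9,21,120,126], [3,4,5,6,30,105,140], [2,5,8,10,18,72,180], [2,4,6,15,90,180],
   [2,4,12,14,15,42,210], [2,6,7,8,28,40,210], [2,6,7,8,20,120,140], [2,3,10,20,90,180],
   [2,3,8,42,84,168], [2,5,6,14,30,42,210], [2,4,5,30,90,180], [2,4,9,14,20,84,180],
   [2,4,9,10,45,105,140], [2,4,8,9,126,168], [2,5,8,10,14,280], [2,4,6,15,84,210],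
   [2,4,8,9,120,180], [2,5,7,18,20,21,252], [2,4,5,28,120,168], [2,3,12,18,42,252],
   [2,6,8,9,12,126,168], [2,6,7,9,21,36,252]]"

lemma graham_table_valid:
  "\<forall>xs\<in>set graham_table. distinct xs \<and> (\<forall>x\<in>set xs. x dvd 27720 \<and> x \<noteq> 1) \<and>
     (\<Sum>x\<leftarrow>xs. 27720 div x) = 27720"
  by (simp add: graham_table_def)

text \<open>Even n from 158 = 2 * 78 + 2 on and odd n from 335 = 2 * 78 + 179 on reduce to a smaller
  case that is still at least 78; the table covers the remaining n from 78 on.\<close>

lemma graham_table_sums:
  "map sum_list graham_table = filter (\<lambda>n. odd n \<or> n < 158) [78..<335]"
  by (simp add: graham_table_def)

text \<open>The recursion below sends \<open>A\<close> to \<open>2A \<union> {2}\<close> and \<open>2A \<union> {3, 7, 78, 91}\<close>; the conditions on \<open>1\<close> and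
  \<open>39\<close> keep these unions disjoint.\<close>

definition good_partition :: "nat \<Rightarrow> nat set \<Rightarrow> bool" where
  "good_partition n A \<longleftrightarrow> finite A \<and> 0 \<notin> A \<and> 1 \<notin> A \<and> 39 \<notin> A \<and>
     (\<forall>a\<in>A. \<not> 17 dvd a) \<and> \<Sum>A = n \<and> rsum A = 1"

lemma good_partition_table:
  assumes "78 \<le> n" "odd n \<and> n < 335 \<or> n < 158"
  shows "\<exists>A. good_partition n A"
proof -
  have "n \<in> set (filter (\<lambda>n. odd n \<or> n < 158) [78..<335])"
    unfolding set_filter set_upt mem_Collect_eq atLeastLessThan_iff using assms by linarith
  then have "n \<in> sum_list ` set graham_table"
    unfolding graham_table_sums[symmetric] list.set_map .
  then obtain xs where xs: "xs \<in> set graham_table" "n = sum_list xs" by blast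
  have 1: "distinct xs" "\<And>x. x \<in> set xs \<Longrightarrow> x dvd 27720" "\<And>x. x \<in> set xs \<Longrightarrow> x \<noteq> 1"
    "(\<Sum>x\<leftarrow>xs. 27720 div x) = 27720"
    using graham_table_valid xs(1) by blast+
  have "real (\<Sum>x\<in>set xs. 27720 div x) = 27720"
    using 1(4) unfolding sum_list_distinct_conv_sum_set[OF 1(1)] by (metis of_nat_numeral)
  moreover have "real (\<Sum>x\<in>set xs. 27720 div x) = 27720 * rsum (set xs)"
    unfolding of_nat_sum rsum_def sum_distrib_left
    by (intro sum.cong refl) (simp add: real_of_nat_div 1(2))
  ultimately have 2: "rsum (set xs) = 1" by linarith
  have 3: "\<not> 17 dvd a" if "a \<in> set xs" for a
  proof
    assume "17 dvd a"
    then have "17 dvd (27720::nat)" using 1(2)[OF that] dvd_trans by blast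
    then show False by simp
  qed
  have 4: "0 \<notin> set xs" using 1(2)[of 0] by auto
  have 5: "39 \<notin> set xs" using 1(2)[of 39] by auto
  have 6: "1 \<notin> set xs" using 1(3)[of 1] by blast
  have 7: "\<Sum>(set xs) = n"
    using sum_list_distinct_conv_sum_set[OF 1(1), of "\<lambda>x. x"] xs(2) by simp
  show ?thesis unfolding good_partition_def using 2 3 4 5 6 7 by blast
qed

lemma good_partition_even:
  assumes "good_partition m A"
  shows "good_partition (2 * m + 2) (insert 2 ((*) 2 ` A))"
proof -
  have A: "finite A" "0 \<notin> A" "1 \<notin> A" "\<And>a. a \<in> A \<Longrightarrow> \<not> 17 dvd a" "\<Sum>A = m" "rsum A = 1"
    using assms by (auto simp: good_partition_def)
  have dvd17: "\<not> 17 dvd 2 * x" if "\<not> 17 dvd x" for x :: nat using that by presburger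
  have odd2: "2 * x \<noteq> 1" "39 \<noteq> 2 * x" for x :: nat by presburger+
  have 2: "2 \<notin> (*) 2 ` A" using A(3) by auto
  show ?thesis
    unfolding good_partition_def
  proof (intro conjI ballI)
    show "\<not> 17 dvd a" if "a \<in> insert 2 ((*) 2 ` A)" for a
      using that dvd17 A(4) by force
  qed (use 2 A(1-3,5-6) odd2 in \<open>auto simp: sum_scale rsum_insert rsum_scale image_iff\<close>)
qed

text \<open>1/3 + 1/7 + 1/78 + 1/91 = 1/2, and 3 + 7 + 78 + 91 = 179 is odd, which supplies the
  parity that doubling and adding 2 never reaches.\<close>

lemma good_partition_odd:
  assumes "good_partition m A"
  shows "good_partition (2 * m + 179) (insert 3 (insert 7 (insert 78 (insert 91 ((*) 2 ` A)))))"
proof -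
  have A: "finite A" "0 \<notin> A" "39 \<notin> A" "\<And>a. a \<in> A \<Longrightarrow> \<not> 17 dvd a" "\<Sum>A = m" "rsum A = 1"
    using assms by (auto simp: good_partition_def)
  have dvd17: "\<not> 17 dvd 2 * x" if "\<not> 17 dvd x" for x :: nat using that by presburger
  have odd2: "2 * x \<noteq> 1" "39 \<noteq> 2 * x" "91 \<noteq> 2 * x" "3 \<noteq> 2 * x" "7 \<noteq> 2 * x" for x :: nat
    by presburger+
  have 2: "78 \<notin> (*) 2 ` A" using A(3) by auto
  have 3: "91 \<notin> (*) 2 ` A" "3 \<notin> (*) 2 ` A" "7 \<notin> (*) 2 ` A" "1 \<notin> (*) 2 ` A" "39 \<notin> (*) 2 ` A"
    using odd2 by (auto simp: image_iff)
  show ?thesis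
    unfolding good_partition_def
  proof (intro conjI ballI)
    show "\<not> 17 dvd a" if "a \<in> insert 3 (insert 7 (insert 78 (insert 91 ((*) 2 ` A))))" for a
      using that dvd17 A(4) by force
  qed (use 2 3 A(1,2,5,6) in \<open>auto simp: sum_scale rsum_insert rsum_scale\<close>)
qed

lemma good_partition_exists:
  "78 \<le> n \<Longrightarrow> \<exists>A. good_partition n A"
proof (induction n rule: less_induct)
  case (less n)
  consider (table) "odd n \<and> n < 335 \<or> n < 158" | (even) "even n" "n \<ge> 158" | (odd) "odd n" "n \<ge> 335"
    using not_less by blast
  then show ?case
  proof cases
    case table
    then show ?thesis using good_partition_table less.prems by blast
  next
    case even
    then have m: "n = 2 * ((n - 2) div 2) + 2" by presburger
    with even have "(n - 2) div 2 < n" "(n - 2) div 2 \<ge> 78" by linarith+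
    then show ?thesis using less.IH good_partition_even m by metis
  next
    case odd
    then have m: "n = 2 * ((n - 179) div 2) + 179" by presburger
    with odd have "(n - 179) div 2 < n" "(n - 179) div 2 \<ge> 78" by linarith+
    then show ?thesis using less.IH good_partition_odd m by metis
  qed
qed

section \<open>Chebyshev-type estimates\<close>

definition oddlcm :: "nat \<Rightarrow> nat" where
  "oddlcm x = Lcm {m. odd m \<and> m \<le> x}"

text \<open>The entries \<open>1 / (m * (n choose m))\<close> of the Leibniz harmonic triangle are differences of
  entries closer to the edge \<open>1 / n\<close>, hence integer combinations of \<open>1, 1/2, ..., 1/n\<close>.\<close>

lemma leibniz_triangle_integral:
  assumes "m > 0" "\<And>j. j \<in> {1..m + d} \<Longrightarrow> j dvd L"
  shows "real L / (real m * real ((m + d) choose m)) \<in> \<int>"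
  using assms
proof (induction d arbitrary: m)
  case 0
  then have "m dvd L" by auto
  then show ?case by auto
next
  case (Suc d)
  define C0 where "C0 = (m + d) choose m"
  define C1 where "C1 = (m + Suc d) choose m"
  define C2 where "C2 = (m + Suc d) choose Suc m"
  have C: "real C0 > 0" by (simp add: C0_def zero_less_binomial)
  have h1: "Suc d * C1 = (m + Suc d) * C0"
    using binomial_absorb_comp[of "m + Suc d" m] by (simp add: C0_def C1_def)
  have h2: "Suc m * C2 = (m + Suc d) * C0"
    using Suc_times_binomial[of m "m + d"] by (simp add: C0_def C2_def)
  have e1: "(real d + 1) * real C1 = (real m + real d + 1) * real C0"
    using arg_cong[OF h1, of real] by (simp only: of_nat_mult of_nat_add of_nat_Suc) (simp add: add_ac)
  have e2: "(real m + 1) * real C2 = (real m + real d + 1) * real C0"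
    using arg_cong[OF h2, of real] by (simp only: of_nat_mult of_nat_add of_nat_Suc) (simp add: add_ac)
  have e1': "real C1 = (real m + real d + 1) * real C0 / (real d + 1)"
    using e1 by (simp add: field_simps)
  have "1 / (real m * real C1) = 1 / (real m * real C0) - 1 / ((real m + 1) * real C2)"
    unfolding e1' e2 using C Suc.prems(1)
    by (simp add: divide_simps)
  then have "real L * (1 / (real m * real C1)) = real L * (1 / (real m * real C0) - 1 / ((real m + 1) * real C2))"
    by simp
  then have "real L / (real m * real ((m + Suc d) choose m)) =
        real L / (real m * real C0) - real L / (real (Suc m) * real ((Suc m + d) choose Suc m))"
    by (simp add: right_diff_distrib C1_def C2_def add.commute)
  moreover have "real L / (real m * real C0) \<in> \<int>"
    unfolding C0_def using Suc.prems by (intro Suc.IH) auto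
  moreover have "real L / (real (Suc m) * real ((Suc m + d) choose Suc m)) \<in> \<int>"
    using Suc.prems by (intro Suc.IH) auto
  ultimately show ?case by simp
qed

lemma oddlcm_pos: "oddlcm x > 0"
  unfolding oddlcm_def by (auto simp: Lcm_0_iff_nat intro!: Nat.gr0I)

lemma odd_Lcm:
  assumes "finite A" "\<And>a. a \<in> A \<Longrightarrow> odd (a :: nat)"
  shows "odd (Lcm A)"
proof -
  have *: "odd (lcm a b)" if "odd a" "odd b" for a b :: nat
  proof
    assume "even (lcm a b)"
    moreover have "lcm a b dvd a * b" by (intro lcm_least) auto
    ultimately have "even (a * b)" by (rule dvd_trans)
    then show False using that by simp
  qed
  show ?thesis using assms by (induction rule: finite_induct) (simp_all add: *)
qed

lemma odd_oddlcm: "odd (oddlcm x)"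
  unfolding oddlcm_def by (rule odd_Lcm) auto

lemma dvd_oddlcm: "odd m \<Longrightarrow> m \<le> x \<Longrightarrow> m dvd oddlcm x"
  unfolding oddlcm_def by (rule dvd_Lcm) auto

lemma two_power_odd_decomp:
  assumes "m > 0"
  obtains i r :: nat where "odd r" "m = 2 ^ i * r"
proof -
  have "m \<noteq> 0" "\<not> is_unit (2::nat)" using assms by auto
  then obtain r where "m = 2 ^ multiplicity 2 m * r" "\<not> 2 dvd r"
    by (rule multiplicity_decompose')
  then show ?thesis using that by blast
qed

text \<open>Nair's argument: lcm(1, ..., 2n) is a positive integer multiple of n * (2n choose n),
  which is at least 4^n / 2. The power of two in it is at most x, so dividing it out costs only the
  factor x; the constant 4 covers 4^n / 2 and the rounding in n = x div 2.\<close>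

lemma oddlcm_lower: 
  assumes "x > 0"
  shows "2 ^ x \<le> 4 * real x * real (oddlcm x)"
proof (cases "x = 1")
  case True
  then show ?thesis using oddlcm_pos[of x] by simp
next
  case False
  define n where "n = x div 2"
  have n: "n > 0" "2 * n \<le> x" "x \<le> 2 * n + 1" using False assms by (auto simp: n_def)
  obtain t where t: "2 ^ t \<le> x" "x < 2 ^ Suc t"
    using ex_power_ivl1[of 2 x] assms by auto
  let ?L = "2 ^ t * oddlcm x"
  have dv: "j dvd ?L" if "j \<in> {1..n + n}" for j
  proof -
    have "j > 0" using that by auto
    then obtain i r where r: "odd r" "j = 2 ^ i * r" by (rule two_power_odd_decomp)
    have "r > 0" using r that by (auto intro!: Nat.gr0I)
    then have "2 ^ i * 1 \<le> j" unfolding r(2) by (intro mult_le_mono) auto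
    then have "2 ^ i < (2::nat) ^ Suc t" using that t n by simp
    then have "i \<le> t" by (metis less_Suc_eq_le nat_power_less_imp_less pos2)
    moreover have "r \<le> j" unfolding r(2) by simp
    then have "r \<le> x" using that n by simp
    ultimately show ?thesis unfolding r(2) using dvd_oddlcm r(1)
      by (intro mult_dvd_mono le_imp_power_dvd) auto
  qed
  have "real ?L / (real n * real ((n + n) choose n)) \<in> \<int>"
    by (rule leibniz_triangle_integral) (use n dv in auto)
  then obtain z where z: "real ?L / (real n * real ((n + n) choose n)) = of_int z" by (auto elim: Ints_cases)
  have C: "real ((n + n) choose n) > 0" by simp
  have "real ?L > 0" using oddlcm_pos[of x] by simp
  then have "of_int z > (0::real)" using z n C by (metis divide_pos_pos mult_pos_pos of_nat_0_less_iff)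
  then have "(1::real) \<le> of_int z" by simp
  then have "1 * (real n * real ((n + n) choose n)) \<le> of_int z * (real n * real ((n + n) choose n))"
    by (intro mult_right_mono) auto
  also have "\<dots> = real ?L" using z n C by (simp add: field_simps)
  finally have "real n * real ((2 * n) choose n) \<le> real ?L" by (simp add: mult_2)
  moreover have "4 ^ n / (2 * real n) \<le> real ((2 * n) choose n)"
    using central_binomial_lower_bound n by blast
  then have "4 ^ n / 2 \<le> real n * real ((2 * n) choose n)" using n by (simp add: field_simps)
  ultimately have "4 ^ n / 2 \<le> real ?L" by (rule order_trans[rotated])
  also have "real ?L = real (2 ^ t) * real (oddlcm x)" by simp
  also have "\<dots> \<le> real x * real (oddlcm x)" using t(1) by (intro mult_right_mono of_nat_mono) auto
  finally have "4 ^ n / 2 \<le> real x * real (oddlcm x)" .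
  moreover have "(2::real) ^ x \<le> 2 ^ (2 * n + 1)" using n by (intro power_increasing) auto
  ultimately show ?thesis by (simp add: power_mult)
qed

text \<open>The multiplicity of a prime in a least common multiple is the maximum over the members,
  so a prime power, unlike a general divisor, already divides one of them.\<close>

lemma primepow_dvd_Lcm:
  assumes "finite A" "0 \<notin> A" "primepow P" "P dvd Lcm A"
  shows "\<exists>a\<in>A. P dvd (a :: nat)"
  using assms(1,2,4)
proof (induction A rule: finite_induct)
  case empty
  then show ?case using assms(3) primepow_gt_Suc_0[of P] by auto
next
  case (insert a A)
  obtain p k where p: "prime p" "P = p ^ k" using assms(3) by (auto simp: primepow_def)
  have L0: "Lcm A \<noteq> 0" using insert by (simp add: Lcm_0_iff_nat)
  have "k \<le> multiplicity p (lcm a (Lcm A))"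
    using insert.prems insert.hyps p L0 by (intro multiplicity_geI) (auto simp: lcm_eq_0_iff)
  moreover have "multiplicity p (lcm a (Lcm A)) = max (multiplicity p a) (multiplicity p (Lcm A))"
    using insert.prems L0 p(1) by (intro multiplicity_lcm) auto
  ultimately have "k \<le> multiplicity p a \<or> k \<le> multiplicity p (Lcm A)" by linarith
  then show ?case
  proof
    assume "k \<le> multiplicity p a"
    then show ?thesis unfolding p(2) using multiplicity_dvd' by blast
  next
    assume "k \<le> multiplicity p (Lcm A)"
    then have "P dvd Lcm A" unfolding p(2) using multiplicity_dvd' by blast
    then show ?thesis using insert by auto
  qed
qed

lemma primepow_factors_oddlcm: "primepow_factors (oddlcm x) \<subseteq> {P. primepow P \<and> P \<le> x}"
proof
  fix P assume "P \<in> primepow_factors (oddlcm x)"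
  then have P: "primepow P" "P dvd Lcm {m. odd m \<and> m \<le> x}"
    by (auto simp: primepow_factors_def oddlcm_def)
  have "\<exists>a\<in>{m. odd m \<and> m \<le> x}. P dvd a"
    by (rule primepow_dvd_Lcm) (use P in auto)
  then obtain a where "P dvd a" "odd a" "a \<le> x" by auto
  then show "P \<in> {P. primepow P \<and> P \<le> x}" using P(1) by (auto dest!: dvd_imp_le intro!: Nat.gr0I)
qed

section \<open>Upper bound for the number of prime powers up to x\<close>

definition primorial :: "nat \<Rightarrow> nat" where
  "primorial n = \<Prod>{p. prime p \<and> p \<le> n}"

lemma prod_primes_dvd:
  assumes "finite S" "\<And>p. p \<in> S \<Longrightarrow> prime p \<and> p dvd (n::nat)"
  shows "\<Prod>S dvd n"
  using assms
proof (induction S rule: finite_induct)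
  case (insert p S)
  have "coprime p (\<Prod>S)" 
    by (rule prod_coprime_right) (use insert in \<open>auto intro!: primes_coprime\<close>)
  then show ?case using insert by (simp add: divides_mult)
qed auto

text \<open>Row 2m + 1 of Pascal's triangle has two equal middle entries, and the whole row adds up
  to 2 * 4^m.\<close>

lemma binomial_odd_le: "(2 * m + 1) choose m \<le> 4 ^ m"
proof -
  have "(2 * m + 1) choose (m + 1) = (2 * m + 1) choose m"
    using central_binomial_odd[of "2 * m + 1"] by simp
  then have "2 * ((2 * m + 1) choose m) = (\<Sum>k\<in>{m, m + 1}. (2 * m + 1) choose k)" by simp
  also have "\<dots> \<le> (\<Sum>k\<le>2 * m + 1. (2 * m + 1) choose k)"
    by (rule sum_mono2) auto
  also have "\<dots> = 2 ^ (2 * m + 1)" by (rule choose_row_sum)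
  finally show ?thesis by (simp add: power_mult)
qed

text \<open>Erdos' proof: for n = 2m + 1 every prime in (m + 1, n] divides (n choose m), which is at
  most 4^m, and the primes up to m + 1 are covered by induction.\<close>

lemma primorial_le: "primorial n \<le> 4 ^ n"
proof (induction n rule: less_induct)
  case (less n)
  consider "n = 0" | "n = 1" | "n = 2" | "n > 2" "even n" | "n > 2" "odd n" by linarith
  then show ?case
  proof cases
    case 1
    then have *: "{p. prime p \<and> p \<le> n} = {}" by (auto dest: prime_gt_0_nat)
    show ?thesis by (simp only: primorial_def * prod.empty) simp
  next
    case 2
    then have *: "{p. prime p \<and> p \<le> n} = {}" by (auto dest: prime_gt_1_nat)
    show ?thesis by (simp only: primorial_def * prod.empty) simp
  next
    case 3
    then have "{p. prime p \<and> p \<le> n} = {2}" by (auto dest: prime_gt_1_nat)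
    then show ?thesis using 3 by (simp add: primorial_def)
  next
    case 4
    have "\<not> prime n" using 4 prime_odd_nat by blast
    then have "p \<le> n \<longleftrightarrow> p \<le> n - 1" if "prime p" for p
      using that 4(1) by (cases "p = n") auto
    then have "{p. prime p \<and> p \<le> n} = {p. prime p \<and> p \<le> n - 1}" by blast
    then have "primorial n \<le> 4 ^ (n - 1)" using less[of "n - 1"] 4 by (simp add: primorial_def)
    also have "\<dots> \<le> 4 ^ n" by (intro power_increasing) auto
    finally show ?thesis .
  next
    case 5
    then obtain m where m: "n = 2 * m + 1" by (auto elim: oddE)
    let ?S = "{p. prime p \<and> m + 1 < p \<and> p \<le> n}"
    have "{p. prime p \<and> p \<le> n} = {p. prime p \<and> p \<le> m + 1} \<union> ?S" using m by auto
    then have "primorial n = primorial (m + 1) * \<Prod>?S"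
      unfolding primorial_def by (simp add: prod.union_disjoint disjoint_iff)
    moreover have "primorial (m + 1) \<le> 4 ^ (m + 1)" using less[of "m + 1"] 5(1) m by simp
    moreover have "\<Prod>?S \<le> 4 ^ m"
    proof -
      have "\<Prod>?S dvd (n choose m)"
      proof (rule prod_primes_dvd)
        fix p assume p: "p \<in> ?S"
        then have "p dvd fact n" by (simp add: prime_dvd_fact_iff)
        also have "fact n = fact m * fact (n - m) * (n choose m)"
          using binomial_fact_lemma[of m n] m by simp
        finally have "p dvd fact m \<or> p dvd fact (n - m) \<or> p dvd (n choose m)"
          using p by (simp add: prime_dvd_mult_iff)
        moreover have "prime p" "\<not> p \<le> m" "\<not> p \<le> n - m" using p m by auto
        then have "\<not> p dvd fact m" "\<not> p dvd fact (n - m)" "prime p" by (simp_all only: prime_dvd_fact_iff not_False_eq_True)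
        ultimately show "prime p \<and> p dvd (n choose m)" by blast
      qed auto
      then have "\<Prod>?S \<le> n choose m" by (rule dvd_imp_le) (use m in simp)
      also have "\<dots> \<le> 4 ^ m" using binomial_odd_le m by simp
      finally show ?thesis .
    qed
    ultimately have "primorial n \<le> 4 ^ (m + 1) * 4 ^ m" by (simp only: mult_le_mono)
    also have "(4::nat) ^ (m + 1) * 4 ^ m = 4 ^ n"
      unfolding m power_add[symmetric] by (rule arg_cong[where f = "power 4"]) simp
    finally show ?thesis .
  qed
qed

text \<open>Each counted prime contributes a factor above sqrt x to the primorial, which is at most
  4^x. Taking logarithms gives the constant 4 as 2 * 2, since ln 4 = 2 * ln 2 is at most 2.\<close>

lemma card_large_primes_le:
  assumes "x \<ge> 2"
  shows "real (card {p. prime p \<and> sqrt (real x) < real p \<and> p \<le> x}) * ln (real x) \<le> 4 * real x"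
proof -
  let ?S = "{p. prime p \<and> sqrt (real x) < real p \<and> p \<le> x}"
  have fin: "finite ?S" by (rule finite_subset[of _ "{..x}"]) auto
  have "sqrt (real x) ^ card ?S = (\<Prod>p\<in>?S. sqrt (real x))" by simp
  also have "\<dots> \<le> (\<Prod>p\<in>?S. real p)" by (intro prod_mono) auto
  also have "\<dots> = real (\<Prod>?S)" by simp
  also have "\<Prod>?S \<le> primorial x"
    unfolding primorial_def by (intro dvd_imp_le prod_dvd_prod_subset) (auto intro!: prod_pos prime_gt_0_nat)
  then have "real (\<Prod>?S) \<le> real (primorial x)" by (rule of_nat_mono)
  also have "\<dots> \<le> real (4 ^ x)" using primorial_le by (intro of_nat_mono)
  finally have "sqrt (real x) ^ card ?S \<le> 4 ^ x" by simp
  then have "ln (sqrt (real x) ^ card ?S) \<le> ln (4 ^ x)"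
    using assms by (subst ln_le_cancel_iff) auto
  then have "real (card ?S) * (ln (real x) / 2) \<le> real x * ln 4"
    using assms by (simp add: ln_realpow ln_sqrt)
  also have "ln (4::real) = 2 * ln 2" using ln_realpow[of 2 2] by simp
  also have "ln (2::real) \<le> 1" using ln_le_minus_one[of 2] by simp
  finally show ?thesis using assms by (simp add: algebra_simps mult_left_mono)
qed

text \<open>A prime power up to x is either a prime above sqrt x or p^k with p at most sqrt x and k
  at most log_2 x; pairs (p, k) of the second kind are few.\<close>

lemma card_primepow_le:
  assumes "x \<ge> 2"
  shows "real (card {P. primepow P \<and> P \<le> x}) \<le> 4 * real x / ln (real x) + sqrt (real x) * (1 + log 2 (real x))"
proof -
  let ?S = "{p. prime p \<and> sqrt (real x) < real p \<and> p \<le> x}"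
  let ?r = "nat \<lfloor>sqrt (real x)\<rfloor>" and ?l = "nat \<lfloor>log 2 (real x)\<rfloor>"
  let ?T = "(\<lambda>(p, k). p ^ k) ` ({1..?r} \<times> {0..?l})"
  have "{P. primepow P \<and> P \<le> x} \<subseteq> ?S \<union> ?T"
  proof
    fix P assume "P \<in> {P. primepow P \<and> P \<le> x}"
    then obtain p k where p: "prime p" "k > 0" "P = p ^ k" "P \<le> x" by (auto simp: primepow_def)
    have p2: "p \<ge> 2" using p prime_ge_2_nat by blast
    show "P \<in> ?S \<union> ?T"
    proof (cases "k = 1 \<and> sqrt (real x) < real p")
      case True
      then show ?thesis using p by auto
    next
      case False
      have "real p \<le> sqrt (real x)"
      proof (cases "k = 1")
        case False
        then have "p ^ 2 \<le> p ^ k" using p p2 by (intro power_increasing) auto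
        then have "real (p ^ 2) \<le> real x" using p by linarith
        then show ?thesis by (intro real_le_rsqrt) simp
      qed (use False in auto)
      then have 1: "p \<in> {1..?r}" using p2 by (auto simp: le_nat_iff le_floor_iff)
      have "2 ^ k \<le> p ^ k" using p2 by (intro power_mono) auto
      then have "2 ^ k \<le> x" using p by linarith
      then have "real (2 ^ k) \<le> real x" by (intro of_nat_mono)
      then have "2 powr real k \<le> real x" by (simp add: powr_realpow)
      then have "real k \<le> log 2 (real x)" using assms by (subst le_log_iff) auto
      then have "k \<in> {0..?l}" by (simp add: le_nat_iff le_floor_iff)
      then show ?thesis using 1 p(3) by force
    qed
  qed
  moreover have finS: "finite ?S" by (rule finite_subset[of _ "{..x}"]) auto
  ultimately have "card {P. primepow P \<and> P \<le> x} \<le> card (?S \<union> ?T)"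
    by (intro card_mono) auto
  also have "\<dots> \<le> card ?S + card ?T" by (rule card_Un_le)
  also have "card ?T \<le> card ({1..?r} \<times> {0..?l})" by (rule card_image_le) auto
  also have "\<dots> = ?r * (?l + 1)" by simp
  finally have "real (card {P. primepow P \<and> P \<le> x}) \<le> real (card ?S) + real ?r * (real ?l + 1)"
    by (metis (mono_tags, lifting) add_left_mono of_nat_1 of_nat_add of_nat_le_iff of_nat_mult)
  also have "real ?r * (real ?l + 1) \<le> sqrt (real x) * (log 2 (real x) + 1)"
    using assms by (intro mult_mono) auto
  also have "real (card ?S) \<le> 4 * real x / ln (real x)"
    using card_large_primes_le[OF assms] assms by (simp add: field_simps)
  finally show ?thesis by (simp add: algebra_simps)
qed

text \<open>The term sqrt x * (1 + log_2 x) is itself O(x / ln x). The result bounds the number of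
  fractions used by one elimination.\<close>

lemma primepow_count:
  obtains C :: real where "C > 0"
    "\<And>x. x \<ge> 2 \<Longrightarrow> real (card (primepow_factors (oddlcm x))) \<le> C * real x / ln (real x)"
proof -
  have "((\<lambda>x::real. sqrt x * (1 + log 2 x) * ln x / x) \<longlongrightarrow> 0) at_top" by real_asymp
  then have "(\<lambda>n. sqrt (real n) * (1 + log 2 (real n)) * ln (real n) / real n) \<longlonglongrightarrow> 0"
    by (rule filterlim_compose[OF _ filterlim_real_sequentially])
  then have "Bseq (\<lambda>n. sqrt (real n) * (1 + log 2 (real n)) * ln (real n) / real n)"
    by (rule convergent_imp_Bseq[OF convergentI])
  then obtain K where K: "K > 0" "\<And>n. norm (sqrt (real n) * (1 + log 2 (real n)) * ln (real n) / real n) \<le> K"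
    by (auto elim: BseqE)
  show ?thesis
  proof (rule that)
    show "4 + K > 0" using K by simp
    fix x :: nat assume x: "x \<ge> 2"
    have "sqrt (real x) * (1 + log 2 (real x)) * ln (real x) / real x \<le> K"
      using K(2)[of x] unfolding real_norm_def by (rule abs_le_D1)
    then have 1: "sqrt (real x) * (1 + log 2 (real x)) \<le> K * real x / ln (real x)"
      using x by (simp add: field_simps)
    have "card (primepow_factors (oddlcm x)) \<le> card {P. primepow P \<and> P \<le> x}"
      by (rule card_mono[OF _ primepow_factors_oddlcm]) (rule finite_subset[of _ "{..x}"], auto)
    then show "real (card (primepow_factors (oddlcm x))) \<le> (4 + K) * real x / ln (real x)"
      using card_primepow_le[OF x] 1 by (simp add: add_divide_distrib algebra_simps)
  qed
qed

section \<open>Elimination of odd prime powers from the denominator\<close>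

text \<open>The lowest binary digit of n stands for 1 / 2^B and the digit of weight 2^B for 1 / 1,
  so B + 1 digits represent every multiple of 1 / 2^B below 2. The induction splits off the lowest
  digit.\<close>

lemma dyadic_expansion:
  "n < 2 ^ Suc B \<Longrightarrow> \<exists>D. finite D \<and> D \<subseteq> (\<lambda>j. 2 ^ j) ` {..B} \<and> rsum D = real n / 2 ^ B \<and> \<Sum>D \<le> 2 ^ Suc B"
proof (induction B arbitrary: n)
  case 0
  then consider "n = 0" | "n = 1" by fastforce
  then show ?case
  proof cases
    case 1
    then show ?thesis by (intro exI[of _ "{}"]) simp
  next
    case 2
    then show ?thesis by (intro exI[of _ "{1}"]) (simp add: rsum_def)
  qed
next
  case (Suc B)
  have "n div 2 < 2 ^ Suc B" using Suc.prems by simp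
  then obtain D where D: "finite D" "D \<subseteq> (\<lambda>j. 2 ^ j) ` {..B}" "rsum D = real (n div 2) / 2 ^ B" "\<Sum>D \<le> 2 ^ Suc B"
    using Suc.IH by blast
  have n: "real n = 2 * real (n div 2) + real (n mod 2)"
    by (metis of_nat_add of_nat_mult of_nat_numeral mult_div_mod_eq)
  show ?case
  proof (cases "even n")
    case True
    then have "rsum D = real n / 2 ^ Suc B" using D(3) n by (simp add: field_simps)
    moreover have "D \<subseteq> (\<lambda>j. 2 ^ j) ` {..Suc B}" using D(2) by (force simp: image_iff)
    moreover have "\<Sum>D \<le> 2 ^ Suc (Suc B)" using D(4) by simp
    ultimately show ?thesis using D(1) by blast
  next
    case False
    then have m: "n mod 2 = 1" by presburger
    have notin: "2 ^ Suc B \<notin> D"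
    proof
      assume "2 ^ Suc B \<in> D"
      then obtain j where "j \<le> B" "(2::nat) ^ Suc B = 2 ^ j" using D(2) by blast
      then have "Suc B = j" by (simp only: power_inject_exp[of "2::nat"] one_less_numeral_iff semiring_norm)
      then show False using \<open>j \<le> B\<close> by simp
    qed
    let ?D = "insert (2 ^ Suc B) D"
    have "rsum ?D = real n / 2 ^ Suc B" using D(1,3) notin n m
      by (simp add: rsum_insert) (simp add: field_simps)
    moreover have "?D \<subseteq> (\<lambda>j. 2 ^ j) ` {..Suc B}" using D(2) by (force simp: image_iff)
    moreover have "\<Sum>?D \<le> 2 ^ Suc (Suc B)" using D(1,4) notin by simp
    ultimately show ?thesis using D(1) by blast
  qed
qed

lemma cong_linear_prime:
  fixes u v :: int and p :: nat
  assumes "prime p" "\<not> int p dvd u" "\<not> int p dvd v"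
  obtains m :: nat where "0 < m" "m < p" "int p dvd int m * u - v"
proof -
  have "coprime u (int p)" using assms(1,2) by (metis coprime_commute prime_imp_coprime prime_int_nat_transfer prime_nat_int_transfer)
  then obtain y where y: "[u * y = 1] (mod int p)" using cong_solve_coprime_int by blast
  define m where "m = nat ((v * y) mod int p)"
  have p0: "int p > 0" using assms(1) prime_gt_0_nat by auto
  have m: "int m = (v * y) mod int p" unfolding m_def using p0 by simp
  have "[int m * u = (v * y) * u] (mod int p)" unfolding m by (intro cong_mult cong_refl) simp
  also have "(v * y) * u = v * (u * y)" by simp
  also have "[v * (u * y) = v * 1] (mod int p)" using y by (intro cong_mult) auto
  finally have d: "int p dvd int m * u - v" by (simp add: cong_iff_dvd_diff)
  have "m \<noteq> 0"
  proof
    assume "m = 0"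
    then have "int p dvd - v" using d by simp
    then show False using assms(3) by simp
  qed
  moreover have "m < p" using m p0 by (metis of_nat_less_iff pos_mod_bound)
  ultimately show ?thesis using that d by blast
qed

text \<open>The property of the odd part of \<open>lcm(1, ..., x)\<close> that survives dividing out the largest prime: the
  cofactor \<open>m < p\<close> of an eliminating fraction introduces no new odd prime powers.\<close>

definition closed_modulus :: "nat \<Rightarrow> bool" where
  "closed_modulus M \<longleftrightarrow> odd M \<and> (\<forall>p r. prime p \<and> p dvd M \<and> odd r \<and> r < p \<longrightarrow> r dvd M)"

text \<open>Since p is the largest prime factor, every odd r below some remaining prime is below p,
  hence coprime to p, and survives the division.\<close>

lemma closed_modulus_strip:
  assumes "closed_modulus (p * M)" "prime p" "\<And>q. prime q \<Longrightarrow> q dvd p * M \<Longrightarrow> q \<le> p"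
  shows "closed_modulus M"
  unfolding closed_modulus_def
proof (intro conjI allI impI)
  show "odd M" using assms(1) by (auto simp: closed_modulus_def)
  fix q r assume "prime q \<and> q dvd M \<and> odd r \<and> r < q"
  then have q: "prime q" "q dvd M" "odd r" "r < q" by auto
  have "q dvd p * M" using q by simp
  then have "r dvd p * M" using assms(1) q unfolding closed_modulus_def by blast
  have "q \<le> p" using assms(3) q by auto
  then have "r < p" using q by simp
  then have "coprime p r" using assms(2) q(3)
    by (intro prime_imp_coprime) (auto dest!: dvd_imp_le intro!: Nat.gr0I)
  then show "r dvd M" using \<open>r dvd p * M\<close> by (simp add: coprime_dvd_mult_right_iff coprime_commute)
qed

text \<open>A prime power P = p^j is charged one denominator P * 2^a * m with m < p, where P * 2^a
  is either P itself or less than 2 * X.\<close>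

definition elim_cost :: "nat \<Rightarrow> nat \<Rightarrow> nat" where
  "elim_cost X M = (\<Sum>P\<in>primepow_factors M. aprimedivisor P * max (2 * X) P)"

lemma odd_elimination:
  assumes "X > 0" "2 * X * x \<le> 2 ^ B"
  shows "closed_modulus M \<Longrightarrow> (\<And>p. prime p \<Longrightarrow> p dvd M \<Longrightarrow> p \<le> x) \<Longrightarrow> 2 ^ B * real M * \<rho> \<in> \<int> \<Longrightarrow>
    \<exists>E. finite E \<and> (\<forall>e\<in>E. e dvd 2 ^ B * M \<and> X \<le> e \<and> (\<exists>p. prime p \<and> odd p \<and> p dvd e)) \<and>
      rsum E \<le> real (card (primepow_factors M)) / real X \<and> \<Sum>E \<le> elim_cost X M \<and>
      2 ^ B * (\<rho> - rsum E) \<in> \<int>"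
proof (induction M arbitrary: \<rho> rule: less_induct)
  case (less M)
  have M0: "M > 0" "odd M" using less.prems(1) by (auto simp: closed_modulus_def intro!: Nat.gr0I)
  show ?case
  proof (cases "M = 1")
    case True
    then show ?thesis using less.prems(3) by (intro exI[of _ "{}"]) auto
  next
    case False
    define p where "p = Max (prime_factors M)"
    obtain q0 where "prime q0" "q0 dvd M" using prime_factor_nat[OF False] by blast
    then have "q0 \<in> prime_factors M" using M0(1) by (simp add: in_prime_factors_iff)
    then have ne: "prime_factors M \<noteq> {}" by blast
    then have "p \<in> prime_factors M" unfolding p_def by (intro Max_in) auto
    then have p: "prime p" "p dvd M" by auto
    have pmax: "q \<le> p" if "prime q" "q dvd M" for q
      unfolding p_def using that M0 by (intro Max_ge) (auto simp: in_prime_factors_iff)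
    have oddp: "odd p" using M0 p(2) by (meson dvd_trans)
    have p2: "p \<ge> 2" using p prime_ge_2_nat by blast
    define j where "j = multiplicity p M"
    have "\<not> is_unit p" using p(1) by auto
    then obtain M1 where M1: "M = p ^ j * M1" "\<not> p dvd M1"
      using M0 multiplicity_decompose'[of M p] unfolding j_def by blast
    have j1: "j > 0" unfolding j_def using p M0 by (simp add: prime_multiplicity_gt_zero_iff)
    obtain M2 where M2: "M = p * M2" using p(2) by auto
    have M2': "M2 = p ^ (j - 1) * M1"
      using M2 M1(1) j1 p2 by (cases j) auto
    have lt: "M2 < M" using M2 M0 p2 by (cases "M2 = 0") auto
    have cl: "closed_modulus M2"
      using closed_modulus_strip[of p M2] less.prems(1) p(1) pmax M2 by auto
    have sm: "q \<le> x" if "prime q" "q dvd M2" for q using less.prems(2) that M2 by auto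
    obtain u where u: "2 ^ B * real M * \<rho> = of_int u" using less.prems(3) by (auto elim: Ints_cases)
    have pf: "primepow_factors M2 \<subseteq> primepow_factors M" using M2 by (auto simp: primepow_factors_def)
    have finM: "finite (primepow_factors M)" using M0 finite_primepow_factors by blast
    have PjM: "p ^ j \<in> primepow_factors M" using p j1 M1 by (auto simp: primepow_factors_def)
    have M20: "M2 > 0" using M2 M0 by (auto intro!: Nat.gr0I)
    have Pj2: "\<not> p ^ j dvd 2 ^ B * M2"
    proof
      assume "p ^ j dvd 2 ^ B * M2"
      moreover have "coprime (p ^ j) (2 ^ B)" using oddp by (simp add: coprime_right_2_iff_odd)
      ultimately have "p ^ j dvd M2" by (simp add: coprime_dvd_mult_right_iff)
      then have "p * p ^ (j - 1) dvd p ^ (j - 1) * M1" using M2' j1 by (simp flip: power_Suc)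
      then show False using M1(2) p2 by (simp add: mult.commute)
    qed
    have PjM2: "p ^ j \<notin> primepow_factors M2" using Pj2 by (auto simp: primepow_factors_def)
    have cost: "aprimedivisor (p ^ j) * max (2 * X) (p ^ j) + elim_cost X M2 \<le> elim_cost X M"
    proof -
      have "aprimedivisor (p ^ j) * max (2 * X) (p ^ j) + elim_cost X M2
        = (\<Sum>P\<in>insert (p ^ j) (primepow_factors M2). aprimedivisor P * max (2 * X) P)"
        unfolding elim_cost_def using PjM2 finM pf by (simp add: finite_subset)
      also have "\<dots> \<le> elim_cost X M"
        unfolding elim_cost_def using pf PjM finM by (intro sum_mono2) auto
      finally show ?thesis .
    qed
    have ap: "aprimedivisor (p ^ j) = p" using p j1 by (simp add: aprimedivisor_prime_power)
    have card2: "card (primepow_factors M2) + 1 \<le> card (primepow_factors M)"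
    proof -
      have "card (insert (p ^ j) (primepow_factors M2)) \<le> card (primepow_factors M)"
        using pf PjM finM by (intro card_mono) auto
      then show ?thesis using PjM2 finM pf by (simp add: finite_subset)
    qed
    show ?thesis
    proof (cases "int p dvd u")
      case True
      then obtain z where z: "u = int p * z" by auto
      have "real p * (2 ^ B * real M2 * \<rho>) = real p * of_int z"
        using u unfolding M2 z by (simp add: algebra_simps)
      then have "2 ^ B * real M2 * \<rho> = of_int z" using p2 by simp
      then have "2 ^ B * real M2 * \<rho> \<in> \<int>" by simp
      from less.IH[OF lt cl sm this] obtain E where E: "finite E"
        "\<forall>e\<in>E. e dvd 2 ^ B * M2 \<and> X \<le> e \<and> (\<exists>p. prime p \<and> odd p \<and> p dvd e)"
        "rsum E \<le> real (card (primepow_factors M2)) / real X" "\<Sum>E \<le> elim_cost X M2"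
        "2 ^ B * (\<rho> - rsum E) \<in> \<int>" by blast
      have "e dvd 2 ^ B * M" if "e \<in> E" for e using E(2) that M2 by (metis dvd_mult dvd_mult2 mult.left_commute)
      moreover have "rsum E \<le> real (card (primepow_factors M)) / real X"
        using card2 by (intro order_trans[OF E(3)] divide_right_mono of_nat_mono) auto
      moreover have "\<Sum>E \<le> elim_cost X M" using E(4) cost by linarith
      ultimately show ?thesis using E by blast
    next
      case False
      have ex: "\<exists>a. X \<le> p ^ j * 2 ^ a"
      proof -
        have "X \<le> 2 ^ X" by (simp add: less_imp_le)
        also have "\<dots> \<le> p ^ j * 2 ^ X" using p2 by simp
        finally show ?thesis by blast
      qed
      \<comment> \<open>The least power of two that lifts p^j to X; minimality gives p^j * 2^a < 2 *
        X unless a = 0, which is the maximum in \<open>elim_cost\<close>.\<close>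
      define a where "a = (LEAST a. X \<le> p ^ j * 2 ^ a)"
      have a1: "X \<le> p ^ j * 2 ^ a" unfolding a_def using ex by (rule LeastI_ex)
      have a2: "a = 0 \<or> p ^ j * 2 ^ a < 2 * X"
      proof (cases a)
        case (Suc b)
        then have "\<not> X \<le> p ^ j * 2 ^ b" using not_less_Least[of b "\<lambda>a. X \<le> p ^ j * 2 ^ a"] a_def by auto
        then show ?thesis using Suc by simp
      qed simp
      have px: "p \<le> x" using less.prems(2) p by auto
      have pj1: "p ^ j \<ge> 1" using p2 by simp
      have a2X: "2 ^ a \<le> 2 * X"
      proof -
        have *: "1 * 2 ^ a \<le> p ^ j * 2 ^ a" using pj1 by (intro mult_le_mono) auto
        show ?thesis
        proof (cases "a = 0")
          case False
          then have "p ^ j * 2 ^ a < 2 * X" using a2 by simp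
          then show ?thesis using * by linarith
        qed (use assms(1) in simp)
      qed
      \<comment> \<open>Since m < p is at most x, this leaves room in 2^B for the power of two
        contained in m as well.\<close>
      have aB: "2 ^ a * x \<le> 2 ^ B" using mult_le_mono1[OF a2X, of x] assms(2) by linarith
      then have "2 ^ a * 1 \<le> 2 ^ a * x" using px p2 by (intro mult_le_mono) auto
      then have "(2::nat) ^ a \<le> 2 ^ B" using aB by linarith
      then have ab: "a \<le> B" by simp
      have "\<not> int p dvd 2 ^ (B - a) * int M1"
      proof
        assume "int p dvd 2 ^ (B - a) * int M1"
        then have "int p dvd int (2 ^ (B - a) * M1)" by simp
        then have "p dvd 2 ^ (B - a) * M1" by (simp only: of_nat_dvd_iff)
        then have "p dvd 2 ^ (B - a) \<or> p dvd M1" using p(1) prime_dvd_mult_iff by blast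
        then have "p dvd 2" using M1(2) p(1) prime_dvd_power by blast
        then have "p = 2" using p2 dvd_imp_le[of p 2] by simp
        then show False using oddp by simp
      qed
      \<comment> \<open>Over the denominator 2^B * M the fraction 1 / (p^j * 2^a * m) has numerator
        w with m * w = 2^(B - a) * M1. Hence p divides u - w exactly when it divides m * u - 2^(B -
        a) * M1.\<close>
      then obtain m where m: "0 < m" "m < p" "int p dvd int m * u - 2 ^ (B - a) * int M1"
        using cong_linear_prime[OF p(1) False] by metis
      obtain i r where ir: "odd r" "m = 2 ^ i * r" by (rule two_power_odd_decomp[OF m(1)])
      have r0: "r > 0" using ir m by (auto intro!: Nat.gr0I)
      have "r \<le> m" unfolding ir(2) by simp
      have "r < p" using \<open>r \<le> m\<close> m(2) by simp
      then have "r dvd M" using less.prems(1) p ir(1) unfolding closed_modulus_def by blast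
      moreover have "coprime r (p ^ j)"
      proof -
        have "\<not> p dvd r" using \<open>r \<le> m\<close> m(2) r0 by (auto dest!: dvd_imp_le)
        then show ?thesis using p(1) prime_imp_coprime coprime_commute coprime_power_right_iff by metis
      qed
      ultimately have rM1: "r dvd M1" unfolding M1(1) by (simp add: coprime_dvd_mult_right_iff)
      have "2 ^ i * 1 \<le> m" unfolding ir(2) using r0 by (intro mult_le_mono) auto
      then have i1: "2 ^ a * 2 ^ i \<le> 2 ^ a * x" using m px by (intro mult_le_mono) auto
      have "(2::nat) ^ (a + i) \<le> 2 ^ B" unfolding power_add using i1 aB by (rule order_trans)
      then have "a + i \<le> B" by simp
      then have "2 ^ (a + i) * r dvd 2 ^ B * M1" using rM1 by (intro mult_dvd_mono le_imp_power_dvd) auto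
      then have d1: "2 ^ a * m dvd 2 ^ B * M1" unfolding ir(2) by (simp add: power_add mult.assoc)
      then obtain w where w: "2 ^ B * M1 = 2 ^ a * m * w" by auto
      have "(2::nat) ^ B = 2 ^ a * 2 ^ (B - a)" using ab by (simp flip: power_add)
      then have "2 ^ a * (2 ^ (B - a) * M1) = 2 ^ a * (m * w)"
        using w by (simp only: mult.assoc)
      then have w': "2 ^ (B - a) * M1 = m * w" by simp
      have "2 ^ (B - a) * int M1 = int m * int w" using arg_cong[OF w', of int] by simp
      then have "int p dvd int m * (u - int w)" using m(3) by (simp only: right_diff_distrib)
      moreover have "\<not> int p dvd int m" using m(1,2) by (auto dest!: zdvd_imp_le)
      moreover have "prime (int p)" using p(1) by simp
      ultimately have "int p dvd u - int w" by (simp only: prime_dvd_mult_iff) blast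
      then obtain z where z: "u - int w = int p * z" by auto
      define e where "e = p ^ j * 2 ^ a * m"
      have e0: "e > 0" unfolding e_def using m p2 by simp
      have e1: "2 ^ B * real M2 * (1 / real e) = real w / real p"
      proof -
        have "real (2 ^ B * M1) = 2 ^ a * real m * real w" unfolding w by simp
        moreover have "real p ^ j = real p * real p ^ (j - 1)" using j1 by (cases j) auto
        ultimately show ?thesis unfolding M2' e_def using m p2
          by (simp add: field_simps)
      qed
      have "real p * (2 ^ B * real M2 * \<rho>) = of_int u" using u unfolding M2 by (simp add: algebra_simps)
      then have "2 ^ B * real M2 * \<rho> = of_int u / real p" using p2 by (simp add: field_simps)
      then have "2 ^ B * real M2 * (\<rho> - 1 / real e) = of_int (u - int w) / real p"
        using e1 by (simp add: right_diff_distrib diff_divide_distrib)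
      also have "\<dots> = of_int z" unfolding z using p2 by simp
      finally have "2 ^ B * real M2 * (\<rho> - 1 / real e) \<in> \<int>" by simp
      from less.IH[OF lt cl sm this] obtain E where E: "finite E"
        "\<forall>e\<in>E. e dvd 2 ^ B * M2 \<and> X \<le> e \<and> (\<exists>p. prime p \<and> odd p \<and> p dvd e)"
        "rsum E \<le> real (card (primepow_factors M2)) / real X" "\<Sum>E \<le> elim_cost X M2"
        "2 ^ B * (\<rho> - 1 / real e - rsum E) \<in> \<int>" by blast
      have pje: "p ^ j dvd e" by (simp add: e_def mult.assoc)
      \<comment> \<open>All later denominators divide 2^B * M2, which has lost one factor p, while e
        still contains p^j.\<close>
      have eE: "e \<notin> E" using E(2) Pj2 pje dvd_trans by blast
      have edvd: "e dvd 2 ^ B * M" 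
      proof -
        have "p ^ j * (2 ^ a * m) dvd p ^ j * (2 ^ B * M1)" by (rule mult_dvd_mono[OF dvd_refl d1])
        then show ?thesis unfolding e_def M1(1) by (simp add: mult_ac)
      qed
      have Xe: "X \<le> e"
      proof -
        have "p ^ j * 2 ^ a * 1 \<le> e" unfolding e_def using m by (intro mult_le_mono) auto
        then show ?thesis using a1 by simp
      qed
      have ecost: "e \<le> p * max (2 * X) (p ^ j)"
      proof -
        have "p ^ j * 2 ^ a \<le> max (2 * X) (p ^ j)" using a2 by auto
        then have "p ^ j * 2 ^ a * m \<le> max (2 * X) (p ^ j) * p" using m by (intro mult_le_mono) auto
        then show ?thesis unfolding e_def by (simp add: mult.commute)
      qed
      have 1: "rsum (insert e E) \<le> real (card (primepow_factors M)) / real X"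
      proof -
        have "rsum (insert e E) = 1 / real e + rsum E" using E(1) eE by (simp add: rsum_insert)
        also have "1 / real e \<le> 1 / real X" using Xe assms(1) by (intro divide_left_mono) auto
        also have "1 / real X + rsum E \<le> 1 / real X + real (card (primepow_factors M2)) / real X" using E(3) by simp
        also have "\<dots> = real (card (primepow_factors M2) + 1) / real X" by (simp add: add_divide_distrib)
        also have "\<dots> \<le> real (card (primepow_factors M)) / real X" using card2
          by (intro divide_right_mono of_nat_mono) auto
        finally show ?thesis by simp
      qed
      have 2: "\<Sum>(insert e E) \<le> elim_cost X M"
        using E(1,4) eE ecost cost ap by simp
      have 3: "2 ^ B * (\<rho> - rsum (insert e E)) \<in> \<int>"
        using E(1,5) eE by (simp add: rsum_insert diff_diff_add)
      have 4: "\<forall>e'\<in>insert e E. e' dvd 2 ^ B * M \<and> X \<le> e' \<and> (\<exists>p. prime p \<and> odd p \<and> p dvd e')"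
      proof
        fix e' assume "e' \<in> insert e E"
        then consider "e' = e" | "e' \<in> E" by blast
        then show "e' dvd 2 ^ B * M \<and> X \<le> e' \<and> (\<exists>p. prime p \<and> odd p \<and> p dvd e')"
        proof cases
          case 1
          have "p dvd p ^ j" using j1 by simp
          then have "p dvd e" using pje dvd_trans by blast
          then show ?thesis using 1 edvd Xe p(1) oddp by blast
        next
          case 2
          then have "e' dvd 2 ^ B * M" using E(2) M2 by (metis dvd_mult dvd_mult2 mult.left_commute)
          then show ?thesis using 2 E(2) by blast
        qed
      qed
      show ?thesis using E(1) 1 2 3 4 by (intro exI[of _ "insert e E"]) auto
    qed
  qed
qed

text \<open>The lower bound on \<rho> makes the remainder after the elimination nonnegative, and
  \<rho> < 2 lets B + 1 binary digits express it. The two parts are disjoint because every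
  eliminating denominator has an odd prime factor.\<close>

lemma unit_fraction_sum:
  assumes "X > 0" "2 * X * x \<le> 2 ^ B" "closed_modulus M" "\<And>p. prime p \<Longrightarrow> p dvd M \<Longrightarrow> p \<le> x"
    "2 ^ B * real M * \<rho> \<in> \<int>" "real (card (primepow_factors M)) / real X \<le> \<rho>" "\<rho> < 2"
  obtains E where "finite E" "rsum E = \<rho>" "\<And>e. e \<in> E \<Longrightarrow> e dvd 2 ^ B * M"
    "\<And>e. e \<in> E \<Longrightarrow> X \<le> e \<or> (\<exists>i. e = 2 ^ i)" "\<Sum>E \<le> 2 ^ Suc B + elim_cost X M"
proof -
  obtain E where E: "finite E"
      "\<forall>e\<in>E. e dvd 2 ^ B * M \<and> X \<le> e \<and> (\<exists>p. prime p \<and> odd p \<and> p dvd e)"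
      "rsum E \<le> real (card (primepow_factors M)) / real X" "\<Sum>E \<le> elim_cost X M"
      "2 ^ B * (\<rho> - rsum E) \<in> \<int>"
    using odd_elimination[OF assms(1-5)] by blast
  obtain z where z: "2 ^ B * (\<rho> - rsum E) = of_int z" using E(5) by (auto elim: Ints_cases)
  have "0 \<le> \<rho> - rsum E" using E(3) assms(6) by linarith
  then have "0 \<le> 2 ^ B * (\<rho> - rsum E)" by simp
  then have z0: "z \<ge> 0" unfolding z by simp
  have "\<rho> - rsum E < 2" using assms(7) rsum_nonneg[of E] by linarith
  then have "2 ^ B * (\<rho> - rsum E) < 2 ^ B * 2" by simp
  then have "of_int z < (2::real) ^ Suc B" unfolding z by simp
  then have "of_int z < (of_int (2 ^ Suc B) :: real)" by simp
  then have "z < 2 ^ Suc B" by linarith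
  then have "nat z < 2 ^ Suc B" using z0 by (simp add: nat_less_iff)
  then obtain D where D: "finite D" "D \<subseteq> (\<lambda>j. 2 ^ j) ` {..B}" "rsum D = real (nat z) / 2 ^ B" "\<Sum>D \<le> 2 ^ Suc B"
    using dyadic_expansion by blast
  have "2 ^ B * rsum D = of_int z" using D(3) z0 by simp
  then have "2 ^ B * rsum D = 2 ^ B * (\<rho> - rsum E)" using z by simp
  then have rD: "rsum D = \<rho> - rsum E" by (simp only: mult_cancel_left) simp
  have disj: "E \<inter> D = {}"
  proof -
    have "False" if e: "e \<in> E" "e \<in> D" for e
    proof -
      obtain i where "e = 2 ^ i" using D(2) e by blast
      moreover obtain p where "prime p" "odd p" "p dvd e" using E(2) e by blast
      ultimately have "p dvd 2" using prime_dvd_power by blast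
      then have "p = 2" using \<open>prime p\<close> primes_dvd_imp_eq two_is_prime_nat by blast
      then show False using \<open>odd p\<close> by simp
    qed
    then show ?thesis by blast
  qed
  have "\<Sum>(E \<union> D) \<le> 2 ^ Suc B + elim_cost X M"
    using E(1,4) D(1,4) disj by (simp add: sum.union_disjoint)
  moreover have "rsum (E \<union> D) = \<rho>" using rD E(1) D(1) disj by (simp add: rsum_Un)
  moreover have "e dvd 2 ^ B * M" if "e \<in> E \<union> D" for e
    using that E(2) D(2) by (auto intro: dvd_mult2 le_imp_power_dvd)
  moreover have "X \<le> e \<or> (\<exists>i. e = 2 ^ i)" if "e \<in> E \<union> D" for e
    using that E(2) D(2) by auto
  ultimately show ?thesis using E(1) D(1) that[of "E \<union> D"] by blast
qed

section \<open>Removing an arbitrary modulus by means of the odd part of lcm(1, ..., x)\<close>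

lemma closed_modulus_oddlcm: "closed_modulus (oddlcm x)"
  unfolding closed_modulus_def
proof (intro conjI allI impI)
  show "odd (oddlcm x)" by (rule odd_oddlcm)
  fix p r assume a: "prime p \<and> p dvd oddlcm x \<and> odd r \<and> r < p"
  then have "p \<in> primepow_factors (oddlcm x)" by (auto simp: primepow_factors_def)
  then have "p \<le> x" using primepow_factors_oddlcm by blast
  then show "r dvd oddlcm x" using a dvd_oddlcm by auto
qed

lemma prime_dvd_oddlcm_le: "prime p \<Longrightarrow> p dvd oddlcm x \<Longrightarrow> p \<le> x"
proof -
  assume "prime p" "p dvd oddlcm x"
  then have "p \<in> primepow_factors (oddlcm x)" by (auto simp: primepow_factors_def)
  then show "p \<le> x" using primepow_factors_oddlcm by blast
qed

lemma card_primepow_factors_oddlcm_le: "card (primepow_factors (oddlcm x)) \<le> x"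
proof -
  have "primepow_factors (oddlcm x) \<subseteq> {1..x}"
    using primepow_factors_oddlcm[of x] primepow_gt_0_nat by fastforce
  then show ?thesis using card_mono[of "{1..x}"] by fastforce
qed

text \<open>With X = x, a prime power up to x costs at most x * 2x, and the dyadic part costs at
  most 8 * x^2. The count is kept explicit so that the factor 1 / ln x can be inserted
  later.\<close>

definition kill_cost :: "nat \<Rightarrow> nat" where
  "kill_cost x = 8 * x ^ 2 + 2 * x ^ 2 * card (primepow_factors (oddlcm x))"

text \<open>Crude form with at most x prime powers, for places where a polynomial bound in x
  suffices.\<close>

lemma kill_cost_le: "x \<ge> 2 \<Longrightarrow> kill_cost x \<le> 6 * x ^ 3"
proof -
  assume x: "x \<ge> 2"
  have "2 * x ^ 2 * card (primepow_factors (oddlcm x)) \<le> 2 * x ^ 2 * x"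
    using card_primepow_factors_oddlcm_le by (intro mult_le_mono) auto
  moreover have "x ^ 2 * 2 \<le> x ^ 2 * x" using x by (intro mult_le_mono) auto
  moreover have "x ^ 2 * x = x ^ 3" by (simp add: power3_eq_cube power2_eq_square)
  ultimately show ?thesis unfolding kill_cost_def by linarith
qed

text \<open>A modulus \<open>Q\<close> is removed from a denominator by subtracting the fractions \<open>1 / (Q * e)\<close>, \<open>e \<in> E\<close>: only
  the residue of \<open>r\<close> modulo \<open>Q\<close> matters, so \<open>r / oddlcm x\<close> may be taken in \<open>[1, 2)\<close>.\<close>

lemma kill_modulus:
  fixes t :: int
  assumes "x \<ge> 2" "Q > 0" "Q \<le> oddlcm x"
  obtains E r where "finite E" "rsum E = real r / real (oddlcm x)" "[int r = t] (mod int Q)"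
    "1 \<le> rsum E" "rsum E < 2" "\<And>p e. e \<in> E \<Longrightarrow> prime p \<Longrightarrow> p dvd e \<Longrightarrow> p \<le> x" "0 \<notin> E"
    "\<Sum>E \<le> kill_cost x"
proof -
  let ?M = "oddlcm x"
  define r where "r = ?M + nat ((t - int ?M) mod int Q)"
  have Q0: "int Q > 0" using assms by simp
  have ir: "int r = int ?M + (t - int ?M) mod int Q" unfolding r_def using Q0 by simp
  have "[int r = int ?M + (t - int ?M)] (mod int Q)" unfolding ir by (intro cong_add cong_refl) simp
  then have c: "[int r = t] (mod int Q)" by simp
  have "(t - int ?M) mod int Q < int Q" using Q0 by simp
  then have r2: "r < 2 * ?M" using ir assms(3) by linarith
  have r1: "?M \<le> r" by (simp add: r_def)
  have M0: "?M > 0" by (rule oddlcm_pos)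
  obtain b where b: "2 ^ b \<le> 2 * x ^ 2" "2 * x ^ 2 < 2 ^ Suc b"
    using ex_power_ivl1[of 2 "2 * x ^ 2"] assms(1) by auto
  have x0: "x > 0" using assms by simp
  have B: "2 * x * x \<le> 2 ^ Suc b" using b by (simp add: power2_eq_square)
  have i: "2 ^ Suc b * real ?M * (real r / real ?M) \<in> \<int>"
  proof -
    have "2 ^ Suc b * real ?M * (real r / real ?M) = real (2 ^ Suc b * r)" using M0 by simp
    then show ?thesis by (metis Ints_of_nat)
  qed
  \<comment> \<open>At most x fractions, each at most 1 / x, remove no more than 1, and r was taken
    between \<open>?M\<close> and 2 * \<open>?M\<close>.\<close>
  have "real (card (primepow_factors ?M)) / real x \<le> 1"
    using card_primepow_factors_oddlcm_le[of x] x0 by simp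
  also have "1 \<le> real r / real ?M" using r1 M0 by simp
  finally have 1: "real (card (primepow_factors ?M)) / real x \<le> real r / real ?M" .
  have 2: "real r / real ?M < 2" using r2 M0 by (simp add: divide_less_eq)
  obtain E where E: "finite E" "rsum E = real r / real ?M" "\<And>e. e \<in> E \<Longrightarrow> e dvd 2 ^ Suc b * ?M"
     "\<And>e. e \<in> E \<Longrightarrow> x \<le> e \<or> (\<exists>i. e = 2 ^ i)" "\<Sum>E \<le> 2 ^ Suc (Suc b) + elim_cost x ?M"
    using unit_fraction_sum[OF x0 B closed_modulus_oddlcm prime_dvd_oddlcm_le i 1 2] by metis
  have ec: "elim_cost x ?M \<le> 2 * x ^ 2 * card (primepow_factors ?M)"
  proof -
    have "aprimedivisor P * max (2 * x) P \<le> 2 * x ^ 2" if "P \<in> primepow_factors ?M" for P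
    proof -
      have "primepow P" "P \<le> x" using that primepow_factors_oddlcm by auto
      moreover have "aprimedivisor P \<le> P" using \<open>primepow P\<close> by (intro aprimedivisor_le_nat) (auto dest: primepow_gt_Suc_0)
      ultimately have "aprimedivisor P * max (2 * x) P \<le> x * (2 * x)" by (intro mult_le_mono) auto
      then show ?thesis by (simp add: power2_eq_square mult_ac)
    qed
    then have "elim_cost x ?M \<le> (\<Sum>P\<in>primepow_factors ?M. 2 * x ^ 2)" unfolding elim_cost_def by (rule sum_mono)
    then show ?thesis by (simp add: mult.commute)
  qed
  have "\<Sum>E \<le> kill_cost x" using E(5) ec b(1) unfolding kill_cost_def by simp
  moreover have "0 \<notin> E" using E(3)[of 0] M0 by auto
  moreover have "p \<le> x" if "e \<in> E" "prime p" "p dvd e" for p e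
  proof -
    have "p dvd 2 ^ Suc b * ?M" using E(3) that dvd_trans by blast
    then have "p dvd 2 ^ Suc b \<or> p dvd ?M" using that(2) prime_dvd_mult_iff by blast
    then show ?thesis
    proof
      assume "p dvd 2 ^ Suc b"
      then have "p dvd 2" using that(2) prime_dvd_power by blast
      then show ?thesis using assms(1) dvd_imp_le[of p 2] by linarith
    qed (use that prime_dvd_oddlcm_le in blast)
  qed
  ultimately show ?thesis
    using that[of E r] E(1,2) c 2 r1 M0 by simp
qed

section \<open>Filling an initial interval\<close>

definition smooth :: "nat \<Rightarrow> nat \<Rightarrow> bool" where
  "smooth x s \<longleftrightarrow> s > 0 \<and> (\<forall>p. prime p \<longrightarrow> p dvd s \<longrightarrow> p \<le> x)"

definition rough :: "nat \<Rightarrow> nat \<Rightarrow> bool" where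
  "rough x d \<longleftrightarrow> d > 0 \<and> (\<forall>p. prime p \<longrightarrow> p dvd d \<longrightarrow> x < p)"

lemma coprime_natI_prime:
  assumes "\<And>p. prime p \<Longrightarrow> p dvd a \<Longrightarrow> p dvd b \<Longrightarrow> False"
  shows "coprime a (b :: nat)"
proof (rule ccontr)
  assume "\<not> coprime a b"
  then have "gcd a b \<noteq> 1" unfolding coprime_iff_gcd_eq_1 .
  from prime_factor_nat[OF this] obtain p where p: "prime p" "p dvd gcd a b" by blast
  have "p dvd a" using p(2) by (rule dvd_trans) (rule gcd_dvd1)
  moreover have "p dvd b" using p(2) by (rule dvd_trans) (rule gcd_dvd2)
  ultimately show False using assms p(1) by blast
qed

lemma rough_smooth_coprime: "rough x d \<Longrightarrow> smooth x s \<Longrightarrow> coprime d s"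
  unfolding rough_def smooth_def by (intro coprime_natI_prime) (meson leD)

lemma smooth_le: "0 < s \<Longrightarrow> s \<le> x \<Longrightarrow> smooth x s"
  by (auto simp: smooth_def dest!: dvd_imp_le)

lemma rough_gt: "rough x d \<Longrightarrow> d > 1 \<Longrightarrow> x < d"
proof -
  assume d: "rough x d" "d > 1"
  then obtain p where p: "prime p" "p dvd d" using prime_factor_nat[of d] by auto
  then have "x < p" using d(1) unfolding rough_def by blast
  moreover have "p \<le> d" using p(2) d(2) by (intro dvd_imp_le) auto
  ultimately show ?thesis by linarith
qed

text \<open>s is the largest smooth divisor: a prime up to x in the cofactor could be moved into
  s.\<close>

lemma rough_smooth_decomp:
  assumes "n > 0"
  obtains d s where "rough x d" "smooth x s" "n = d * s"
proof -
  let ?S = "{s. s dvd n \<and> smooth x s}"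
  have fin: "finite ?S" using assms by (intro finite_subset[of ?S "{..n}"]) (auto dest: dvd_imp_le)
  have "1 \<in> ?S" by (auto simp: smooth_def)
  then have m: "Max ?S \<in> ?S" using fin by (intro Max_in) auto
  define s where "s = Max ?S"
  have s: "s dvd n" "smooth x s" using m by (auto simp: s_def)
  obtain d where d: "n = s * d" using s(1) by blast
  have "x < p" if p: "prime p" "p dvd d" for p
  proof (rule ccontr)
    assume "\<not> x < p"
    then have px: "p \<le> x" by simp
    obtain c where c: "d = p * c" using p(2) by blast
    have "smooth x (s * p)" using s(2) p(1) px prime_gt_0_nat[OF p(1)]
      by (auto simp: smooth_def prime_dvd_mult_iff dest: primes_dvd_imp_eq)
    moreover have "s * p dvd n" unfolding d c by simp
    ultimately have "s * p \<le> s" unfolding s_def using fin by (intro Max_ge) auto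
    moreover have "s > 0" using s(2) by (simp add: smooth_def)
    ultimately show False using prime_gt_1_nat[OF p(1)] by simp
  qed
  moreover have "d > 0" using assms d by (auto intro!: Nat.gr0I)
  ultimately have "rough x d" by (auto simp: rough_def)
  then show ?thesis using that s(2) d by (simp add: mult.commute)
qed

lemma rough_smooth_unique:
  assumes "rough x d" "smooth x s" "rough x d'" "smooth x s'" "d * s = d' * s'"
  shows "d = d'" "s = s'"
proof -
  have "d dvd d' * s'" using assms(5) by (metis dvd_triv_left)
  then have 1: "d dvd d'" using rough_smooth_coprime[OF assms(1,4)] by (simp add: coprime_dvd_mult_left_iff)
  have "d' dvd d * s" using assms(5) by (metis dvd_triv_left)
  then have 2: "d' dvd d" using rough_smooth_coprime[OF assms(3,2)] by (simp add: coprime_dvd_mult_left_iff)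
  show "d = d'" using 1 2 by (rule dvd_antisym)
  then show "s = s'" using assms(1,5) by (auto simp: rough_def)
qed

lemma rsum_Un_le: "finite A \<Longrightarrow> finite B \<Longrightarrow> rsum (A \<union> B) \<le> rsum A + rsum B"
  unfolding rsum_def using sum.union_inter[of A B "\<lambda>a. 1 / real a"] sum_nonneg[of "A \<inter> B" "\<lambda>a. 1 / real a"] by simp

lemma rsum_UN_le: "finite I \<Longrightarrow> (\<And>i. i \<in> I \<Longrightarrow> finite (A i)) \<Longrightarrow> rsum (\<Union>i\<in>I. A i) \<le> (\<Sum>i\<in>I. rsum (A i))"
proof (induction I rule: finite_induct)
  case (insert i I)
  then show ?case using rsum_Un_le[of "A i" "\<Union>i\<in>I. A i"] by simp
qed simp

lemma rsum_Union: 
  assumes "finite \<F>" "\<And>G. G \<in> \<F> \<Longrightarrow> finite G" "pairwise disjnt \<F>"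
  shows "rsum (\<Union>\<F>) = (\<Sum>G\<in>\<F>. rsum G)"
proof -
  have "\<forall>A\<in>\<F>. finite A" "\<forall>A\<in>\<F>. \<forall>B\<in>\<F>. A \<noteq> B \<longrightarrow> A \<inter> B = {}"
    using assms by (auto simp: pairwise_def disjnt_def)
  then show ?thesis unfolding rsum_def using sum.Union_disjoint[of \<F> "\<lambda>a. 1 / real a"] by simp
qed

lemma rsum_interval: "rsum {1..n} = harm n"
  by (simp add: rsum_def harm_def inverse_eq_divide)

lemma harm_le: "n > 0 \<Longrightarrow> (harm n :: real) \<le> 1 + ln (real n)"
proof -
  assume "n > 0"
  then obtain m where m: "n = Suc m" using gr0_implies_Suc by blast
  have "harm (Suc m) - ln (real (Suc m)) \<le> harm (Suc 0) - ln (real (Suc 0))"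
    using decseq_harm_diff_ln unfolding decseq_def by blast
  then show ?thesis unfolding m by (simp add: harm_def)
qed

lemma rsum_subset_interval_le: "A \<subseteq> {1..n} \<Longrightarrow> rsum A \<le> harm n"
  unfolding rsum_interval[symmetric] by (rule rsum_mono) auto

text \<open>Every s up to x is smooth, so the products d * s are distinct integers up to n * x, and
  the product of the two reciprocal sums is part of \<open>harm (n * x)\<close>. Rough numbers
  therefore carry only about a share 1 / ln x of the harmonic sum, which keeps the deletions from
  the blocks small in total.\<close>

lemma rough_rsum_le:
  assumes "x > 0"
  shows "rsum {d. rough x d \<and> d \<le> n} * harm x \<le> harm (n * x)"
proof -
  let ?D = "{d. rough x d \<and> d \<le> n}"
  have fin: "finite ?D" by (rule finite_subset[of _ "{..n}"]) auto
  have inj: "inj_on (\<lambda>(d, s). d * s) (?D \<times> {1..x})"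
  proof (rule inj_onI, clarify)
    fix d s d' s' assume "s \<in> {1..x}" "s' \<in> {1..x}" "rough x d" "rough x d'" "d * s = d' * s'"
    then show "d = d' \<and> s = s'" using rough_smooth_unique[of x d s d' s'] smooth_le by auto
  qed
  have "rsum ?D * harm x = (\<Sum>d\<in>?D. \<Sum>s\<in>{1..x}. 1 / real d * (1 / real s))"
    unfolding rsum_interval[symmetric] rsum_def by (rule sum_product)
  also have "\<dots> = (\<Sum>(d, s)\<in>?D \<times> {1..x}. 1 / real (d * s))"
    using fin by (simp add: sum.cartesian_product)
  also have "\<dots> = rsum ((\<lambda>(d, s). d * s) ` (?D \<times> {1..x}))"
    unfolding rsum_def using inj by (simp add: sum.reindex case_prod_unfold)
  also have "\<dots> \<le> harm (n * x)"
    by (rule rsum_subset_interval_le) (auto simp: rough_def Suc_le_eq intro!: mult_le_mono)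
  finally show ?thesis .
qed

text \<open>Adding one set at a time raises the sum by at most w, so the last union before \<tau> is
  exceeded lies within w of \<tau>.\<close>

lemma greedy_subfamily:
  assumes "finite \<F>" "\<And>G. G \<in> \<F> \<Longrightarrow> finite G" "\<And>G. G \<in> \<F> \<Longrightarrow> rsum G \<le> w" "w > 0" "\<tau> \<ge> 0"
  shows "rsum (\<Union>\<F>) \<le> \<tau> \<or> (\<exists>\<J>\<subseteq>\<F>. \<tau> - w < rsum (\<Union>\<J>) \<and> rsum (\<Union>\<J>) \<le> \<tau>)"
  using assms(1-3)
proof (induction \<F> rule: finite_induct)
  case empty
  then show ?case using assms(5) by simp
next
  case (insert G \<F>)
  show ?case
  proof (cases "rsum (\<Union>\<F>) \<le> \<tau> \<and> \<not> rsum (\<Union>(insert G \<F>)) \<le> \<tau>")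
    case True
    have "rsum (\<Union>(insert G \<F>)) \<le> rsum G + rsum (\<Union>\<F>)"
      using rsum_Un_le[of G "\<Union>\<F>"] insert by auto
    then have "\<tau> - w < rsum (\<Union>\<F>)" using True insert.prems(2)[of G] by auto
    then show ?thesis using True by blast
  next
    case False
    then show ?thesis using insert by blast
  qed
qed

text \<open>The common denominator that remains once the rough part of every block has been removed.
  Its prime factors are at most x, which is what keeps the modulus of the final elimination
  manageable.\<close>

definition smoothlcm :: "nat \<Rightarrow> nat \<Rightarrow> nat" where
  "smoothlcm x N = Lcm {s. smooth x s \<and> s \<le> N}"

lemma finite_smooth: "finite {s. smooth x s \<and> s \<le> N}"
  by (rule finite_subset[of _ "{..N}"]) auto

lemma smoothlcm_pos: "smoothlcm x N > 0"
  unfolding smoothlcm_def using finite_smooth by (auto simp: Lcm_0_iff_nat smooth_def intro!: Nat.gr0I)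

lemma smooth_smoothlcm: "smooth x (smoothlcm x N)"
  unfolding smooth_def
proof (intro conjI allI impI)
  show "smoothlcm x N > 0" by (rule smoothlcm_pos)
  fix p assume p: "prime p" "p dvd smoothlcm x N"
  have "\<exists>a\<in>{s. smooth x s \<and> s \<le> N}. p dvd a"
    by (rule primepow_dvd_Lcm) (use p finite_smooth in \<open>auto simp: smoothlcm_def smooth_def\<close>)
  then show "p \<le> x" using p(1) by (auto simp: smooth_def)
qed

lemma smoothlcm_rsum_int:
  assumes "finite A" "\<And>s. s \<in> A \<Longrightarrow> smooth x s \<and> s \<le> N"
  shows "real (smoothlcm x N) * rsum A \<in> \<int>"
proof -
  have "real (smoothlcm x N) * (1 / real s) \<in> \<int>" if "s \<in> A" for s
  proof -
    have "s dvd smoothlcm x N" unfolding smoothlcm_def using assms that by (intro dvd_Lcm) auto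
    then have "real (smoothlcm x N) * (1 / real s) = real (smoothlcm x N div s)" by (simp add: real_of_nat_div)
    then show ?thesis by simp
  qed
  then show ?thesis unfolding rsum_def sum_distrib_left by (intro Ints_sum) auto
qed

lemma oddlcm_dvd_smoothlcm: "x \<le> N \<Longrightarrow> oddlcm x dvd smoothlcm x N"
  unfolding oddlcm_def smoothlcm_def
  by (intro Lcm_least dvd_Lcm) (auto intro!: smooth_le Nat.gr0I)

text \<open>Deleting E from the smooth cofactors makes the numerator of the block sum over
  \<open>smoothlcm x N\<close> divisible by d. The factor 6 * x^3 in N guarantees that the cofactors
  to be deleted are present in the block: d is at most N1 and every e in E at most
  \<open>kill_cost x\<close>.\<close>

lemma rough_block:
  assumes "x \<ge> 2" "rough x d" "d \<le> N1" "N1 \<le> oddlcm x" "N = N1 * (6 * x ^ 3)"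
  shows "\<exists>E. E \<subseteq> {s. smooth x s \<and> d * s \<le> N} \<and> rsum E < 2 \<and>
    real (smoothlcm x N) * rsum ((*) d ` ({s. smooth x s \<and> d * s \<le> N} - E)) \<in> \<int>"
proof -
  let ?\<Lambda> = "smoothlcm x N" and ?S = "{s. smooth x s \<and> d * s \<le> N}"
  have d0: "d > 0" using assms(2) by (simp add: rough_def)
  have "s \<le> N" if "d * s \<le> N" for s
  proof -
    have "1 * s \<le> d * s" using d0 by (intro mult_le_mono) auto
    then show ?thesis using that by linarith
  qed
  note sN = this
  have finS: "finite ?S" by (rule finite_subset[of _ "{..N}"]) (use sN in auto)
  have "real ?\<Lambda> * rsum ?S \<in> \<int>" by (intro smoothlcm_rsum_int finS) (use sN in auto)
  then obtain t where t: "real ?\<Lambda> * rsum ?S = of_int t" by (auto elim: Ints_cases)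
  have "N1 > 0" using d0 assms(3) by linarith
  have "x \<le> x ^ 3" using assms(1) by (simp add: self_le_power)
  also have "\<dots> \<le> N" unfolding assms(5) using \<open>N1 > 0\<close> by simp
  finally have "x \<le> N" .
  then obtain L where L: "?\<Lambda> = oddlcm x * L" using oddlcm_dvd_smoothlcm by blast
  have "coprime d L" using rough_smooth_coprime[OF assms(2) smooth_smoothlcm[of x N]] L by auto
  then have "coprime (int L) (int d)" by (simp add: coprime_commute)
  then obtain y where y: "[int L * y = 1] (mod int d)" using cong_solve_coprime_int by blast
  have "d \<le> oddlcm x" using assms by linarith
  \<comment> \<open>\<open>?\<Lambda> * rsum E\<close> equals L * r, so r has to be t / L modulo d;
    L is invertible because the smooth \<open>?\<Lambda>\<close> is coprime to the rough d.\<close>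
  then obtain E r where E: "finite E" "rsum E = real r / real (oddlcm x)" "[int r = t * y] (mod int d)"
    "1 \<le> rsum E" "rsum E < 2" "\<And>p e. e \<in> E \<Longrightarrow> prime p \<Longrightarrow> p dvd e \<Longrightarrow> p \<le> x" "0 \<notin> E"
    "\<Sum>E \<le> kill_cost x"
    using kill_modulus[OF assms(1) d0] by metis
  have ES: "E \<subseteq> ?S"
  proof
    fix e assume e: "e \<in> E"
    have "e \<le> kill_cost x" using member_le_sum_nat[OF E(1) e] E(8) by linarith
    then have "e \<le> 6 * x ^ 3" using kill_cost_le[OF assms(1)] by linarith
    then have "d * e \<le> N" unfolding assms(5) using assms(3) by (intro mult_le_mono) auto
    moreover have "smooth x e" using E(6,7) e by (auto simp: smooth_def intro!: Nat.gr0I)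
    ultimately show "e \<in> ?S" by simp
  qed
  have "[int L * int r = int L * (t * y)] (mod int d)" using E(3) by (intro cong_mult cong_refl)
  also have "int L * (t * y) = t * (int L * y)" by simp
  also have "[t * (int L * y) = t * 1] (mod int d)" using y by (intro cong_mult cong_refl)
  finally have "int d dvd t - int L * int r" by (simp add: cong_iff_dvd_diff dvd_diff_commute)
  then obtain z where z: "t - int L * int r = int d * z" by blast
  have O0: "oddlcm x > 0" by (rule oddlcm_pos)
  have "real ?\<Lambda> * rsum E = real L * real r" unfolding L E(2) using O0 by simp
  then have "real ?\<Lambda> * rsum (?S - E) = of_int (t - int L * int r)"
    using t by (simp add: rsum_Diff[OF finS ES] right_diff_distrib)
  then have "real ?\<Lambda> * rsum (?S - E) = real d * of_int z" unfolding z by simp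
  then have "real ?\<Lambda> * rsum ((*) d ` (?S - E)) = of_int z" using d0 by (simp add: rsum_scale)
  then have "real ?\<Lambda> * rsum ((*) d ` (?S - E)) \<in> \<int>" by simp
  then show ?thesis using ES E(5) by blast
qed

text \<open>These numbers are reserved for the dyadic remainder in the final step, where everything is scaled
  by \<open>289 = 17 ^ 2\<close>.\<close>

definition excluded :: "nat set" where
  "excluded = range (\<lambda>j. 289 * 2 ^ j)"

lemma rsum_excluded_le: "rsum (excluded \<inter> {..n}) \<le> 2"
proof -
  have "excluded \<inter> {..n} \<subseteq> (\<lambda>j. 289 * 2 ^ j) ` {..n}"
  proof
    fix a assume "a \<in> excluded \<inter> {..n}"
    then obtain j where j: "a = 289 * 2 ^ j" "a \<le> n" by (auto simp: excluded_def)
    have "j < 2 ^ j" by (rule less_exp)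
    then have "j \<le> n" using j by linarith
    then show "a \<in> (\<lambda>j. 289 * 2 ^ j) ` {..n}" using j by (intro image_eqI[of _ _ j]) auto
  qed
  then have "rsum (excluded \<inter> {..n}) \<le> rsum ((\<lambda>j. 289 * 2 ^ j) ` {..n})" by (intro rsum_mono) auto
  also have "\<dots> = (\<Sum>j\<le>n. 1 / 289 * (1 / 2) ^ j)"
    unfolding rsum_def by (subst sum.reindex) (auto simp: inj_on_def power_one_over divide_simps)
  also have "\<dots> \<le> (\<Sum>j\<le>n. (1 / 2) ^ j)" by (intro sum_mono) auto
  also have "\<dots> = 2 - (1 / 2) ^ n" by (induction n) auto
  also have "\<dots> \<le> 2" by simp
  finally show ?thesis .
qed

text \<open>The numbers 289 * 2^j have no prime factor above 17, so x \<ge> 17 keeps all blocks with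
  d > 1 clear of the reserved numbers.\<close>

lemma rough_smooth_not_excluded:
  assumes "rough x d" "d > 1" "x \<ge> 17"
  shows "d * s \<notin> excluded"
proof
  assume "d * s \<in> excluded"
  then obtain j where j: "d * s = 289 * 2 ^ j" by (auto simp: excluded_def)
  obtain p where p: "prime p" "p dvd d" using assms(2) prime_factor_nat[of d] by auto
  then have "x < p" using assms(1) by (auto simp: rough_def)
  have "p dvd d * s" using p(2) by (rule dvd_mult2)
  then have "p dvd 17 ^ 2 * 2 ^ j" unfolding j by simp
  then have "p dvd 17 ^ 2 \<or> p dvd 2 ^ j" using p(1) prime_dvd_mult_iff by blast
  then have "p dvd 17 \<or> p dvd 2" using p(1) prime_dvd_power by blast
  then have "p \<le> 17" by (auto dest!: dvd_imp_le)
  then show False using \<open>x < p\<close> assms(3) by simp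
qed

text \<open>The available pieces are the corrected blocks with d > 1 and singletons of smooth
  numbers. Each piece is integral over \<open>smoothlcm x N\<close> and has reciprocal sum at most 1
  / 578, so every union of pieces is admissible and a greedy choice approximates \<tau>. The
  precision is half of 1 / 289: after scaling by 289 the error stays below 1 / 2.\<close>

lemma filler:
  assumes "x \<ge> 17" "N1 > 0" "N1 \<le> oddlcm x" "N = N1 * (6 * x ^ 3)" "578 * (1 + ln (real N)) \<le> real x"
    "0 \<le> \<tau>" "\<tau> \<le> ln (real N1) - 10 - 2 * (1 + ln (real N1) + ln (real x)) / ln (real x)"
  shows "\<exists>F. finite F \<and> F \<subseteq> {1..N} \<and> \<tau> - 1 / 578 < rsum F \<and> rsum F \<le> \<tau> \<and>
    real (smoothlcm x N) * rsum F \<in> \<int> \<and> F \<inter> excluded = {}"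
proof -
  let ?\<Lambda> = "smoothlcm x N"
  define D where "D = {d. rough x d \<and> 1 < d \<and> d \<le> N1}"
  define S where "S d = {s. smooth x s \<and> d * s \<le> N}" for d
  have finD: "finite D" unfolding D_def by (rule finite_subset[of _ "{..N1}"]) auto
  have x2: "x \<ge> 2" using assms(1) by simp
  have N0: "N > 0" using assms(1,2,4) by simp
  have "\<exists>E. E \<subseteq> S d \<and> rsum E < 2 \<and> real ?\<Lambda> * rsum ((*) d ` (S d - E)) \<in> \<int>" if "d \<in> D" for d
    unfolding S_def using rough_block[OF x2 _ _ assms(3,4)] that by (auto simp: D_def)
  then obtain E where E: "\<And>d. d \<in> D \<Longrightarrow> E d \<subseteq> S d" "\<And>d. d \<in> D \<Longrightarrow> rsum (E d) < 2"
    "\<And>d. d \<in> D \<Longrightarrow> real ?\<Lambda> * rsum ((*) d ` (S d - E d)) \<in> \<int>" by metis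
  define B where "B d = (*) d ` (S d - E d)" for d
  define T where "T = {s. smooth x s \<and> 578 \<le> s \<and> s \<le> N \<and> s \<notin> excluded}"
  define \<F> where "\<F> = B ` D \<union> (\<lambda>s. {s}) ` T"
  have finT: "finite T" unfolding T_def by (rule finite_subset[of _ "{..N}"]) auto
  have D0: "d > 0" if "d \<in> D" for d using that by (simp add: D_def)
  have finS: "finite (S d)" if "d \<in> D" for d
  proof (rule finite_subset)
    show "S d \<subseteq> {..N}"
    proof
      fix s assume "s \<in> S d"
      then have "d * s \<le> N" by (simp add: S_def)
      moreover have "1 * s \<le> d * s" using D0[OF that] by (intro mult_le_mono) auto
      ultimately have "s \<le> N" by linarith
      then show "s \<in> {..N}" by simp
    qed
  qed auto
  have finE: "finite (E d)" if "d \<in> D" for d using finS E(1) that finite_subset by blast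
  have fin\<F>: "finite \<F>" unfolding \<F>_def using finD finT by simp
  have finG: "finite G" if "G \<in> \<F>" for G using that finS by (auto simp: \<F>_def B_def)
  have BN: "B d \<subseteq> {1..N}" if "d \<in> D" for d
    using D0[OF that] by (auto simp: B_def S_def smooth_def Suc_le_eq)
  have disj: "pairwise disjnt \<F>"
  proof -
    have disjB: "B d \<inter> B d' = {}" if dd: "d \<in> D" "d' \<in> D" "d \<noteq> d'" for d d'
    proof -
      have False if n: "n \<in> B d" "n \<in> B d'" for n
      proof -
        obtain s where s: "n = d * s" "smooth x s" using n(1) unfolding B_def S_def by blast
        obtain s' where s': "n = d' * s'" "smooth x s'" using n(2) unfolding B_def S_def by blast
        have "d * s = d' * s'" using s s' by simp
        moreover have "rough x d" "rough x d'" using dd by (simp_all add: D_def)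
        ultimately have "d = d'" using rough_smooth_unique(1) s(2) s'(2) by blast
        then show False using dd(3) by simp
      qed
      then show ?thesis by blast
    qed
    have disjT: "B d \<inter> {s} = {}" if dd: "d \<in> D" "s \<in> T" for d s
    proof -
      have False if sB: "s \<in> B d"
      proof -
        obtain s' where s: "s = d * s'" "smooth x s'" using sB unfolding B_def S_def by blast
        have "rough x d" "rough x 1" "smooth x s" using dd by (auto simp: D_def T_def rough_def)
        moreover have "d * s' = 1 * s" using s by simp
        ultimately have "d = 1" using rough_smooth_unique(1) s(2) by blast
        then show False using dd(1) by (simp add: D_def)
      qed
      then show ?thesis by blast
    qed
    show ?thesis
    proof (rule pairwiseI, unfold disjnt_def)
      fix G H assume GH: "G \<in> \<F>" "H \<in> \<F>" "G \<noteq> H"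
      consider d e where "G = B d" "H = B e" "d \<in> D" "e \<in> D" | d s where "G = B d" "H = {s}" "d \<in> D" "s \<in> T"
        | d s where "H = B d" "G = {s}" "d \<in> D" "s \<in> T" | s t where "G = {s}" "H = {t}"
        using GH(1,2) unfolding \<F>_def by blast
      then show "G \<inter> H = {}"
      proof cases
        case 1
        moreover have "d \<noteq> e" using 1 GH(3) by blast
        ultimately show ?thesis by (simp add: disjB)
      next
        case 2
        then show ?thesis using disjT by simp
      next
        case 3
        then show ?thesis using disjT[of d s] by (simp add: Int_commute)
      next
        case 4
        then show ?thesis using GH(3) by auto
      qed
    qed
  qed
  have int\<F>: "real ?\<Lambda> * rsum G \<in> \<int>" if GF: "G \<in> \<F>" for G
  proof -
    consider d where "d \<in> D" "G = B d" | s where "s \<in> T" "G = {s}" using GF by (auto simp: \<F>_def)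
    then show ?thesis
    proof cases
      case 1
      then show ?thesis using E(3) by (simp add: B_def)
    next
      case 2
      then show ?thesis by (intro smoothlcm_rsum_int) (auto simp: T_def)
    qed
  qed
  \<comment> \<open>A block is scaled down by d > x, and x exceeds 578 times the bound 1 + ln N for
    the harmonic sum; singletons start at 578.\<close>
  have small: "rsum G \<le> 1 / 578" if GF: "G \<in> \<F>" for G
  proof -
    consider d where "d \<in> D" "G = B d" | s where "s \<in> T" "G = {s}" using GF by (auto simp: \<F>_def)
    then show ?thesis
    proof cases
      case 1
      have "real d \<ge> real x" using rough_gt[of x d] 1(1) by (simp add: D_def)
      have x0: "real x > 0" using assms(1) by simp
      have S1: "S d - E d \<subseteq> {1..N}"
      proof
        fix s assume "s \<in> S d - E d"
        then have "s > 0" "d * s \<le> N" by (auto simp: S_def smooth_def)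
        moreover have "1 * s \<le> d * s" using D0[OF 1(1)] by (intro mult_le_mono) auto
        ultimately have "1 \<le> s" "s \<le> N" by linarith+
        then show "s \<in> {1..N}" by simp
      qed
      have "rsum G = rsum (S d - E d) / real d" using 1 D0 by (simp add: B_def rsum_scale)
      also have "\<dots> \<le> harm N / real d" using S1 by (intro divide_right_mono rsum_subset_interval_le) auto
      also have "\<dots> \<le> harm N / real x" using \<open>real d \<ge> real x\<close> x0
        by (intro divide_left_mono harm_nonneg mult_pos_pos) auto
      also have "\<dots> \<le> (1 + ln (real N)) / real x" using N0 by (intro divide_right_mono harm_le) auto
      also have "\<dots> \<le> 1 / 578" using assms(5) x0 by (simp add: field_simps)
      finally show ?thesis .
    next
      case 2
      then show ?thesis by (auto simp: T_def rsum_def divide_simps)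
    qed
  qed
  \<comment> \<open>Losses against \<open>harm N1\<close>: at most 1 + 7 for the numbers up to 578
    and 2 for the reserved ones, together 10, and less than 2 / d for what is deleted from block
    d.\<close>
  have lower: "\<tau> \<le> rsum (\<Union>\<F>)"
  proof -
    let ?R = "\<Union>d\<in>D. (*) d ` E d"
    have sub: "{1..N1} \<subseteq> \<Union>\<F> \<union> ({1..578} \<union> (excluded \<inter> {..N1} \<union> ?R))"
    proof
      fix n assume n: "n \<in> {1..N1}"
      then have "n > 0" by simp
      then obtain d s where ds: "rough x d" "smooth x s" "n = d * s" by (rule rough_smooth_decomp)
      have s0: "s > 0" using ds by (simp add: smooth_def)
      have NN: "N1 \<le> N" unfolding assms(4) using assms(1) by simp
      have d0: "d > 0" using ds(1) by (simp add: rough_def)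
      show "n \<in> \<Union>\<F> \<union> ({1..578} \<union> (excluded \<inter> {..N1} \<union> ?R))"
      proof (cases "d = 1")
        case True
        have "n \<in> T \<or> n \<in> {1..578} \<or> n \<in> excluded" using True ds n NN by (auto simp: T_def)
        then show ?thesis using n by (auto simp: \<F>_def)
      next
        case False
        have "d * 1 \<le> d * s" using s0 by (intro mult_le_mono) auto
        moreover have "d * s \<le> N1" using n ds(3) by simp
        ultimately have "d \<le> N1" by linarith
        then have "d \<in> D" using False d0 ds(1) by (simp add: D_def)
        moreover have "s \<in> S d" using ds n NN by (auto simp: S_def)
        ultimately show ?thesis using ds(3) by (auto simp: \<F>_def B_def)
      qed
    qed
    have finR: "finite ?R" using finD finE by auto
    have fU: "finite (\<Union>\<F>)" using fin\<F> finG by blast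
    have "harm N1 \<le> rsum (\<Union>\<F> \<union> ({1..578} \<union> (excluded \<inter> {..N1} \<union> ?R)))"
      unfolding rsum_interval[symmetric] using sub finR fU by (intro rsum_mono) auto
    also have "\<dots> \<le> rsum (\<Union>\<F>) + rsum ({1..578} \<union> (excluded \<inter> {..N1} \<union> ?R))"
      using finR fU by (intro rsum_Un_le) auto
    also have "rsum ({1..578} \<union> (excluded \<inter> {..N1} \<union> ?R)) \<le> rsum {1..578} + rsum (excluded \<inter> {..N1} \<union> ?R)"
      using finR by (intro rsum_Un_le) auto
    also have "rsum (excluded \<inter> {..N1} \<union> ?R) \<le> rsum (excluded \<inter> {..N1}) + rsum ?R"
      using finR by (intro rsum_Un_le) auto
    also have "rsum (excluded \<inter> {..N1}) \<le> 2" by (rule rsum_excluded_le)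
    also have "rsum {1..578} \<le> 1 + ln 578"
      using harm_le[of 578] by (simp only: rsum_interval) simp
    also have "ln (578::real) \<le> 7"
    proof -
      have "(578::real) \<le> (5/2) ^ 7" by (simp add: power_numeral_reduce)
      also have "(5/2::real) \<le> exp 1" using exp_ge_one_plus_x_over_n_power_n[of 2 1] 
        exp_lower_Taylor_quadratic[of "1::real"] by simp
      then have "(5/2::real) ^ 7 \<le> exp 1 ^ 7" by (intro power_mono) auto
      also have "\<dots> = exp 7" by (simp flip: exp_of_nat_mult)
      finally have "ln 578 \<le> ln (exp (7::real))" by (subst ln_le_cancel_iff) auto
      then show ?thesis by simp
    qed
    also have "rsum ?R \<le> (\<Sum>d\<in>D. rsum ((*) d ` E d))" using finD finE by (intro rsum_UN_le) auto
    also have "\<dots> \<le> (\<Sum>d\<in>D. 2 * (1 / real d))"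
      using D0 E(2) by (intro sum_mono) (simp add: rsum_scale divide_simps less_imp_le)
    also have "\<dots> = 2 * rsum D" by (simp add: rsum_def sum_distrib_left)
    also have "rsum D \<le> rsum {d. rough x d \<and> d \<le> N1}"
      by (rule rsum_mono) (auto simp: D_def intro: finite_subset[of _ "{..N1}"])
    also have "\<dots> \<le> (1 + ln (real N1) + ln (real x)) / ln (real x)"
    proof -
      have lx: "ln (real x) > 0" using assms(1) by (intro ln_gt_zero) auto
      have "ln (real x) \<le> ln (real x + 1)" using assms(1) by (subst ln_le_cancel_iff) auto
      then have "ln (real x) \<le> harm x" using ln_le_harm[of x] by linarith
      then have "rsum {d. rough x d \<and> d \<le> N1} * ln (real x) \<le> rsum {d. rough x d \<and> d \<le> N1} * harm x"
        by (intro mult_left_mono rsum_nonneg)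
      also have "\<dots> \<le> harm (N1 * x)" by (rule rough_rsum_le) (use assms(1) in simp)
      also have "\<dots> \<le> 1 + ln (real (N1 * x))" using assms(1,2) by (intro harm_le) simp
      also have "ln (real (N1 * x)) = ln (real N1) + ln (real x)" using assms(1,2) by (simp add: ln_mult)
      finally show ?thesis using lx by (simp add: field_simps)
    qed
    finally have "harm N1 \<le> rsum (\<Union>\<F>) + (1 + 7 + (2 + 2 * ((1 + ln (real N1) + ln (real x)) / ln (real x))))"
      by simp
    moreover have "ln (real N1) \<le> ln (real N1 + 1)" using assms(2) by (subst ln_le_cancel_iff) auto
    then have "ln (real N1) \<le> harm N1" using ln_le_harm[of N1] by linarith
    ultimately show ?thesis using assms(7) by simp
  qed
  have "\<exists>\<J>\<subseteq>\<F>. \<tau> - 1 / 578 < rsum (\<Union>\<J>) \<and> rsum (\<Union>\<J>) \<le> \<tau>"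
  proof -
    have "rsum (\<Union>\<F>) \<le> \<tau> \<or> (\<exists>\<J>\<subseteq>\<F>. \<tau> - 1 / 578 < rsum (\<Union>\<J>) \<and> rsum (\<Union>\<J>) \<le> \<tau>)"
      by (rule greedy_subfamily[OF fin\<F> finG small]) (use assms(6) in auto)
    then show ?thesis
    proof
      assume "rsum (\<Union>\<F>) \<le> \<tau>"
      then show ?thesis using lower by (intro exI[of _ \<F>]) auto
    qed
  qed
  then obtain \<J> where \<J>: "\<J> \<subseteq> \<F>" "\<tau> - 1 / 578 < rsum (\<Union>\<J>)" "rsum (\<Union>\<J>) \<le> \<tau>" by blast
  have "rsum (\<Union>\<J>) = (\<Sum>G\<in>\<J>. rsum G)"
    by (rule rsum_Union) (use \<J>(1) fin\<F> finG disj finite_subset in \<open>auto intro: pairwise_subset\<close>)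
  then have "real ?\<Lambda> * rsum (\<Union>\<J>) = (\<Sum>G\<in>\<J>. real ?\<Lambda> * rsum G)" by (simp add: sum_distrib_left)
  also have "\<dots> \<in> \<int>" using \<J>(1) int\<F> by (intro Ints_sum) auto
  finally have "real ?\<Lambda> * rsum (\<Union>\<J>) \<in> \<int>" .
  moreover have "G \<subseteq> {1..N} \<and> G \<inter> excluded = {}" if GF: "G \<in> \<F>" for G
  proof -
    consider d where "d \<in> D" "G = B d" | s where "s \<in> T" "G = {s}" using GF by (auto simp: \<F>_def)
    then show ?thesis
    proof cases
      case 1
      have "d * s \<notin> excluded" for s
        using rough_smooth_not_excluded[of x d s] 1 assms(1) by (auto simp: D_def)
      then show ?thesis using 1 BN by (auto simp: B_def)
    next
      case 2
      then show ?thesis by (auto simp: T_def)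
    qed
  qed
  then have "\<Union>\<J> \<subseteq> {1..N}" "\<Union>\<J> \<inter> excluded = {}" using \<J>(1) by blast+
  moreover have "finite (\<Union>\<J>)" using calculation(2) by (rule finite_subset) simp
  ultimately show ?thesis using \<J>(2,3) by blast
qed

text \<open>The n-th power of y \<le> exp y at y = s * t / n.\<close>

lemma exp_ge_power_nonneg: 
  fixes t :: real
  assumes "t \<ge> 0" "s > 0"
  shows "t ^ n \<le> (real n / s) ^ n * exp (s * t)"
proof (cases "n = 0")
  case False
  have "s * t / real n \<le> exp (s * t / real n)" using exp_ge_add_one_self[of "s * t / real n"] by linarith
  then have "(s * t / real n) ^ n \<le> exp (s * t / real n) ^ n" using assms by (intro power_mono) auto
  also have "\<dots> = exp (s * t)" using False by (simp flip: exp_of_nat_mult)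
  finally have "(real n / s) ^ n * (s * t / real n) ^ n \<le> (real n / s) ^ n * exp (s * t)"
    using assms by (intro mult_left_mono) auto
  moreover have "(real n / s) ^ n * (s * t / real n) ^ n = t ^ n"
    using False assms by (simp flip: power_mult_distrib)
  ultimately show ?thesis by simp
qed (use assms in simp)

text \<open>Half of \<delta> enlarges ln N1 to pay for the deletions; the other half absorbs the
  factor x^3 = O(a^3) in N = N1 * 6 * x^3. N and x are fixed before \<tau>, because the exact target
  depends on scales that are themselves chosen in terms of N.\<close>

lemma filler_exists:
  fixes \<delta> :: real
  assumes "0 < \<delta>" "\<delta> \<le> 1"
  obtains C :: real where "C \<ge> 1"
    "\<And>a. a \<ge> 1 \<Longrightarrow> \<exists>N x. N > 0 \<and> x \<ge> 17 \<and> real N \<le> C * exp ((1 + \<delta>) * a) \<and> real x \<le> C * a \<and>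
      (\<forall>\<tau>. 0 \<le> \<tau> \<and> \<tau> \<le> a \<longrightarrow> (\<exists>F. finite F \<and> F \<subseteq> {1..N} \<and> \<tau> - 1 / 578 < rsum F \<and> rsum F \<le> \<tau> \<and>
         real (smoothlcm x N) * rsum F \<in> \<int> \<and> F \<inter> excluded = {}))"
proof -
  have "eventually (\<lambda>x::real. 1156 * (24 + 3 * ln x) \<le> x) at_top" by real_asymp
  then obtain x0 :: real where x0: "\<And>x. x \<ge> x0 \<Longrightarrow> 1156 * (24 + 3 * ln x) \<le> x"
    by (auto simp: eventually_at_top_linorder)
  \<comment> \<open>2312 = 4 * 578 lets x dominate the part of 578 * ln N that is linear in a, x0
    the part that is logarithmic in x. From exp (16 / \<delta>) one gets ln x \<ge> 16 / \<delta>,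
    so the deletions cost at most \<delta> / 8 * (1 + ln N1) + 2.\<close>
  define K :: real where "K = max (max 2312 x0) (exp (16 / \<delta>))"
  have K: "K \<ge> 2312" "K \<ge> x0" "K \<ge> exp (16 / \<delta>)" by (auto simp: K_def)
  define C where "C = exp 17 * 6 * (2 * K) ^ 3 * (6 / \<delta>) ^ 3 + 2 * K"
  have e1: "exp 17 * 6 * (2 * K) ^ 3 * (6 / \<delta>) ^ 3 \<ge> 0" using K assms by auto
  show ?thesis
  proof (rule that[of C])
    show "C \<ge> 1" using e1 K unfolding C_def by linarith
    fix a :: real assume a: "a \<ge> 1"
    \<comment> \<open>(1 - \<delta> / 8) * (1 + \<delta> / 2) is at least 1 for \<delta> \<le> 1, so
      at least a is left after the deletions; the summand 16 covers the constants 10 + 2 + \<delta>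
      / 8.\<close>
    define y where "y = (1 + \<delta> / 2) * a + 16"
    define N1 where "N1 = nat \<lceil>exp y\<rceil>"
    define x where "x = nat \<lceil>K * a\<rceil>"
    define N where "N = N1 * (6 * x ^ 3)"
    have Ka: "K * a \<ge> 2312 * 1" using K a by (intro mult_mono) auto
    have "real x = of_int \<lceil>K * a\<rceil>" using Ka by (simp add: x_def)
    then have x1: "K * a \<le> real x" "real x \<le> K * a + 1" by linarith+
    have KKa: "K * 1 \<le> K * a" using a K by (intro mult_left_mono) auto
    have xK: "real x \<ge> K" using x1 KKa by linarith
    have x17: "x \<ge> 17" using x1 Ka by linarith
    have "y > 0" unfolding y_def using a assms by (intro add_nonneg_pos) auto
    have "real N1 = of_int \<lceil>exp y\<rceil>" by (simp add: N1_def less_imp_le)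
    then have N1: "exp y \<le> real N1" "real N1 \<le> exp y + 1" by linarith+
    have "exp y \<ge> 1" using \<open>y > 0\<close> by simp
    have "exp y + 1 \<le> exp y * 2" using \<open>exp y \<ge> 1\<close> by linarith
    also have "\<dots> \<le> exp y * exp 1" using exp_ge_add_one_self[of 1] by (intro mult_left_mono) auto
    also have "\<dots> = exp (y + 1)" by (simp add: exp_add)
    finally have N1': "real N1 \<le> exp (y + 1)" using N1 by linarith
    have N1pos: "N1 > 0" using N1 \<open>exp y \<ge> 1\<close> by linarith
    have "y \<le> ln (real N1)" using N1(1) N1pos by (simp add: ln_ge_iff)
    moreover have "ln (real N1) \<le> ln (exp (y + 1))" using N1' N1pos by (subst ln_le_cancel_iff) auto
    ultimately have lnN1: "y \<le> ln (real N1)" "ln (real N1) \<le> y + 1" by simp_all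
    have xpos: "real x > 0" using x17 by simp
    have lnN: "ln (real N) = ln (real N1) + ln 6 + 3 * ln (real x)"
      unfolding N_def using N1pos xpos by (simp add: ln_mult ln_realpow)
    have ln6: "ln (6::real) \<le> 5" using ln_le_minus_one[of 6] by simp
    have lnx: "ln (real x) \<ge> 16 / \<delta>" using xK K(3) xpos by (simp add: ln_ge_iff)
    have lnx0: "ln (real x) > 0" using lnx assms by (meson divide_pos_pos less_le_trans zero_less_numeral)
    have yb: "y \<le> 2 * a + 16"
    proof -
      have "(1 + \<delta> / 2) * a \<le> 2 * a" using assms a by (intro mult_right_mono) auto
      then show ?thesis by (simp add: y_def)
    qed
    have ax: "2312 * a \<le> real x"
    proof -
      have "2312 * a \<le> K * a" using K a by (intro mult_right_mono) auto
      then show ?thesis using x1 by linarith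
    qed
    have small: "578 * (1 + ln (real N)) \<le> real x"
    proof -
      have "1156 * (24 + 3 * ln (real x)) \<le> real x" using x0 xK K by auto
      moreover have "578 * (1 + L) \<le> t" if "1156 * (24 + 3 * l) \<le> t" "L = l1 + l6 + 3 * l" "l6 \<le> 5"
        "l1 \<le> y + 1" "y \<le> 2 * a + 16" "2312 * a \<le> t" for L l l1 l6 t :: real using that by argo
      ultimately show ?thesis using lnN ln6 lnN1(2) yb ax by blast
    qed
    \<comment> \<open>N \<le> exp (x / 2) \<le> 2^x \<le> 4 * x * \<open>oddlcm x\<close>, and the
      factor 6 * x^3 contained in N exceeds 4 * x.\<close>
    have N1odd: "N1 \<le> oddlcm x"
    proof -
      have "L \<le> t / 2" if "578 * (1 + L) \<le> t" "0 < t" for L t :: real using that by argo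
      then have "ln (real N) \<le> real x / 2" using small xpos by blast
      then have NN: "real N \<le> exp (real x / 2)"
        using N1pos xpos by (metis N_def exp_le_cancel_iff exp_ln mult_pos_pos of_nat_0_less_iff zero_less_numeral zero_less_power)
      have "exp (1/2::real) \<le> 2" using exp_bound_half[of "1/2::real"] by simp
      then have "exp (1/2::real) ^ x \<le> 2 ^ x" by (intro power_mono) auto
      then have "exp (real x / 2) \<le> 2 ^ x" by (simp flip: exp_of_nat_mult)
      also have "\<dots> \<le> 4 * real x * real (oddlcm x)" using x17 by (intro oddlcm_lower) simp
      finally have "real N1 * (6 * real x ^ 3) \<le> 4 * real x * real (oddlcm x)" using NN by (simp add: N_def)
      moreover have "real N1 * (4 * real x) \<le> real N1 * (6 * real x ^ 3)"
      proof (intro mult_left_mono)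
        have "real x \<le> real x ^ 3" using x17 by (intro self_le_power) auto
        then show "4 * real x \<le> 6 * real x ^ 3" using xpos by linarith
      qed auto
      ultimately have "real N1 * (4 * real x) \<le> real (oddlcm x) * (4 * real x)" by (simp add: mult_ac)
      then show ?thesis using xpos by simp
    qed
    have main: "a \<le> ln (real N1) - 10 - 2 * (1 + ln (real N1) + ln (real x)) / ln (real x)"
    proof -
      have lN0: "1 + ln (real N1) \<ge> 0" using lnN1 \<open>y > 0\<close> by linarith
      have "2 * (1 + ln (real N1) + ln (real x)) / ln (real x) = 2 * (1 + ln (real N1)) / ln (real x) + 2"
        using lnx0 by (simp add: field_simps)
      also have "2 * (1 + ln (real N1)) / ln (real x) \<le> 2 * (1 + ln (real N1)) / (16 / \<delta>)"
        using lN0 lnx lnx0 assms by (intro divide_left_mono) auto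
      also have "\<dots> = \<delta> / 8 * (1 + ln (real N1))" using assms by (simp add: field_simps)
      finally have 1: "2 * (1 + ln (real N1) + ln (real x)) / ln (real x) \<le> \<delta> / 8 * (1 + ln (real N1)) + 2"
        by simp
      have 2: "(1 - \<delta> / 8) * ln (real N1) \<ge> (1 - \<delta> / 8) * y" using lnN1 assms by (intro mult_left_mono) auto
      have 3: "(1 - \<delta> / 8) * y = (1 + \<delta> * (3 / 8 - \<delta> / 16)) * a + 16 * (1 - \<delta> / 8)"
        unfolding y_def by (simp add: algebra_simps)
      have 4: "(1 + \<delta> * (3 / 8 - \<delta> / 16)) * a \<ge> 1 * a"
        using assms a by (intro mult_right_mono) auto
      have 5: "\<delta> / 8 * (1 + ln (real N1)) = \<delta> / 8 + ln (real N1) - (1 - \<delta> / 8) * ln (real N1)"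
        by (simp add: algebra_simps)
      have "a \<le> L - 10 - T" if "T \<le> S + 2" "P \<ge> Q" "Q = R + 16 * (1 - \<delta> / 8)" "R \<ge> 1 * a" "S = \<delta> / 8 + L - P"
        for L T S P Q R using that assms by argo
      from this[OF 1 2 3 4 5] show ?thesis .
    qed
    have NC: "real N \<le> C * exp ((1 + \<delta>) * a)"
    proof -
      have "real x \<le> 2 * K * a" using x1 Ka by linarith
      then have "real x ^ 3 \<le> (2 * K * a) ^ 3" by (intro power_mono) auto
      also have "\<dots> = (2 * K) ^ 3 * a ^ 3" by (simp add: power_mult_distrib)
      also have "a ^ 3 \<le> (6 / \<delta>) ^ 3 * exp (\<delta> / 2 * a)"
        using exp_ge_power_nonneg[of a "\<delta> / 2" 3] assms a by simp
      finally have "real x ^ 3 \<le> (2 * K) ^ 3 * ((6 / \<delta>) ^ 3 * exp (\<delta> / 2 * a))" using K by (simp add: mult_left_mono)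
      then have "real N \<le> exp (y + 1) * (6 * ((2 * K) ^ 3 * ((6 / \<delta>) ^ 3 * exp (\<delta> / 2 * a))))"
        unfolding N_def of_nat_mult of_nat_power of_nat_numeral using N1' by (intro mult_mono) auto
      also have "exp (y + 1) = exp 17 * exp ((1 + \<delta> / 2) * a)" unfolding y_def by (simp flip: exp_add)
      also have "exp 17 * exp ((1 + \<delta> / 2) * a) * (6 * ((2 * K) ^ 3 * ((6 / \<delta>) ^ 3 * exp (\<delta> / 2 * a))))
        = exp 17 * 6 * (2 * K) ^ 3 * (6 / \<delta>) ^ 3 * (exp ((1 + \<delta> / 2) * a) * exp (\<delta> / 2 * a))"
        by (simp only: mult_ac)
      also have "exp ((1 + \<delta> / 2) * a) * exp (\<delta> / 2 * a) = exp ((1 + \<delta>) * a)"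
        by (simp add: algebra_simps flip: exp_add)
      also have "exp 17 * 6 * (2 * K) ^ 3 * (6 / \<delta>) ^ 3 * exp ((1 + \<delta>) * a) \<le> C * exp ((1 + \<delta>) * a)"
        unfolding C_def using K by (intro mult_right_mono) auto
      finally show ?thesis .
    qed
    have xC: "real x \<le> C * a"
    proof -
      have "real x \<le> 2 * K * a" using x1 Ka by linarith
      also have "\<dots> \<le> C * a" using e1 a unfolding C_def by (intro mult_right_mono) auto
      finally show ?thesis .
    qed
    have "\<exists>F. finite F \<and> F \<subseteq> {1..N} \<and> \<tau> - 1 / 578 < rsum F \<and> rsum F \<le> \<tau> \<and>
         real (smoothlcm x N) * rsum F \<in> \<int> \<and> F \<inter> excluded = {}" if "0 \<le> \<tau>" "\<tau> \<le> a" for \<tau>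
      by (rule filler[OF x17 N1pos N1odd N_def small that(1) order_trans[OF that(2) main]])
    moreover have "N > 0" using N1pos x17 by (simp add: N_def)
    ultimately show "\<exists>N x. N > 0 \<and> x \<ge> 17 \<and> real N \<le> C * exp ((1 + \<delta>) * a) \<and> real x \<le> C * a \<and>
      (\<forall>\<tau>. 0 \<le> \<tau> \<and> \<tau> \<le> a \<longrightarrow> (\<exists>F. finite F \<and> F \<subseteq> {1..N} \<and> \<tau> - 1 / 578 < rsum F \<and> rsum F \<le> \<tau> \<and>
         real (smoothlcm x N) * rsum F \<in> \<int> \<and> F \<inter> excluded = {}))"
      using x17 NC xC by blast
  qed
qed

section \<open>Assembling the partition\<close>

text \<open>Choose j < D with K * (m0 + j) congruent to n modulo D. The excess K * j is less than K
  * D, so the rest is a multiple of D that is still at least m0 * D. The shift m0 will be 78, so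
  that both coefficients are sums of good partitions.\<close>

lemma frobenius_shifted:
  fixes K D n m0 :: nat
  assumes "coprime K D" "D > 0" "n \<ge> m0 * (K + D) + K * D"
  obtains m1 m2 where "m1 \<ge> m0" "m2 \<ge> m0" "n = K * m1 + D * m2"
proof -
  have "coprime (int K) (int D)" using assms(1) by simp
  then obtain u where u: "[int K * u = 1] (mod int D)" using cong_solve_coprime_int by blast
  define j where "j = nat ((u * (int n - int (K * m0))) mod int D)"
  have D0: "int D > 0" using assms(2) by simp
  have ij: "int j = (u * (int n - int (K * m0))) mod int D" using D0 by (simp add: j_def)
  have jD: "j < D" using ij D0 by (metis of_nat_less_iff pos_mod_bound)
  have "[int K * int j = int K * (u * (int n - int (K * m0)))] (mod int D)"
    unfolding ij by (intro cong_mult cong_refl) simp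
  also have "int K * (u * (int n - int (K * m0))) = (int K * u) * (int n - int (K * m0))" by simp
  also have "[(int K * u) * (int n - int (K * m0)) = 1 * (int n - int (K * m0))] (mod int D)"
    using u by (intro cong_mult cong_refl)
  finally have "int D dvd (int n - int (K * m0)) - int K * int j"
    by (simp add: cong_iff_dvd_diff dvd_diff_commute)
  also have "(int n - int (K * m0)) - int K * int j = int n - int (K * (m0 + j))" by (simp add: algebra_simps)
  finally have d: "int D dvd int n - int (K * (m0 + j))" .
  have "K * (m0 + j) \<le> K * (m0 + D)" using jD by (intro mult_le_mono) auto
  moreover have "K * (m0 + D) + m0 * D = m0 * (K + D) + K * D" by (simp add: algebra_simps)
  ultimately have le: "K * (m0 + j) + m0 * D \<le> n" using assms(3) by linarith
  then have "int n - int (K * (m0 + j)) = int (n - K * (m0 + j))" by (simp add: of_nat_diff)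
  then have "D dvd n - K * (m0 + j)" using d by (metis of_nat_dvd_iff)
  then obtain m2 where m2: "n - K * (m0 + j) = D * m2" by blast
  have "m0 * D \<le> D * m2" using le m2 by linarith
  then have "D * m0 \<le> D * m2" unfolding mult.commute[of m0 D] .
  then have "m0 \<le> m2" using assms(2) by simp
  moreover have "n = K * (m0 + j) + D * m2" using m2 le by linarith
  ultimately show ?thesis using that[of "m0 + j" m2] by simp
qed

text \<open>The odd part of a common denominator of what remains after \<open>q\<close> has been eliminated, the interval
  has been filled and the copy scaled by \<open>3 ^ b\<close> has been subtracted.\<close>

definition big_modulus :: "nat \<Rightarrow> nat \<Rightarrow> nat \<Rightarrow> nat \<Rightarrow> nat" where
  "big_modulus x z N b = Lcm ({m. odd m \<and> m \<le> x} \<union> {m. odd m \<and> smooth z m \<and> m \<le> N} \<union> {3 ^ b})"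

lemma odd_big_modulus: "odd (big_modulus x z N b)"
  unfolding big_modulus_def by (rule odd_Lcm) auto

lemma primepow_dvd_big_modulus:
  assumes "primepow P" "P dvd big_modulus x z N b"
  shows "\<exists>m. P dvd m \<and> m > 0 \<and> (m \<le> x \<or> smooth z m \<and> m \<le> N \<or> m = 3 ^ b)"
proof -
  have "\<exists>m\<in>{m. odd m \<and> m \<le> x} \<union> {m. odd m \<and> smooth z m \<and> m \<le> N} \<union> {3 ^ b}. P dvd m"
    by (rule primepow_dvd_Lcm) (use assms in \<open>auto simp: big_modulus_def\<close>)
  then show ?thesis by (auto simp: odd_pos)
qed

lemma prime_dvd_big_modulus_le:
  assumes "prime p" "p dvd big_modulus x z N b" "3 \<le> x" "z \<le> x"
  shows "p \<le> x"
proof -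
  obtain m where m: "p dvd m" "m > 0" "m \<le> x \<or> smooth z m \<and> m \<le> N \<or> m = 3 ^ b"
    using primepow_dvd_big_modulus[OF primepow_prime[OF assms(1)] assms(2)] by blast
  from m(3) show ?thesis
  proof (elim disjE)
    assume "m \<le> x"
    then show ?thesis using m(1,2) dvd_imp_le[of p m] by linarith
  next
    assume "smooth z m \<and> m \<le> N"
    then have "p \<le> z" using m(1) assms(1) by (auto simp: smooth_def)
    then show ?thesis using assms(4) by linarith
  next
    assume "m = 3 ^ b"
    then have "p dvd 3" using m(1) assms(1) prime_dvd_power by blast
    then have "p \<le> 3" by (rule dvd_imp_le) simp
    then show ?thesis using assms(3) by linarith
  qed
qed

lemma closed_big_modulus:
  assumes "3 \<le> x" "z \<le> x"
  shows "closed_modulus (big_modulus x z N b)"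
  unfolding closed_modulus_def
proof (intro conjI allI impI)
  show "odd (big_modulus x z N b)" by (rule odd_big_modulus)
  fix p r assume a: "prime p \<and> p dvd big_modulus x z N b \<and> odd r \<and> r < p"
  then have "p \<le> x" using prime_dvd_big_modulus_le assms by blast
  then have "r \<le> x" using a by simp
  then show "r dvd big_modulus x z N b" unfolding big_modulus_def using a by (intro dvd_Lcm) auto
qed

lemma primepow_factors_big_modulus_le:
  assumes "P \<in> primepow_factors (big_modulus x z N b)"
  shows "P \<le> max x N \<or> (\<exists>j\<le>b. P = 3 ^ j)"
proof -
  have P: "primepow P" "P dvd big_modulus x z N b" using assms by (auto simp: primepow_factors_def)
  obtain m where m: "P dvd m" "m > 0" "m \<le> x \<or> smooth z m \<and> m \<le> N \<or> m = 3 ^ b"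
    using primepow_dvd_big_modulus[OF P] by blast
  have "P \<le> m" using m dvd_imp_le by blast
  show ?thesis
  proof (cases "m = 3 ^ b")
    case True
    moreover have "prime (3::nat)" by simp
    ultimately show ?thesis using m(1) divides_primepow_nat[of 3 P b] by auto
  next
    case False
    then show ?thesis using m \<open>P \<le> m\<close> by auto
  qed
qed

lemma aprimedivisor_big_modulus_le:
  assumes "P \<in> primepow_factors (big_modulus x z N b)" "3 \<le> x" "z \<le> x"
  shows "aprimedivisor P \<le> x"
proof -
  have P: "primepow P" "P dvd big_modulus x z N b" using assms by (auto simp: primepow_factors_def)
  then obtain p k where p: "prime p" "k > 0" "P = p ^ k" by (auto simp: primepow_def)
  then have "p dvd P" by simp
  then have "p dvd big_modulus x z N b" using P(2) dvd_trans by blast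
  then have "p \<le> x" using prime_dvd_big_modulus_le p assms by blast
  then show ?thesis using p by (simp add: aprimedivisor_prime_power)
qed

text \<open>A prime power dividing the modulus is at most 2^x, so both its prime and its exponent
  are at most x. With X \<ge> x^2 the elimination then subtracts at most 1.\<close>

lemma card_big_modulus_le:
  assumes "3 \<le> x" "z \<le> x" "N \<le> 2 ^ x" "3 ^ b \<le> (2::nat) ^ x"
  shows "card (primepow_factors (big_modulus x z N b)) \<le> x ^ 2"
proof -
  have "primepow_factors (big_modulus x z N b) \<subseteq> (\<lambda>(p, j). p ^ j) ` ({1..x} \<times> {1..x})"
  proof
    fix P assume PP: "P \<in> primepow_factors (big_modulus x z N b)"
    then have P: "primepow P" by (auto simp: primepow_factors_def)
    then obtain p k where p: "prime p" "k > 0" "P = p ^ k" by (auto simp: primepow_def)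
    have px: "p \<le> x" using aprimedivisor_big_modulus_le[OF PP assms(1,2)] p by (simp add: aprimedivisor_prime_power)
    have "x < 2 ^ x" by (rule less_exp)
    have "P \<le> 2 ^ x" using primepow_factors_big_modulus_le[OF PP]
    proof
      assume "P \<le> max x N"
      then show ?thesis using \<open>x < 2 ^ x\<close> assms(3) by linarith
    next
      assume "\<exists>j\<le>b. P = 3 ^ j"
      then obtain j where "j \<le> b" "P = 3 ^ j" by blast
      then have "P \<le> 3 ^ b" by (simp add: power_increasing)
      then show ?thesis using assms(4) by linarith
    qed
    moreover have "2 ^ k \<le> P" unfolding p(3) using prime_ge_2_nat[OF p(1)] by (intro power_mono) auto
    ultimately have "(2::nat) ^ k \<le> 2 ^ x" by linarith
    then have "k \<le> x" by simp
    then show "P \<in> (\<lambda>(p, j). p ^ j) ` ({1..x} \<times> {1..x})"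
      using p px prime_gt_0_nat[OF p(1)] by (intro image_eqI[of _ _ "(p, k)"]) auto
  qed
  then have "card (primepow_factors (big_modulus x z N b)) \<le> card ((\<lambda>(p, j). p ^ j) ` ({1..x} \<times> {1..x}))"
    by (intro card_mono) auto
  also have "\<dots> \<le> card ({1..x} \<times> {1..x})" by (rule card_image_le) auto
  also have "\<dots> = x ^ 2" by (simp add: power2_eq_square)
  finally show ?thesis .
qed

text \<open>The prime powers involved are at most X, except possibly powers of 3 up to 3^b. Their
  extra charges 3 * 3^j form a geometric sum below 5 * 3^b; otherwise each of the at most x^2 prime
  powers costs 2 * X * x.\<close>

lemma elim_cost_big_modulus_le:
  assumes "3 \<le> x" "z \<le> x" "N \<le> 2 ^ x" "3 ^ b \<le> (2::nat) ^ x" "N \<le> X" "x \<le> X"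
  shows "elim_cost X (big_modulus x z N b) \<le> 2 * X * x ^ 3 + 5 * 3 ^ b"
proof -
  let ?P = "primepow_factors (big_modulus x z N b)"
  let ?T = "(\<lambda>j. 3 ^ j :: nat) ` {..b}"
  have fin: "finite ?P" using odd_big_modulus[of x z N b] by (intro finite_primepow_factors) (auto intro!: Nat.gr0I)
  have "aprimedivisor P * max (2 * X) P \<le> 2 * X * x + (if P \<in> ?T then 3 * P else 0)" if PP: "P \<in> ?P" for P
  proof (cases "P \<le> max x N")
    case True
    have "aprimedivisor P * max (2 * X) P \<le> x * (2 * X)"
      using aprimedivisor_big_modulus_le[OF PP assms(1,2)] True assms(5,6) by (intro mult_le_mono) auto
    also have "x * (2 * X) = 2 * X * x" by simp
    finally show ?thesis by (rule order_trans) simp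
  next
    case False
    then obtain j where j: "j \<le> b" "P = 3 ^ j" using primepow_factors_big_modulus_le[OF PP] by auto
    have "primepow P" using PP by (auto simp: primepow_factors_def)
    then have "j > 0" using j by (cases j) auto
    moreover have "prime (3::nat)" by simp
    ultimately have ap: "aprimedivisor P = 3" unfolding j(2) by (simp add: aprimedivisor_prime_power)
    have PT: "P \<in> ?T" using j by blast
    have "3 * max (2 * X) P \<le> 3 * (2 * X) + 3 * P" by simp
    moreover have "3 * (2 * X) \<le> x * (2 * X)" using assms(1) by (intro mult_le_mono) auto
    moreover have "x * (2 * X) = 2 * X * x" by simp
    ultimately have "aprimedivisor P * max (2 * X) P \<le> 2 * X * x + 3 * P" unfolding ap by linarith
    then show ?thesis using PT by (simp only: if_True)
  qed
  then have "elim_cost X (big_modulus x z N b) \<le> (\<Sum>P\<in>?P. 2 * X * x + (if P \<in> ?T then 3 * P else 0))"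
    unfolding elim_cost_def by (rule sum_mono)
  also have "\<dots> = card ?P * (2 * X * x) + (\<Sum>P\<in>?P. if P \<in> ?T then 3 * P else 0)" by (simp add: sum.distrib)
  also have "(\<Sum>P\<in>?P. if P \<in> ?T then 3 * P else 0) = (\<Sum>P\<in>?P \<inter> ?T. 3 * P)"
    using fin by (simp add: sum.inter_restrict)
  also have "\<dots> \<le> (\<Sum>P\<in>?T. 3 * P)" by (intro sum_mono2) auto
  also have "\<dots> = (\<Sum>j\<le>b. 3 * 3 ^ j)" by (subst sum.reindex) (auto simp: inj_on_def)
  also have "\<dots> \<le> 5 * 3 ^ b" by (induction b) auto
  also have "card ?P * (2 * X * x) \<le> x ^ 2 * (2 * X * x)"
    using card_big_modulus_le[OF assms(1-4)] by (intro mult_le_mono) auto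
  also have "x ^ 2 * (2 * X * x) = 2 * X * x ^ 3" by (simp add: power3_eq_cube power2_eq_square)
  finally show ?thesis by simp
qed

lemma smoothlcm_dvd_big_modulus:
  assumes "N \<le> 2 ^ B"
  shows "smoothlcm z N dvd 2 ^ B * big_modulus x z N b"
  unfolding smoothlcm_def
proof (rule Lcm_least)
  fix s assume "s \<in> {s. smooth z s \<and> s \<le> N}"
  then have s: "smooth z s" "s \<le> N" by auto
  then have "s > 0" by (simp add: smooth_def)
  then obtain i r where r: "odd r" "s = 2 ^ i * r" by (rule two_power_odd_decomp)
  have r0: "r > 0" using r(1) by (rule odd_pos)
  have "2 ^ i * 1 \<le> 2 ^ i * r" using r0 by (intro mult_le_mono) auto
  then have "2 ^ i \<le> (2::nat) ^ B" using r(2) s(2) assms by linarith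
  then have iB: "i \<le> B" by simp
  have "1 * r \<le> 2 ^ i * r" by (intro mult_le_mono) auto
  then have rN: "r \<le> N" using r(2) s(2) by linarith
  have "smooth z r" using s(1) r0 unfolding r(2) smooth_def by (meson dvd_mult)
  then have "r dvd big_modulus x z N b" unfolding big_modulus_def using r(1) rN by (intro dvd_Lcm) auto
  then show "s dvd 2 ^ B * big_modulus x z N b" unfolding r(2) using iB
    by (intro mult_dvd_mono le_imp_power_dvd)
qed

lemma Ints_dvd_mult:
  assumes "L dvd W" "real L * t \<in> \<int>"
  shows "real W * t \<in> \<int>"
proof -
  obtain w where "W = L * w" using assms(1) by blast
  then have "real W * t = real w * (real L * t)" by simp
  then show ?thesis using assms(2) by (metis Ints_mult Ints_of_nat)
qed

lemma alpha_partitionI: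
  assumes "finite A" "0 \<notin> A" "\<Sum>A = n" "rsum A = real p / real q"
  shows "alpha_partition (of_nat p / of_nat q) n A"
proof -
  have "of_rat (\<Sum>a\<in>A. 1 / of_nat a) = (of_rat (of_nat p / of_nat q) :: real)"
    using assms(4) by (simp add: of_rat_sum of_rat_divide rsum_def)
  then have "(\<Sum>a\<in>A. 1 / of_nat a) = (of_nat p / of_nat q :: rat)" by (simp only: of_rat_eq_iff)
  moreover have "\<forall>a\<in>A. 0 < a" using assms(2) by (auto intro!: Nat.gr0I)
  ultimately show ?thesis using assms(1,3) by (simp add: alpha_partition_def)
qed

text \<open>The partition is \<open>k * (F \<union> 289 * E \<union> 289 * q * y * E0) \<union> 17 * 2 ^ c * A1 \<union> 3 ^ b * A2\<close>, where \<open>k\<close>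
  rescales \<open>p / q\<close> to at least \<open>1\<close>, \<open>F\<close> fills \<open>[1, N]\<close>, \<open>E0\<close> eliminates \<open>q * y\<close>, and \<open>E\<close> expands what is left.
  The scales are chosen to force \<open>F < 289 * E < 289 * q * y * E0\<close> elementwise, apart from the dyadic
  elements of \<open>E\<close>. The bound \<open>T0\<close> exceeds \<open>k * N\<close>, and \<open>V\<close> bounds the sum of \<open>E\<close>.\<close>

locale assembly =
  fixes p q k N z x :: nat
  assumes p0: "p > 0" and q0: "q > 0" and k0: "k > 0" and N0: "N > 0"
    and a1: "1 \<le> real k * (real p / real q)"
    and x3: "x \<ge> 3" and zx: "z \<le> x"
    and fill: "\<And>\<tau>. 0 \<le> \<tau> \<Longrightarrow> \<tau> \<le> real k * (real p / real q) \<Longrightarrow> \<exists>F. finite F \<and> F \<subseteq> {1..N} \<and>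
      \<tau> - 1 / 578 < rsum F \<and> rsum F \<le> \<tau> \<and> real (smoothlcm z N) * rsum F \<in> \<int> \<and> F \<inter> excluded = {}"
begin

text \<open>Both 2^c and 3^b will be at least T0, so with 4624 = 16 * 289 each Graham copy uses at
  most 1 / 4624 of the target.\<close>

definition "T0 = 4624 * k * (N + 1) + x"
text \<open>Above N to keep E off the filled interval, and at least x^2 to outweigh the number of
  eliminated prime powers.\<close>

definition "X = N + x + 8 * x ^ 2"
text \<open>The dyadic part of E adds at most 4 * T0 + 8 * X * x, the eliminating part at most 2 * X
  * x^3 + 15 * T0.\<close>

definition "V = 19 * T0 + 10 * X * x ^ 3"

context
  assumes big1: "3 * T0 \<le> 2 ^ x" and big2: "V + N + 5 * q \<le> oddlcm x"
begin

lemma exists_powers: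
  obtains b c B where "T0 \<le> 3 ^ b" "3 ^ b < 3 * T0" "T0 \<le> 2 ^ c" "2 ^ c < 2 * T0"
    "c \<le> B" "2 * X * x \<le> 2 ^ B" "2 ^ B \<le> 2 * T0 + 4 * X * x"
proof -
  have T: "T0 \<ge> 2" using x3 by (simp add: T0_def)
  have "X \<ge> 1" "x \<ge> 1" using x3 by (simp_all add: X_def)
  then have "2 * 1 * 1 \<le> 2 * X * x" by (intro mult_le_mono) auto
  then have XX: "2 * X * x \<ge> 2" by simp
  have ex: "\<exists>j. m \<le> r ^ j \<and> r ^ j < r * m" if rm: "r \<ge> 2" "m \<ge> 2" for r m :: nat
  proof -
    obtain j where "r ^ j < m" "m \<le> r ^ (j + 1)" using ex_power_ivl2[OF rm] by blast
    then show ?thesis using rm by (intro exI[of _ "j + 1"]) auto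
  qed
  obtain b where b: "T0 \<le> 3 ^ b" "3 ^ b < 3 * T0" using ex[of 3 T0] T by auto
  obtain c where c: "T0 \<le> 2 ^ c" "2 ^ c < 2 * T0" using ex[of 2 T0] T by auto
  obtain d where d: "2 * X * x \<le> 2 ^ d" "2 ^ d < 2 * (2 * X * x)" using ex[of 2 "2 * X * x"] XX by auto
  have "(2::nat) ^ d \<le> 2 ^ max c d" by (rule power_increasing) auto
  then have "2 * X * x \<le> 2 ^ max c d" using d(1) by linarith
  moreover have "(2::nat) ^ max c d \<le> 2 * T0 + 4 * X * x" using c(2) d(2) by (auto simp: max_def)
  ultimately show ?thesis using that[of b c "max c d"] b c by simp
qed

text \<open>The denominators of F and of both copies are absorbed by 2^B and the big modulus, so
  only q has to be cancelled and E0 can be chosen before F. F then stops slightly short of the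
  target, and E expands 289 times what is missing, a number in [1, 2).\<close>

lemma core_sets:
  obtains F E E0 b c y where
    "T0 \<le> 3 ^ b" "3 ^ b < 3 * T0" "T0 \<le> 2 ^ c" "2 ^ c < 2 * T0"
    "V + N < q * y" "q * y \<le> V + N + 5 * q"
    "finite F" "F \<subseteq> {1..N}" "F \<inter> excluded = {}"
    "finite E" "0 \<notin> E" "\<And>e. e \<in> E \<Longrightarrow> N < e \<or> (\<exists>i. e = 2 ^ i)" "\<Sum>E \<le> V"
    "finite E0" "0 \<notin> E0" "\<Sum>E0 \<le> kill_cost x"
    "rsum F + rsum E / 289 + rsum E0 / (289 * real (q * y)) + real k / (17 * 2 ^ c) + real k / 3 ^ b
      = real k * (real p / real q)"
proof -
  obtain b c B where pw: "T0 \<le> 3 ^ b" "3 ^ b < 3 * T0" "T0 \<le> 2 ^ c" "2 ^ c < 2 * T0"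
    "c \<le> B" "2 * X * x \<le> 2 ^ B" "2 ^ B \<le> 2 * T0 + 4 * X * x" by (rule exists_powers)
  \<comment> \<open>A multiple q * y of q above V + N. The summand 5 also gives q * y \<ge> 5, which
    bounds the share of E0 by 2 / (289 * 5).\<close>
  define y where "y = (V + N) div q + 5"
  define a where "a = real k * (real p / real q)"
  have "(V + N) div q * q + (V + N) mod q = V + N" by simp
  moreover have "(V + N) mod q < q" using q0 by simp
  moreover have "q * y = (V + N) div q * q + 5 * q" by (simp add: y_def algebra_simps)
  ultimately have qy: "V + N < q * y" "q * y \<le> V + N + 5 * q" by linarith+
  have qy5: "5 \<le> q * y" using q0 unfolding y_def by (simp add: algebra_simps)
  let ?O = "oddlcm x" and ?M = "big_modulus x z N b"
  have O0: "?O > 0" by (rule oddlcm_pos)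
  have x2: "x \<ge> 2" and qy0: "q * y > 0" and qyO: "q * y \<le> ?O" using x3 qy5 qy big2 by linarith+
  \<comment> \<open>Over the denominator \<open>?O\<close> * q * y the difference 289 * a - rsum E0
    / (q * y) has numerator 289 * k * p * y * \<open>?O\<close> - r, so this residue cancels q *
    y.\<close>
  obtain E0 r where E0: "finite E0" "rsum E0 = real r / real ?O"
    "[int r = int (289 * k * p * y * ?O)] (mod int (q * y))" "1 \<le> rsum E0" "rsum E0 < 2" "0 \<notin> E0" "\<Sum>E0 \<le> kill_cost x"
    using kill_modulus[OF x2 qy0 qyO, of "int (289 * k * p * y * ?O)"] by metis
  obtain w where w: "int (289 * k * p * y * ?O) - int r = int (q * y) * w"
    using E0(3) by (metis cong_iff_dvd_diff cong_sym dvd_def)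
  have y0: "y > 0" by (simp add: y_def)
  have killed: "real ?O * (289 * a - rsum E0 / real (q * y)) = of_int w"
  proof -
    have "real ?O * (289 * a - rsum E0 / real (q * y)) * real (q * y) = real (289 * k * p * y * ?O) - real r"
      unfolding a_def E0(2) using q0 y0 O0 by (simp add: field_simps)
    also have "\<dots> = of_int (int (289 * k * p * y * ?O) - int r)" by simp
    also have "\<dots> = of_int w * real (q * y)" unfolding w by simp
    finally show ?thesis using qy0 by (metis mult_cancel_right of_nat_0_less_iff less_irrefl)
  qed
  \<comment> \<open>The reserved 1 / 289 becomes 1 after scaling, so that \<rho> = 1 + 289 * (\<tau>
    - rsum F) lies in [1, 3/2).\<close>
  define \<tau> where "\<tau> = a - real k / (17 * 2 ^ c) - real k / 3 ^ b - rsum E0 / (289 * real (q * y)) - 1 / 289"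
  have kT: "4624 * real k \<le> real T0"
  proof -
    have "4624 * k * 1 \<le> 4624 * k * (N + 1)" by (intro mult_le_mono) auto
    then have "4624 * k \<le> T0" unfolding T0_def by linarith
    then show ?thesis by (metis of_nat_le_iff of_nat_mult of_nat_numeral)
  qed
  have T0pos: "real T0 > 0" using kT k0 by linarith
  have kc: "real k / (17 * 2 ^ c) \<le> 1 / 4624"
  proof -
    have "real T0 \<le> 2 ^ c" using pw(3) by (metis of_nat_le_iff of_nat_numeral of_nat_power)
    then have "4624 * real k \<le> 17 * 2 ^ c" using kT T0pos by linarith
    then show ?thesis by (simp add: field_simps)
  qed
  have kb: "real k / 3 ^ b \<le> 1 / 4624"
  proof -
    have "real T0 \<le> 3 ^ b" using pw(1) by (metis of_nat_le_iff of_nat_numeral of_nat_power)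
    then have "4624 * real k \<le> 3 ^ b" using kT by linarith
    then show ?thesis by (simp add: field_simps)
  qed
  have ke: "rsum E0 / (289 * real (q * y)) \<le> 2 / (289 * 5)"
    using E0(4,5) qy5 by (intro frac_le) (auto simp del: of_nat_mult)
  have pos: "real k / (17 * 2 ^ c) \<ge> 0" "real k / 3 ^ b \<ge> 0" "rsum E0 / (289 * real (q * y)) \<ge> 0"
    using E0(4) by auto
  have \<tau>: "0 \<le> \<tau>" "\<tau> \<le> a" using kc kb ke pos a1 unfolding \<tau>_def a_def[symmetric] by linarith+
  obtain F where F: "finite F" "F \<subseteq> {1..N}" "\<tau> - 1 / 578 < rsum F" "rsum F \<le> \<tau>"
    "real (smoothlcm z N) * rsum F \<in> \<int>" "F \<inter> excluded = {}"
    using fill[OF \<tau>(1)] \<tau>(2) unfolding a_def by metis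
  define \<rho> where "\<rho> = 289 * (a - real k / (17 * 2 ^ c) - real k / 3 ^ b - rsum F) - rsum E0 / real (q * y)"
  have \<rho>\<tau>: "\<rho> = 289 * (\<tau> - rsum F) + 1" unfolding \<rho>_def \<tau>_def by simp
  have "1 \<le> \<rho>" using F(4) unfolding \<rho>\<tau> by simp
  moreover have "\<rho> < 2" using F(3) unfolding \<rho>\<tau> by (simp add: field_simps)
  ultimately have \<rho>: "1 \<le> \<rho>" "\<rho> < 2" by blast+
  have X0: "X > 0" using N0 by (simp add: X_def)
  have NX: "N \<le> X" "x \<le> X" by (simp_all add: X_def)
  have "1 \<le> 2 * x" using x3 by simp
  then have "X * 1 \<le> X * (2 * x)" by (rule mult_le_mono2)
  moreover have "X * (2 * x) = 2 * X * x" by simp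
  ultimately have XB: "X \<le> 2 ^ B" using pw(6) by linarith
  have N2: "N \<le> 2 ^ x"
  proof -
    have "1 * N \<le> 4624 * k * (N + 1)" using k0 by (intro mult_le_mono) auto
    then have "N \<le> T0" unfolding T0_def by linarith
    then show ?thesis using big1 by linarith
  qed
  have b2: "3 ^ b \<le> (2::nat) ^ x" using pw(2) big1 by linarith
  let ?W = "2 ^ B * ?M"
  have int: "2 ^ B * real ?M * \<rho> \<in> \<int>"
  proof -
    have OM: "?O dvd ?W"
      unfolding oddlcm_def by (intro dvd_mult Lcm_least) (auto simp: big_modulus_def intro!: dvd_Lcm)
    have i1: "real ?W * (289 * a - rsum E0 / real (q * y)) \<in> \<int>"
      by (rule Ints_dvd_mult[OF OM]) (subst killed, simp)
    \<comment> \<open>289 / 17 = 17, so the scaling clears the factor 17 from the denominator of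
      this copy.\<close>
    have i2: "real ?W * (17 * real k / 2 ^ c) \<in> \<int>"
    proof (rule Ints_dvd_mult)
      show "2 ^ c dvd ?W" using pw(5) by (intro dvd_mult2 le_imp_power_dvd)
      have "real (2 ^ c) * (17 * real k / 2 ^ c) = real (17 * k)" by simp
      then show "real (2 ^ c) * (17 * real k / 2 ^ c) \<in> \<int>" by (metis Ints_of_nat)
    qed
    have i3: "real ?W * (289 * real k / 3 ^ b) \<in> \<int>"
    proof (rule Ints_dvd_mult)
      show "3 ^ b dvd ?W" unfolding big_modulus_def by (intro dvd_mult dvd_Lcm) auto
      have "real (3 ^ b) * (289 * real k / 3 ^ b) = real (289 * k)" by simp
      then show "real (3 ^ b) * (289 * real k / 3 ^ b) \<in> \<int>" by (metis Ints_of_nat)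
    qed
    have "smoothlcm z N dvd ?W" using NX(1) XB by (intro smoothlcm_dvd_big_modulus) linarith
    then have i4: "real ?W * rsum F \<in> \<int>" using F(5) Ints_dvd_mult by blast
    have "2 ^ B * real ?M * \<rho> = real ?W * (289 * a - rsum E0 / real (q * y)) - real ?W * (17 * real k / 2 ^ c)
      - real ?W * (289 * real k / 3 ^ b) - 289 * (real ?W * rsum F)"
      unfolding \<rho>_def by (simp add: algebra_simps)
    also have "\<dots> \<in> \<int>" using i1 i2 i3 i4 by (intro Ints_diff Ints_mult[of 289]) auto
    finally show ?thesis .
  qed
  have "card (primepow_factors ?M) \<le> x ^ 2" by (rule card_big_modulus_le[OF x3 zx N2 b2])
  also have "x ^ 2 \<le> X" by (simp add: X_def)
  finally have "real (card (primepow_factors ?M)) / real X \<le> 1" using X0 by simp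
  then have low: "real (card (primepow_factors ?M)) / real X \<le> \<rho>" using \<rho>(1) by linarith
  have pd: "\<And>p. prime p \<Longrightarrow> p dvd ?M \<Longrightarrow> p \<le> x" using prime_dvd_big_modulus_le x3 zx by blast
  have "\<exists>E. finite E \<and> rsum E = \<rho> \<and> (\<forall>e\<in>E. e dvd 2 ^ B * ?M) \<and>
      (\<forall>e\<in>E. X \<le> e \<or> (\<exists>i. e = 2 ^ i)) \<and> \<Sum>E \<le> 2 ^ Suc B + elim_cost X ?M"
  proof (rule unit_fraction_sum[OF X0 pw(6) closed_big_modulus[OF x3 zx] pd int low \<rho>(2)])
    fix E assume E: "finite E" "rsum E = \<rho>" "\<And>e. e \<in> E \<Longrightarrow> e dvd 2 ^ B * ?M"
      "\<And>e. e \<in> E \<Longrightarrow> X \<le> e \<or> (\<exists>i. e = 2 ^ i)" "\<Sum>E \<le> 2 ^ Suc B + elim_cost X ?M"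
    show "\<exists>E. finite E \<and> rsum E = \<rho> \<and> (\<forall>e\<in>E. e dvd 2 ^ B * ?M) \<and>
      (\<forall>e\<in>E. X \<le> e \<or> (\<exists>i. e = 2 ^ i)) \<and> \<Sum>E \<le> 2 ^ Suc B + elim_cost X ?M"
      by (intro exI[of _ E] conjI ballI) (fact E)+
  qed
  then obtain E where E: "finite E" "rsum E = \<rho>" "\<And>e. e \<in> E \<Longrightarrow> e dvd 2 ^ B * ?M"
    "\<And>e. e \<in> E \<Longrightarrow> X \<le> e \<or> (\<exists>i. e = 2 ^ i)" "\<Sum>E \<le> 2 ^ Suc B + elim_cost X ?M" by blast
  have EV: "\<Sum>E \<le> V"
  proof -
    have "elim_cost X ?M \<le> 2 * X * x ^ 3 + 5 * 3 ^ b"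
      by (rule elim_cost_big_modulus_le[OF x3 zx N2 b2 NX])
    moreover have "(2::nat) ^ Suc B \<le> 4 * T0 + 8 * (X * x)" using pw(7) by simp
    moreover have "X * x \<le> X * x ^ 3" using x3 by (intro mult_le_mono2 self_le_power) auto
    moreover have "2 * X * x ^ 3 = 2 * (X * x ^ 3)" "10 * X * x ^ 3 = 10 * (X * x ^ 3)" by simp_all
    ultimately show ?thesis using E(5) pw(2) unfolding V_def by linarith
  qed
  have E00: "0 \<notin> E"
  proof
    assume "0 \<in> E"
    then have "0 dvd 2 ^ B * ?M" using E(3) by blast
    then show False using odd_big_modulus[of x z N b] by auto
  qed
  have EN: "N < e \<or> (\<exists>i. e = 2 ^ i)" if "e \<in> E" for e
  proof -
    have "N < X" using x3 by (simp add: X_def)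
    then show ?thesis using E(4)[OF that] by auto
  qed
  have "rsum F + rsum E / 289 + rsum E0 / (289 * real (q * y)) + real k / (17 * 2 ^ c) + real k / 3 ^ b = a"
    unfolding E(2) \<rho>_def by (simp add: divide_simps) (simp add: algebra_simps)
  then show ?thesis
    using that[of b c y F E E0] pw(1-4) qy F(1,2,6) E(1) E00 EN EV E0(1,6,7) unfolding a_def by blast
qed

text \<open>If g \<le> N, then k * g < T0 lies below all elements of the two copies. Every other k *
  g is divisible by 17^2, whereas 17 * 2^c * a has exactly one factor 17 and 3^b * a none. The
  constants 2886 = 78 * (34 + 3) and 102 = 34 * 3 come from 17 * 2^c < 34 * T0 and 3^b < 3 *
  T0.\<close>

lemma threshold:
  "alpha_threshold (of_nat p / of_nat q)
     (k * (N * N + 289 * V + 289 * (V + N + 5 * q) * kill_cost x) + 2886 * T0 + 102 * T0 ^ 2)"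
proof -
  obtain F E E0 b c y where pw: "T0 \<le> 3 ^ b" "3 ^ b < 3 * T0" "T0 \<le> 2 ^ c" "2 ^ c < 2 * T0"
    and qy: "V + N < q * y" "q * y \<le> V + N + 5 * q"
    and F: "finite F" "F \<subseteq> {1..N}" "F \<inter> excluded = {}"
    and E: "finite E" "0 \<notin> E" "\<And>e. e \<in> E \<Longrightarrow> N < e \<or> (\<exists>i. e = 2 ^ i)" "\<Sum>E \<le> V"
    and E0: "finite E0" "0 \<notin> E0" "\<Sum>E0 \<le> kill_cost x"
    and tot: "rsum F + rsum E / 289 + rsum E0 / (289 * real (q * y)) + real k / (17 * 2 ^ c) + real k / 3 ^ b
      = real k * (real p / real q)"
    by (rule core_sets) blast
  define G where "G = F \<union> ((*) 289 ` E \<union> (*) (289 * (q * y)) ` E0)"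
  let ?R = "k * \<Sum>G" and ?K = "17 * 2 ^ c :: nat" and ?D = "3 ^ b :: nat"
  have qy0: "q * y > 0" using qy by linarith
  have finG: "finite G" using F(1) E(1) E0(1) by (simp add: G_def)
  have d1: "(*) 289 ` E \<inter> (*) (289 * (q * y)) ` E0 = {}"
  proof -
    have "289 * e \<noteq> 289 * (q * y) * e0" if "e \<in> E" "e0 \<in> E0" for e e0
    proof -
      have "e \<le> V" using member_le_sum_nat[OF E(1) that(1)] E(4) by linarith
      moreover have "e0 > 0" using that(2) E0(2) by (auto intro!: Nat.gr0I)
      then have "q * y * 1 \<le> q * y * e0" by (intro mult_le_mono) auto
      ultimately have "e < q * y * e0" using qy(1) by linarith
      then show ?thesis by (simp add: mult.assoc)
    qed
    then show ?thesis by blast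
  qed
  have d2: "F \<inter> ((*) 289 ` E \<union> (*) (289 * (q * y)) ` E0) = {}"
  proof -
    have "289 * e \<notin> F" if eE: "e \<in> E" for e
    proof (cases "N < e")
      case True
      then have "N < 289 * e" by simp
      then show ?thesis using F(2) by (meson atLeastAtMost_iff not_le subsetD)
    next
      case False
      then obtain i where "e = 2 ^ i" using E(3)[OF eE] by blast
      then have "289 * e \<in> excluded" by (auto simp: excluded_def)
      then show ?thesis using F(3) by blast
    qed
    moreover have "289 * (q * y) * e \<notin> F" if "e \<in> E0" for e
    proof -
      have "e > 0" using that E0(2) by (auto intro!: Nat.gr0I)
      then have "1 * (q * y) * 1 \<le> 289 * (q * y) * e" by (intro mult_le_mono) auto
      then have "N < 289 * (q * y) * e" using qy(1) by linarith
      then show ?thesis using F(2) by (meson atLeastAtMost_iff not_le subsetD)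
    qed
    ultimately show ?thesis by blast
  qed
  have sumG: "\<Sum>G = \<Sum>F + (289 * \<Sum>E + 289 * (q * y) * \<Sum>E0)"
    unfolding G_def using F(1) E(1) E0(1) d1 d2 qy0 by (simp add: sum.union_disjoint sum_scale)
  have rsumG: "rsum G = rsum F + (rsum E / 289 + rsum E0 / (289 * real (q * y)))"
    unfolding G_def using F(1) E(1) E0(1) d1 d2 qy0 by (simp add: rsum_Un rsum_scale)
  have rsumG': "rsum G / real k + 1 / real ?K + 1 / real ?D = real p / real q"
  proof -
    have "rsum G + real k / real ?K + real k / real ?D = real k * (real p / real q)" unfolding rsumG using tot by simp
    then have "(rsum G + real k / real ?K + real k / real ?D) / real k = real p / real q" using k0 by simp
    then show ?thesis using k0 by (simp add: add_divide_distrib)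
  qed
  have G17: "g \<le> N \<or> 289 dvd g" if "g \<in> G" for g
    using that F(2) by (auto simp: G_def mult.assoc)
  have G0: "0 \<notin> G" using F(2) E(2) E0(2) qy0 by (auto simp: G_def)
  have kN: "k * N < T0"
  proof -
    have "1 * (k * N) \<le> 4624 * k * (N + 1)" unfolding mult.assoc by (intro mult_le_mono) auto
    then show ?thesis unfolding T0_def using x3 by linarith
  qed
  have part: "\<exists>A. alpha_partition (of_nat p / of_nat q) n A" if n: "n \<ge> ?R + (78 * (?K + ?D) + ?K * ?D)" for n
  proof -
    have "coprime (17::nat) 3" "coprime (2::nat) 3" by (rule primes_coprime; simp)+
    then have "coprime ?K ?D" by simp
    moreover have "?D > 0" by simp
    moreover have "n - ?R \<ge> 78 * (?K + ?D) + ?K * ?D" using n by linarith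
    ultimately obtain m1 m2 where m: "m1 \<ge> 78" "m2 \<ge> 78" "n - ?R = ?K * m1 + ?D * m2"
      by (rule frobenius_shifted)
    obtain A1 where "good_partition m1 A1" using good_partition_exists m(1) by blast
    then have A1: "finite A1" "0 \<notin> A1" "\<And>a. a \<in> A1 \<Longrightarrow> \<not> 17 dvd a" "\<Sum>A1 = m1" "rsum A1 = 1"
      by (auto simp: good_partition_def)
    obtain A2 where "good_partition m2 A2" using good_partition_exists m(2) by blast
    then have A2: "finite A2" "0 \<notin> A2" "\<And>a. a \<in> A2 \<Longrightarrow> \<not> 17 dvd a" "\<Sum>A2 = m2" "rsum A2 = 1"
      by (auto simp: good_partition_def)
    have p17: "prime (17::nat)" by simp
    have n2: "\<not> 17 dvd 2 ^ c * a" if "\<not> 17 dvd a" for a :: nat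
    proof
      assume "17 dvd 2 ^ c * a"
      then have "17 dvd (2::nat) ^ c" using that p17 prime_dvd_mult_iff by blast
      then have "17 dvd (2::nat)" using p17 prime_dvd_power by blast
      then show False by simp
    qed
    have n3: "\<not> 17 dvd 3 ^ b * a" if "\<not> 17 dvd a" for a :: nat
    proof
      assume "17 dvd 3 ^ b * a"
      then have "17 dvd (3::nat) ^ b" using that p17 prime_dvd_mult_iff by blast
      then have "17 dvd (3::nat)" using p17 prime_dvd_power by blast
      then show False by simp
    qed
    have D1: "k * g \<noteq> ?K * a" if "g \<in> G" "a \<in> A1" for g a
    proof
      assume eq: "k * g = ?K * a"
      have a0: "a > 0" using that(2) A1(2) by (auto intro!: Nat.gr0I)
      from G17[OF that(1)] show False
      proof
        assume "g \<le> N"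
        then have "k * g < T0" using kN mult_le_mono2[of g N k] by linarith
        moreover have "1 * 2 ^ c * 1 \<le> 17 * 2 ^ c * a" using a0 by (intro mult_le_mono) auto
        ultimately show False using eq pw(3) by linarith
      next
        assume "289 dvd g"
        then obtain h where "g = 289 * h" by blast
        then have "17 * (17 * (k * h)) = 17 * (2 ^ c * a)" using eq by (simp add: mult_ac)
        then have "17 * (k * h) = 2 ^ c * a" by linarith
        then have "17 dvd 2 ^ c * a" by (metis dvd_triv_left)
        then show False using n2 A1(3)[OF that(2)] by blast
      qed
    qed
    have D2: "k * g \<noteq> ?D * a" if "g \<in> G" "a \<in> A2" for g a
    proof
      assume eq: "k * g = ?D * a"
      have a0: "a > 0" using that(2) A2(2) by (auto intro!: Nat.gr0I)
      from G17[OF that(1)] show False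
      proof
        assume "g \<le> N"
        then have "k * g < T0" using kN mult_le_mono2[of g N k] by linarith
        moreover have "3 ^ b * 1 \<le> 3 ^ b * a" using a0 by (intro mult_le_mono) auto
        ultimately show False using eq pw(1) by linarith
      next
        assume "289 dvd g"
        then obtain h where "g = 289 * h" by blast
        then have "17 * (17 * (k * h)) = 3 ^ b * a" using eq by (simp add: mult_ac)
        then have "17 dvd 3 ^ b * a" by (metis dvd_triv_left)
        then show False using n3 A2(3)[OF that(2)] by blast
      qed
    qed
    have D3: "?K * a \<noteq> ?D * a'" if "a \<in> A1" "a' \<in> A2" for a a'
    proof
      assume "?K * a = ?D * a'"
      then have "17 * (2 ^ c * a) = 3 ^ b * a'" by (simp add: mult_ac)
      then have "17 dvd 3 ^ b * a'" by (metis dvd_triv_left)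
      then show False using n3 A2(3)[OF that(2)] by blast
    qed
    define A where "A = (*) k ` G \<union> ((*) ?K ` A1 \<union> (*) ?D ` A2)"
    have disj: "(*) ?K ` A1 \<inter> (*) ?D ` A2 = {}" "(*) k ` G \<inter> ((*) ?K ` A1 \<union> (*) ?D ` A2) = {}"
      using D1 D2 D3 by blast+
    have K0: "?K > 0" "?D > 0" by simp_all
    have "\<Sum>A = \<Sum>((*) k ` G) + (\<Sum>((*) ?K ` A1) + \<Sum>((*) ?D ` A2))"
      unfolding A_def using finG A1(1) A2(1) disj by (simp add: sum.union_disjoint)
    also have "\<dots> = ?R + (?K * m1 + ?D * m2)"
      unfolding sum_scale[OF k0] sum_scale[OF K0(1)] sum_scale[OF K0(2)] A1(4) A2(4) by (rule refl)
    also have "\<dots> = n" using m(3) n by linarith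
    finally have sA: "\<Sum>A = n" .
    have "rsum A = rsum ((*) k ` G) + (rsum ((*) ?K ` A1) + rsum ((*) ?D ` A2))"
      unfolding A_def using finG A1(1) A2(1) disj by (simp add: rsum_Un)
    also have "\<dots> = real p / real q"
      unfolding rsum_scale[OF k0] rsum_scale[OF K0(1)] rsum_scale[OF K0(2)] A1(5) A2(5) using rsumG' by simp
    finally have rA: "rsum A = real p / real q" .
    have "finite A" unfolding A_def using finG A1(1) A2(1) by simp
    moreover have "0 \<notin> A" unfolding A_def using G0 A1(2) A2(2) k0 by auto
    ultimately have "alpha_partition (of_nat p / of_nat q) n A" using sA rA by (intro alpha_partitionI)
    then show ?thesis by blast
  qed
  have bound: "?R + (78 * (?K + ?D) + ?K * ?D) \<le>
    k * (N * N + 289 * V + 289 * (V + N + 5 * q) * kill_cost x) + 2886 * T0 + 102 * T0 ^ 2"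
  proof -
    have "\<Sum>F \<le> (\<Sum>i\<in>{1..N}. N)"
    proof -
      have "\<Sum>F \<le> (\<Sum>i\<in>F. N)" using F(2) by (intro sum_mono) auto
      also have "\<dots> \<le> (\<Sum>i\<in>{1..N}. N)" using F(2) by (intro sum_mono2) auto
      finally show ?thesis .
    qed
    then have f: "\<Sum>F \<le> N * N" by simp
    have "289 * (q * y) * \<Sum>E0 \<le> 289 * (V + N + 5 * q) * kill_cost x"
      using qy(2) E0(3) by (intro mult_le_mono) auto
    then have "\<Sum>G \<le> N * N + 289 * V + 289 * (V + N + 5 * q) * kill_cost x"
      unfolding sumG using f E(4) by linarith
    then have r: "?R \<le> k * (N * N + 289 * V + 289 * (V + N + 5 * q) * kill_cost x)" by (rule mult_le_mono2)
    have K: "?K \<le> 34 * T0" "?D \<le> 3 * T0" using pw(2,4) by linarith+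
    have "?K * ?D \<le> (34 * T0) * (3 * T0)" using K by (rule mult_le_mono)
    also have "\<dots> = 102 * T0 ^ 2" by (simp add: power2_eq_square)
    finally have kd: "?K * ?D \<le> 102 * T0 ^ 2" .
    have "78 * (?K + ?D) \<le> 78 * (34 * T0 + 3 * T0)" by (intro mult_le_mono add_mono K order_refl)
    then have kd2: "78 * (?K + ?D) \<le> 2886 * T0" by simp
    show ?thesis using r kd kd2 by linarith
  qed
  have "0 < T0" using x3 by (simp add: T0_def)
  then show ?thesis unfolding alpha_threshold_def using part bound by (auto intro: order_trans)
qed

end

end

section \<open>Asymptotics\<close>

lemma estimate_V:
  fixes k N x T X V :: real
  assumes "k \<ge> 1" "N \<ge> 1" "x \<ge> 1" "T = 4624 * k * (N + 1) + x" "X = N + x + 8 * x ^ 2" "V = 19 * T + 10 * X * x ^ 3"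
  shows "T \<le> 9248 * (k * N) + x" "V \<le> 200000 * (k * N + N * x ^ 5)"
proof -
  have "k * 1 \<le> k * N" using assms by (intro mult_left_mono) auto
  then show T: "T \<le> 9248 * (k * N) + x" unfolding assms(4) by (simp add: algebra_simps)
  have p: "x \<le> x ^ 2" "1 \<le> x ^ 2" "x \<le> x ^ 5" using assms(3) by (auto intro: self_le_power)
  have "N * 1 \<le> N * x ^ 2" "1 * x ^ 2 \<le> N * x ^ 2" "1 * x ^ 5 \<le> N * x ^ 5"
    using assms p by (intro mult_left_mono mult_right_mono; simp)+
  then have "X \<le> 10 * (N * x ^ 2)" and xN: "x \<le> N * x ^ 5" using p unfolding assms(5) by linarith+
  then have "X * x ^ 3 \<le> 10 * (N * x ^ 2) * x ^ 3" using assms(3) by (intro mult_right_mono) auto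
  also have "\<dots> = 10 * (N * x ^ 5)" by (simp flip: power_add)
  finally have "10 * X * x ^ 3 \<le> 100 * (N * x ^ 5)" by simp
  moreover have "k * N \<ge> 0" using assms by simp
  moreover have "19 * T + W \<le> 200000 * (S + P)" if "W \<le> 100 * P" "0 \<le> S" "T \<le> 9248 * S + x" "x \<le> P"
    for W S P :: real using that assms(3) by argo
  ultimately show "V \<le> 200000 * (k * N + N * x ^ 5)" using T xN unfolding assms(6) by blast
qed

text \<open>The threshold is reduced to five monomials: k * q * \<kappa> leads to the first term of
  the theorem, k^2 * N^2 to the exponential one. The largest coefficient is about 2988 * 2 * 9248^2,
  which is below 10^12.\<close>

lemma estimate_total:
  fixes k N x q \<kappa> T X V :: real
  assumes "k \<ge> 1" "N \<ge> 1" "x \<ge> 1" "q \<ge> 1" "\<kappa> \<ge> 1"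
    and "T = 4624 * k * (N + 1) + x" "X = N + x + 8 * x ^ 2" "V = 19 * T + 10 * X * x ^ 3"
  shows "k * (N * N + 289 * V + 289 * (V + N + 5 * q) * \<kappa>) + 2886 * T + 102 * T ^ 2
    \<le> 10 ^ 12 * (k ^ 2 * N ^ 2 + x ^ 2 + k ^ 2 * N * \<kappa> + k * N * x ^ 5 * \<kappa> + k * q * \<kappa>)"
proof -
  note est = estimate_V[OF assms(1-3,6-8)]
  have kN: "k * N \<ge> 0" using assms by simp
  have Tge: "T \<ge> 1"
  proof -
    have "4624 * k * (N + 1) \<ge> 0" using assms by simp
    then show ?thesis unfolding assms(6) using assms(3) by linarith
  qed
  have V0: "V \<ge> 0" unfolding assms(7,8) using Tge assms by simp
  have T2: "T ^ 2 \<le> 171051008 * (k ^ 2 * N ^ 2) + 2 * x ^ 2"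
  proof -
    have "T ^ 2 \<le> (9248 * (k * N) + x) ^ 2" using est(1) Tge by (intro power_mono) auto
    also have "\<dots> \<le> 2 * (9248 * (k * N)) ^ 2 + 2 * x ^ 2"
    proof -
      have "0 \<le> (9248 * (k * N) - x) ^ 2" by simp
      then show ?thesis by (simp add: power2_eq_square algebra_simps)
    qed
    also have "2 * (9248 * (k * N)) ^ 2 = 171051008 * (k ^ 2 * N ^ 2)" by (simp add: power_mult_distrib)
    finally show ?thesis .
  qed
  have "T * 1 \<le> T * T" using Tge by (intro mult_left_mono) auto
  then have t: "2886 * T + 102 * T ^ 2 \<le> 2988 * T ^ 2" by (simp add: power2_eq_square)
  have kV: "k * V \<le> 200000 * (k ^ 2 * N + k * N * x ^ 5)"
  proof -
    have "k * V \<le> k * (200000 * (k * N + N * x ^ 5))" using est(2) assms by (intro mult_left_mono) auto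
    then show ?thesis by (simp add: algebra_simps power2_eq_square)
  qed
  have kV0: "k * V \<ge> 0" using V0 assms by simp
  have "k * V * 1 \<le> k * V * \<kappa>" using kV0 assms by (intro mult_left_mono) auto
  moreover have "k * V * \<kappa> \<le> 200000 * (k ^ 2 * N + k * N * x ^ 5) * \<kappa>" using kV assms by (intro mult_right_mono) auto
  moreover have "200000 * (k ^ 2 * N + k * N * x ^ 5) * \<kappa> = 200000 * (k ^ 2 * N * \<kappa>) + 200000 * (k * N * x ^ 5 * \<kappa>)"
    by (simp add: algebra_simps)
  moreover have "k * N * \<kappa> * 1 \<le> k * N * \<kappa> * x ^ 5" using assms by (intro mult_left_mono) auto
  moreover have "k * N * \<kappa> * x ^ 5 = k * N * x ^ 5 * \<kappa>" by simp
  moreover have "k * (N * N) * 1 \<le> k * (N * N) * k" using assms by (intro mult_left_mono) auto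
  moreover have "k * (N * N) * k = k ^ 2 * N ^ 2" by (simp add: power2_eq_square)
  moreover have "k * (N * N + 289 * V + 289 * (V + N + 5 * q) * \<kappa>) =
      k * (N * N) + 289 * (k * V) + 289 * (k * V * \<kappa>) + 289 * (k * N * \<kappa>) + 1445 * (k * q * \<kappa>)"
    by (simp add: algebra_simps)
  moreover have "k ^ 2 * N * \<kappa> \<ge> 0" "k * N * x ^ 5 * \<kappa> \<ge> 0" "k * q * \<kappa> \<ge> 0" "k ^ 2 * N ^ 2 \<ge> 0" "x ^ 2 \<ge> 0"
    using assms by simp_all
  moreover have "s + 289 * b + 289 * c + 289 * d + 1445 * e + h \<le> 1000000000000 * (K + y + f + g + e)"
    if "b \<le> c" "c \<le> S" "S = 200000 * f + 200000 * g" "d \<le> g" "s \<le> K" "0 \<le> f" "0 \<le> g" "0 \<le> e" "0 \<le> K" "0 \<le> y"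
      "h \<le> 2988 * U" "U \<le> 171051008 * K + 2 * y" for s b c d e h K y f g S U :: real
    using that by argo
  moreover have "(10::real) ^ 12 = 1000000000000" by simp
  ultimately show ?thesis using t T2 unfolding mult_1_right by (simp only: add.assoc)
qed

section \<open>Bounds for the truncated logarithm and the cost of removing q\<close>

lemma clog_ge_1: "clog t \<ge> 1"
proof (cases "t < exp 1")
  case False
  moreover have "(0::real) < exp 1" by simp
  ultimately have "ln (exp 1) \<le> ln t" by (subst ln_le_cancel_iff) linarith+
  then show ?thesis using False by (simp add: clog_def)
qed (simp add: clog_def)

lemma clog_le_self: "t \<ge> 1 \<Longrightarrow> clog t \<le> t"
  using ln_le_minus_one[of t] by (auto simp: clog_def)

lemma le_exp_clog: "t > 0 \<Longrightarrow> t \<le> exp (clog t)"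
  by (auto simp: clog_def)

lemma exp_clog_le: "t \<ge> 1 \<Longrightarrow> exp (clog t) \<le> exp 1 * t"
  by (auto simp: clog_def)

lemma clog_le_ln: "t \<ge> 3 \<Longrightarrow> s \<le> t \<Longrightarrow> clog s \<le> ln t"
proof -
  assume t: "t \<ge> 3" "s \<le> t"
  have "exp 1 \<le> (3::real)" by (rule exp_le)
  then have "ln (exp 1) \<le> ln t" using t by (subst ln_le_cancel_iff) auto
  moreover have "ln s \<le> ln t" if "\<not> s < exp 1"
  proof -
    have "s > 0" using that exp_gt_zero[of "1::real"] by linarith
    then show ?thesis using t by simp
  qed
  ultimately show ?thesis by (auto simp: clog_def)
qed

text \<open>The sum is at most twice its larger summand, and m^16 \<le> 16^16 * exp m. The exponent
  16 arises from splitting a product N * x^8 into squares.\<close>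

lemma power_sum_le_exp:
  fixes u a :: real
  assumes "u \<ge> 0" "a \<ge> 0"
  shows "(u + a) ^ 16 \<le> 32 ^ 16 * (exp u + exp a)"
proof -
  define m where "m = max u a"
  have m: "m \<ge> 0" "u + a \<le> 2 * m" using assms by (auto simp: m_def)
  have "(u + a) ^ 16 \<le> (2 * m) ^ 16" using m assms by (intro power_mono) auto
  also have "\<dots> = 2 ^ 16 * m ^ 16" by (rule power_mult_distrib)
  also have "m ^ 16 \<le> (16 / 1) ^ 16 * exp (1 * m)" using exp_ge_power_nonneg[OF m(1), of 1 16] by simp
  also have "exp (1 * m) \<le> exp u + exp a" by (auto simp: m_def max_def)
  finally show ?thesis by (simp add: power_mult_distrib)
qed

text \<open>The factor 1 / ln x is the density of prime powers; the term in x^2 is absorbed because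
  ln x \<le> x. With x of order log q it turns into 1 / log log q.\<close>

lemma kill_cost_bound:
  "\<exists>C::real. C \<ge> 1 \<and> (\<forall>x\<ge>3. real (kill_cost x) \<le> C * real x ^ 3 / ln (real x))"
proof (rule primepow_count)
  fix C :: real
  assume C: "C > 0" "\<And>x. x \<ge> 2 \<Longrightarrow> real (card (primepow_factors (oddlcm x))) \<le> C * real x / ln (real x)"
  have "real (kill_cost x) \<le> (8 + 2 * C) * real x ^ 3 / ln (real x)" if x: "x \<ge> 3" for x
  proof -
    have l0: "ln (real x) > 0" using x by (intro ln_gt_zero) auto
    have "ln (real x) \<le> real x" using ln_le_minus_one[of "real x"] x by simp
    then have "real x ^ 2 * ln (real x) \<le> real x ^ 2 * real x" by (intro mult_left_mono) auto
    then have "real x ^ 2 \<le> real x ^ 3 / ln (real x)" using l0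
      by (simp add: pos_le_divide_eq power3_eq_cube power2_eq_square)
    moreover have "2 * real x ^ 2 * real (card (primepow_factors (oddlcm x))) \<le> 2 * real x ^ 2 * (C * real x / ln (real x))"
      using C(2)[of x] x by (intro mult_left_mono) auto
    moreover have "2 * real x ^ 2 * (C * real x / ln (real x)) = 2 * C * (real x ^ 3 / ln (real x))"
      by (simp add: power3_eq_cube power2_eq_square)
    moreover have "real (kill_cost x) = 8 * real x ^ 2 + 2 * real x ^ 2 * real (card (primepow_factors (oddlcm x)))"
      by (simp add: kill_cost_def)
    moreover have "(8 + 2 * C) * real x ^ 3 / ln (real x) = 8 * (real x ^ 3 / ln (real x)) + 2 * C * (real x ^ 3 / ln (real x))"
      by (simp add: distrib_right add_divide_distrib)
    ultimately show ?thesis by linarith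
  qed
  then show ?thesis using C(1) by (intro exI[of _ "8 + 2 * C"]) simp
qed

text \<open>Here \<open>x\<close> is comparable to \<open>clog q + a\<close>; the part coming from \<open>a\<close> only matters when \<open>q \<le> exp a\<close>.\<close>

lemma cost_bound:
  fixes C1 C2 :: real
  assumes "C1 \<ge> 1" "C2 \<ge> 1"
  shows "\<exists>C\<ge>1. \<forall>q x a \<kappa>. q \<ge> 1 \<and> a \<ge> 1 \<and> x \<ge> 3 \<and> clog q \<le> x \<and> x \<le> C1 * (clog q + a) \<and> \<kappa> \<le> C2 * x ^ 3 / ln x \<longrightarrow>
       q * \<kappa> + x ^ 16 \<le> C * (q * clog q ^ 3 / clog (clog q) + exp (2 * a))"
proof (intro exI[of _ "C2 * (2 * C1) ^ 3 * 27 + C1 ^ 16 * 32 ^ 16 * exp 1"] conjI allI impI)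
  have c: "C2 * (2 * C1) ^ 3 * 27 \<ge> 0" "C1 ^ 16 * 32 ^ 16 * exp 1 \<ge> (0::real)" using assms by auto
  have "1 * 1 \<le> (C1 ^ 16 * 32 ^ 16) * exp (1::real)"
    using assms one_le_power[of C1 16] by (intro mult_mono) (auto intro!: one_le_mult_iff[THEN iffD2] simp: mult_ge1_I)
  then show "C2 * (2 * C1) ^ 3 * 27 + C1 ^ 16 * 32 ^ 16 * exp 1 \<ge> 1" using c by linarith
  fix q x a \<kappa> :: real
  assume "q \<ge> 1 \<and> a \<ge> 1 \<and> x \<ge> 3 \<and> clog q \<le> x \<and> x \<le> C1 * (clog q + a) \<and> \<kappa> \<le> C2 * x ^ 3 / ln x"
  then have q: "q \<ge> 1" and a: "a \<ge> 1" and x: "x \<ge> 3" "clog q \<le> x" "x \<le> C1 * (clog q + a)"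
    and k: "\<kappa> \<le> C2 * x ^ 3 / ln x" by blast+
  define u where "u = clog q"
  define Q where "Q = q * u ^ 3 / clog u"
  have u1: "u \<ge> 1" unfolding u_def by (rule clog_ge_1)
  have cu: "clog u \<ge> 1" by (rule clog_ge_1)
  have "clog u * 1 \<le> u * u ^ 2" using clog_le_self[OF u1] u1 by (intro mult_mono) auto
  then have "q * clog u \<le> q * u ^ 3" using q by (intro mult_left_mono) (auto simp: power3_eq_cube power2_eq_square)
  then have qQ: "q \<le> Q" unfolding Q_def using cu by (simp add: pos_le_divide_eq)
  have lx: "ln x \<ge> clog u"
  proof -
    have "u \<le> x" using x by (simp add: u_def)
    then show ?thesis using clog_le_ln x(1) by blast
  qed
  then have lx1: "ln x \<ge> 1" using cu by linarith
  have e2: "exp (2 * a) = exp a * exp a" unfolding mult_2 by (rule exp_add)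
  have ea: "exp a \<ge> 1" using a by simp
  have ea2: "exp a \<le> exp (2 * a)" using a by simp
  have "q * \<kappa> \<le> C2 * (2 * C1) ^ 3 * 27 * (Q + exp (2 * a))"
  proof (cases "a \<le> u")
    case True
    have "x \<le> C1 * (2 * u)" using x(3) True assms u_def by (smt (verit) mult_left_mono)
    then have "x ^ 3 \<le> (2 * C1 * u) ^ 3" using x(1) by (intro power_mono) auto
    then have x3: "x ^ 3 \<le> (2 * C1) ^ 3 * u ^ 3" by (simp only: power_mult_distrib)
    have "\<kappa> \<le> C2 * x ^ 3 / ln x" by (rule k)
    also have "\<dots> \<le> C2 * ((2 * C1) ^ 3 * u ^ 3) / clog u"
      using x3 lx cu u1 assms x(1) by (intro frac_le mult_left_mono) auto
    finally have "q * \<kappa> \<le> q * (C2 * ((2 * C1) ^ 3 * u ^ 3) / clog u)" using q by (intro mult_left_mono) auto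
    also have "\<dots> = C2 * (2 * C1) ^ 3 * Q" by (simp add: Q_def)
    also have "\<dots> \<le> C2 * (2 * C1) ^ 3 * 27 * (Q + exp (2 * a))"
      unfolding mult.assoc[of _ 27] using assms qQ q by (intro mult_left_mono) (auto simp: add_increasing2)
    finally show ?thesis .
  next
    case False
    have "x \<le> C1 * (2 * a)" using x(3) False assms u_def by (smt (verit) mult_left_mono)
    then have "x ^ 3 \<le> (2 * C1 * a) ^ 3" using x(1) by (intro power_mono) auto
    then have "x ^ 3 \<le> (2 * C1) ^ 3 * a ^ 3" by (simp only: power_mult_distrib)
    also have "a ^ 3 \<le> 27 * exp a" using exp_ge_power_nonneg[of a 1 3] a by simp
    finally have x3: "x ^ 3 \<le> (2 * C1) ^ 3 * (27 * exp a)" using assms by (simp add: mult_left_mono)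
    have "\<kappa> \<le> C2 * x ^ 3 / ln x" by (rule k)
    also have "\<dots> \<le> C2 * x ^ 3 / 1" using lx1 assms x(1) by (intro divide_left_mono) auto
    also have "\<dots> \<le> C2 * ((2 * C1) ^ 3 * (27 * exp a))" using x3 assms by simp
    finally have kk: "\<kappa> \<le> C2 * ((2 * C1) ^ 3 * (27 * exp a))" .
    \<comment> \<open>One factor exp a pays for q, the other for a^3 \<le> 27 * exp a.\<close>
    have "q \<le> exp u" unfolding u_def using q by (intro le_exp_clog) auto
    also have "\<dots> \<le> exp a" using False by simp
    finally have qa: "q \<le> exp a" .
    have "q * \<kappa> \<le> q * (C2 * ((2 * C1) ^ 3 * (27 * exp a)))" using kk q by (intro mult_left_mono) auto
    also have "\<dots> \<le> exp a * (C2 * ((2 * C1) ^ 3 * (27 * exp a)))" using qa assms by (intro mult_right_mono) auto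
    also have "\<dots> = C2 * (2 * C1) ^ 3 * 27 * exp (2 * a)" unfolding e2 by (simp only: mult_ac)
    also have "\<dots> \<le> C2 * (2 * C1) ^ 3 * 27 * (Q + exp (2 * a))" using assms qQ q by (intro mult_left_mono) auto
    finally show ?thesis .
  qed
  moreover have "x ^ 16 \<le> C1 ^ 16 * 32 ^ 16 * exp 1 * (Q + exp (2 * a))"
  proof -
    have "x ^ 16 \<le> (C1 * (u + a)) ^ 16" using x unfolding u_def by (intro power_mono) auto
    also have "\<dots> = C1 ^ 16 * (u + a) ^ 16" by (rule power_mult_distrib)
    also have "\<dots> \<le> C1 ^ 16 * (32 ^ 16 * (exp u + exp a))"
      using power_sum_le_exp[of u a] u1 a assms by (intro mult_left_mono) auto
    also have "\<dots> \<le> C1 ^ 16 * (32 ^ 16 * (exp 1 * (Q + exp (2 * a))))"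
    proof (intro mult_left_mono)
      have "exp u \<le> exp 1 * Q"
        using exp_clog_le[OF q] qQ unfolding u_def by (rule order_trans[OF _ mult_left_mono]) auto
      moreover have "1 * exp a \<le> exp 1 * exp (2 * a)" using ea2 by (intro mult_mono) auto
      ultimately show "exp u + exp a \<le> exp 1 * (Q + exp (2 * a))" by (simp add: distrib_left)
    qed (use assms in auto)
    finally show ?thesis by (simp only: mult.assoc)
  qed
  ultimately show "q * \<kappa> + x ^ 16 \<le> (C2 * (2 * C1) ^ 3 * 27 + C1 ^ 16 * 32 ^ 16 * exp 1) * (q * clog q ^ 3 / clog (clog q) + exp (2 * a))"
    unfolding Q_def u_def by (simp only: distrib_right)
qed

text \<open>Once x is a large multiple of clog q + a, the numbers q, N and k * N are at most C * exp
  (x / 10). V is larger only by a polynomial in x, while \<open>oddlcm x\<close> is at least 2^x /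
  (4 * x).\<close>

lemma size_conditions:
  fixes C :: real
  assumes "C \<ge> 1"
  shows "\<exists>C1\<ge>3. C1 \<ge> C \<and>
    (\<forall>(k::nat) (N::nat) (q::nat) (x::nat) a T X V. k \<ge> 1 \<and> N \<ge> 1 \<and> k \<le> q \<and> a \<ge> 1 \<and> real N \<le> C * exp (2 * a) \<and>
      C1 * (clog (real q) + a) \<le> real x \<and> T = 4624 * k * (N + 1) + x \<and> X = N + x + 8 * x ^ 2 \<and>
      V = 19 * T + 10 * X * x ^ 3 \<longrightarrow> 3 * T \<le> 2 ^ x \<and> V + N + 5 * q \<le> oddlcm x)"
proof -
  \<comment> \<open>400006 = 2 * 200000 + 1 + 5 collects V, N and 5 * q; the factor 4 is the one in
    the lower bound for \<open>oddlcm\<close>.\<close>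
  define C3 where "C3 = 4 * 400006 * C"
  have C3: "C3 > 0" using assms by (simp add: C3_def)
  have "((\<lambda>x::real. x ^ 6 * exp (x / 10) / exp (x / 2)) \<longlongrightarrow> 0) at_top" by real_asymp
  then have "eventually (\<lambda>x::real. x ^ 6 * exp (x / 10) / exp (x / 2) < 1 / C3) at_top"
    using C3 by (intro order_tendstoD(2)) auto
  then obtain x1 :: real where x1: "\<And>x. x \<ge> x1 \<Longrightarrow> x ^ 6 * exp (x / 10) / exp (x / 2) < 1 / C3"
    by (auto simp: eventually_at_top_linorder)
  \<comment> \<open>The value 20 yields 2 * (u + a) \<le> x / 10, and the summand
    \<open>\<bar>x1\<bar>\<close> puts x beyond x1.\<close>
  define C1 where "C1 = max 20 C + \<bar>x1\<bar>"
  show ?thesis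
  proof (intro exI[of _ C1] conjI[of "C1 \<ge> 3"] conjI[of "C1 \<ge> C"] allI impI)
    show "C1 \<ge> 3" "C1 \<ge> C" unfolding C1_def by linarith+
    fix k N q x :: nat and a :: real and T X V
    assume *: "k \<ge> 1 \<and> N \<ge> 1 \<and> k \<le> q \<and> a \<ge> 1 \<and> real N \<le> C * exp (2 * a) \<and>
      C1 * (clog (real q) + a) \<le> real x \<and> T = 4624 * k * (N + 1) + x \<and> X = N + x + 8 * x ^ 2 \<and>
      V = 19 * T + 10 * X * x ^ 3"
    have k: "k \<ge> 1" and N: "N \<ge> 1" and kq: "k \<le> q" and a: "a \<ge> 1" and NC: "real N \<le> C * exp (2 * a)"
      and xl: "C1 * (clog (real q) + a) \<le> real x"
      and TXV: "T = 4624 * k * (N + 1) + x" "X = N + x + 8 * x ^ 2" "V = 19 * T + 10 * X * x ^ 3"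
      using * by blast+
    define u where "u = clog (real q)"
    have u1: "u \<ge> 1" unfolding u_def by (rule clog_ge_1)
    have q1: "real q \<ge> 1" using k kq by linarith
    have C120: "C1 \<ge> 20" "C1 \<ge> x1" unfolding C1_def by linarith+
    have "C1 * 1 \<le> C1 * (u + a)" using C120 u1 a by (intro mult_left_mono) auto
    then have xx1: "real x \<ge> x1" "real x \<ge> 20" using xl C120 unfolding u_def[symmetric] by linarith+
    have "20 * (u + a) \<le> C1 * (u + a)" using C120 u1 a by (intro mult_right_mono) auto
    then have t: "2 * (u + a) \<le> real x / 10" using xl unfolding u_def[symmetric] by linarith
    have x5: "real x ^ 5 \<ge> 1" using xx1 by (intro one_le_power) auto
    define Y where "Y = exp (real x / 10)"
    have q2: "real q \<le> exp u" unfolding u_def using q1 by (intro le_exp_clog) auto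
    have "exp u \<le> Y" unfolding Y_def using t u1 a by simp
    then have qY: "real q \<le> Y" using q2 by linarith
    have "exp (2 * a) \<le> Y" unfolding Y_def using t u1 by simp
    then have NY: "real N \<le> C * Y" using NC assms by (meson mult_left_mono order_trans zero_le_one)
    have kN: "real k * real N \<le> C * Y"
    proof -
      have "real k \<le> exp u" using kq q2 by linarith
      then have "real k * real N \<le> exp u * (C * exp (2 * a))" using NC by (intro mult_mono) auto
      also have "\<dots> = C * exp (u + 2 * a)" by (simp add: exp_add)
      also have "exp (u + 2 * a) \<le> Y" unfolding Y_def using t u1 by simp
      finally show ?thesis using assms by (simp add: mult_left_mono)
    qed
    have V: "real V \<le> 200000 * (real k * real N + real N * real x ^ 5)"
    proof (rule estimate_V(2))
      show "real T = 4624 * real k * (real N + 1) + real x" unfolding TXV(1) by (simp add: algebra_simps)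
      show "real X = real N + real x + 8 * real x ^ 2" unfolding TXV(2) by simp
      show "real V = 19 * real T + 10 * real X * real x ^ 3" unfolding TXV(3) by simp
    qed (use k N xx1 in auto)
    have CY: "C * Y \<ge> 0" unfolding Y_def using assms by simp
    have Y0: "Y \<ge> 0" unfolding Y_def by simp
    have "C * Y * 1 \<le> C * Y * real x ^ 5" using x5 CY by (intro mult_left_mono) auto
    moreover have "real N * real x ^ 5 \<le> C * Y * real x ^ 5" using NY by (intro mult_right_mono) auto
    moreover have "1 * Y \<le> C * Y" using assms Y0 by (intro mult_right_mono) auto
    ultimately have "real V + real N + 5 * real q \<le> 400006 * (C * Y * real x ^ 5)"
      using V kN NY qY by argo
    then have 1: "(real V + real N + 5 * real q) * (4 * real x) \<le> 400006 * (C * Y * real x ^ 5) * (4 * real x)"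
      by (intro mult_right_mono) auto
    have "real x ^ 6 * Y / exp (real x / 2) < 1 / C3" unfolding Y_def by (rule x1[OF xx1(1)])
    then have "C3 * (real x ^ 6 * Y) < exp (real x / 2)" using C3 by (simp add: divide_simps mult.commute)
    moreover have "exp (real x / 2) \<le> 2 ^ x"
    proof -
      have "exp (1/2::real) ^ x \<le> 2 ^ x" using exp_bound_half[of "1/2::real"] by (intro power_mono) auto
      then show ?thesis by (simp flip: exp_of_nat_mult)
    qed
    ultimately have "C3 * (real x ^ 6 * Y) < 2 ^ x" by linarith
    moreover have "400006 * (C * Y * real x ^ 5) * (4 * real x) = C3 * (real x ^ 6 * Y)"
      unfolding C3_def by (simp add: power_numeral_reduce)
    ultimately have 2: "(real V + real N + 5 * real q) * (4 * real x) \<le> 2 ^ x" using 1 by linarith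
    also have "\<dots> \<le> 4 * real x * real (oddlcm x)" using xx1 by (intro oddlcm_lower) simp
    finally have "(real V + real N + 5 * real q) * (4 * real x) \<le> real (oddlcm x) * (4 * real x)"
      by (simp add: mult_ac)
    then have "real V + real N + 5 * real q \<le> real (oddlcm x)" using xx1 by simp
    then have "real (V + N + 5 * q) \<le> real (oddlcm x)" by simp
    then have A: "V + N + 5 * q \<le> oddlcm x" by (simp only: of_nat_le_iff)
    have "3 * T \<le> V + N + 5 * q" unfolding TXV(3) by simp
    then have "real (3 * T) \<le> real (V + N + 5 * q)" by (rule of_nat_mono)
    also have "\<dots> = real V + real N + 5 * real q" by simp
    finally have "real (3 * T) * 1 \<le> (real V + real N + 5 * real q) * (4 * real x)"
      by (rule mult_mono) (use xx1 in auto)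
    then have "real (3 * T) \<le> real (2 ^ x)" using 2 by simp
    then have "3 * T \<le> 2 ^ x" by (simp only: of_nat_le_iff)
    then show "3 * T \<le> 2 ^ x \<and> V + N + 5 * q \<le> oddlcm x" using A by blast
  qed
qed

text \<open>For p < q take k = \<lceil>q / p\<rceil>: rounding up a number above 1 at most doubles
  it, and k \<le> q because p \<ge> 1.\<close>

lemma scaling_factor:
  fixes p q :: nat
  assumes "p > 0" "q > 0"
  obtains k :: nat where "k \<ge> 1" "k \<le> q" "1 \<le> real k * (real p / real q)"
    "real p / real q \<ge> 1 \<and> k = 1 \<or> real p / real q < 1 \<and> real k * (real p / real q) \<le> 2"
proof (cases "real p / real q \<ge> 1")
  case True
  then show ?thesis using that[of 1] assms by simp
next
  case False
  define r where "r = real q / real p"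
  have r: "r > 1" "real p / real q = 1 / r" using False assms by (auto simp: r_def field_simps)
  define k where "k = nat \<lceil>r\<rceil>"
  have "real k = of_int \<lceil>r\<rceil>" using r by (simp add: k_def)
  then have k: "r \<le> real k" "real k \<le> r + 1" by linarith+
  have "r \<le> real q" unfolding r_def using assms by (simp add: divide_le_eq)
  then have "k \<le> q" unfolding k_def by (simp add: nat_le_iff ceiling_le_iff)
  moreover have "k \<ge> 1" using k r by linarith
  moreover have "1 \<le> real k * (real p / real q)" unfolding r(2) using k r by (simp add: field_simps)
  moreover have "real k * (real p / real q) \<le> 2" unfolding r(2) using k r by (simp add: field_simps)
  ultimately show ?thesis using that[of k] False by simp
qed

text \<open>For \<alpha> \<ge> 1 we have k = 1, and N^2 is at most a constant times the exponential
  term. For \<alpha> < 1 the scaled target a is at most 2, so N is bounded by a constant and every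
  monomial is at most a constant times k * M.\<close>

lemma main_bound:
  fixes \<epsilon> :: real
  assumes "\<epsilon> > 0"
  shows "\<exists>c. \<forall>p q. p > 0 \<and> q > 0 \<longrightarrow> (\<exists>R. alpha_threshold (of_nat p / of_nat q) R \<and>
       real R < c * (real q * clog (real q) ^ 3 / clog (clog (real q)) / min (real p / real q) 1)
         + c * (exp 1 + \<epsilon>) powr (2 * (real p / real q)))"
proof -
  \<comment> \<open>Chosen so that exp (1 + \<eta>) \<le> e + \<epsilon>, which turns N^2 = O(exp (2
    * (1 + \<eta>) * \<alpha>)) into the required power; the cap 1 is the range allowed for \<delta>
    in \<open>filler_exists\<close>.\<close>
  define \<eta> where "\<eta> = min 1 (ln (1 + \<epsilon> / exp 1))"
  have \<epsilon>e: "\<epsilon> / exp 1 > 0" using assms by simp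
  then have "ln (1 + \<epsilon> / exp 1) > 0" by (intro ln_gt_zero) linarith
  then have \<eta>: "0 < \<eta>" "\<eta> \<le> 1" by (auto simp: \<eta>_def)
  have lne: "1 + \<eta> \<le> ln (exp 1 + \<epsilon>)"
  proof -
    have "exp 1 + \<epsilon> = exp 1 * (1 + \<epsilon> / exp 1)" by (simp add: field_simps)
    then have "ln (exp 1 + \<epsilon>) = ln (exp 1) + ln (1 + \<epsilon> / exp 1)" using \<epsilon>e by (simp add: ln_mult)
    then show ?thesis by (simp add: \<eta>_def)
  qed
  show ?thesis
  proof (rule filler_exists[OF \<eta>])
    fix CF :: real
    assume CF: "CF \<ge> 1" and fill: "\<And>a. a \<ge> 1 \<Longrightarrow> \<exists>N x. N > 0 \<and> x \<ge> 17 \<and> real N \<le> CF * exp ((1 + \<eta>) * a) \<and> real x \<le> CF * a \<and>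
        (\<forall>\<tau>. 0 \<le> \<tau> \<and> \<tau> \<le> a \<longrightarrow> (\<exists>F. finite F \<and> F \<subseteq> {1..N} \<and> \<tau> - 1 / 578 < rsum F \<and> rsum F \<le> \<tau> \<and>
           real (smoothlcm x N) * rsum F \<in> \<int> \<and> F \<inter> excluded = {}))"
    obtain C1 :: real where C1: "C1 \<ge> 3" "C1 \<ge> CF" and size:
      "\<forall>(k::nat) (N::nat) (q::nat) (x::nat) a T X V. k \<ge> 1 \<and> N \<ge> 1 \<and> k \<le> q \<and> a \<ge> 1 \<and> real N \<le> CF * exp (2 * a) \<and>
        C1 * (clog (real q) + a) \<le> real x \<and> T = 4624 * k * (N + 1) + x \<and> X = N + x + 8 * x ^ 2 \<and>
        V = 19 * T + 10 * X * x ^ 3 \<longrightarrow> 3 * T \<le> 2 ^ x \<and> V + N + 5 * q \<le> oddlcm x"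
      using size_conditions[OF CF] by (elim exE conjE)
    obtain CK :: real where CK: "CK \<ge> 1" "\<forall>x\<ge>3. real (kill_cost x) \<le> CK * real x ^ 3 / ln (real x)"
      using kill_cost_bound by (elim exE conjE)
    have "2 * C1 \<ge> 1" using C1 by simp
    then obtain CC :: real where CC: "CC \<ge> 1" and cost:
      "\<forall>q x a \<kappa>. q \<ge> 1 \<and> a \<ge> 1 \<and> x \<ge> 3 \<and> clog q \<le> x \<and> x \<le> 2 * C1 * (clog q + a) \<and> \<kappa> \<le> CK * x ^ 3 / ln x \<longrightarrow>
         q * \<kappa> + x ^ 16 \<le> CC * (q * clog q ^ 3 / clog (clog q) + exp (2 * a))"
      using cost_bound[OF _ CK(1), of "2 * C1"] by blast
    define n0 where "n0 = CF * exp 4"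
    define c1 where "c1 = 10 ^ 12 * (8 * CF ^ 2 + 43 * CC)"
    define c2 where "c2 = 10 ^ 12 * (40 * n0 ^ 2 * CC * exp 4)"
    have n0: "n0 \<ge> 1" unfolding n0_def using mult_mono[of 1 CF 1 "exp 4"] CF by simp
    have c12: "c1 \<ge> 0" "c2 \<ge> 0" unfolding c1_def c2_def using CC by auto
    show "\<exists>c. \<forall>p q. p > 0 \<and> q > 0 \<longrightarrow> (\<exists>R. alpha_threshold (of_nat p / of_nat q) R \<and>
         real R < c * (real q * clog (real q) ^ 3 / clog (clog (real q)) / min (real p / real q) 1)
           + c * (exp 1 + \<epsilon>) powr (2 * (real p / real q)))"
    proof (intro exI[of _ "c1 + c2 + 1"] allI impI)
      fix p q :: nat
      assume pq: "p > 0 \<and> q > 0"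
      then have p: "p > 0" and q: "q > 0" by blast+
      define A where "A = real p / real q"
      obtain k :: nat where k: "k \<ge> 1" "k \<le> q" "1 \<le> real k * A"
        "A \<ge> 1 \<and> k = 1 \<or> A < 1 \<and> real k * A \<le> 2"
        unfolding A_def by (rule scaling_factor[OF p q])
      define a where "a = real k * A"
      have A0: "A > 0" unfolding A_def using p q by simp
      have a_ge1: "a \<ge> 1" using k(3) by (simp add: a_def)
      obtain N z where Nz: "N > 0" "z \<ge> 17" "real N \<le> CF * exp ((1 + \<eta>) * a)" "real z \<le> CF * a"
        and fillN: "\<And>\<tau>. 0 \<le> \<tau> \<Longrightarrow> \<tau> \<le> a \<Longrightarrow> \<exists>F. finite F \<and> F \<subseteq> {1..N} \<and> \<tau> - 1 / 578 < rsum F \<and> rsum F \<le> \<tau> \<and>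
           real (smoothlcm z N) * rsum F \<in> \<int> \<and> F \<inter> excluded = {}"
        using fill[OF a_ge1] by blast
      define u where "u = clog (real q)"
      have u1: "u \<ge> 1" unfolding u_def by (rule clog_ge_1)
      \<comment> \<open>The summand u makes \<open>oddlcm x\<close> exceed q; the summand a makes it
        exceed N and gives z \<le> x.\<close>
      define x where "x = nat \<lceil>C1 * (u + a)\<rceil>"
      have "C1 * 2 \<le> C1 * (u + a)" using u1 a_ge1 C1 by (intro mult_left_mono) auto
      moreover have "6 \<le> C1 * 2" using C1 by simp
      ultimately have g6: "6 \<le> C1 * (u + a)" by (rule order_trans[rotated])
      then have "real x = of_int \<lceil>C1 * (u + a)\<rceil>" by (simp add: x_def)
      then have x: "C1 * (u + a) \<le> real x" "real x \<le> C1 * (u + a) + 1" by linarith+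
      have x6: "real x \<ge> 6" using x g6 by linarith
      have x2: "real x \<le> 2 * C1 * (u + a)" using x g6 by linarith
      have "1 * u \<le> C1 * (u + a)" using C1 u1 a_ge1 by (intro mult_mono) auto
      then have ux: "u \<le> real x" using x by linarith
      have "CF * a \<le> C1 * (u + a)" using C1 CF u1 a_ge1 by (intro mult_mono) auto
      then have "real z \<le> real x" using Nz(4) x by linarith
      then have zx: "z \<le> x" by simp
      have q1: "real q \<ge> 1" using q by simp
      interpret assembly p q k N z x
      proof
        show "1 \<le> real k * (real p / real q)" using k(3) by (simp add: A_def)
        show "\<exists>F. finite F \<and> F \<subseteq> {1..N} \<and> \<tau> - 1 / 578 < rsum F \<and> rsum F \<le> \<tau> \<and>
           real (smoothlcm z N) * rsum F \<in> \<int> \<and> F \<inter> excluded = {}"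
          if "0 \<le> \<tau>" "\<tau> \<le> real k * (real p / real q)" for \<tau>
          using fillN that by (simp add: a_def A_def)
      qed (use p q k Nz x6 zx in auto)
      have "(1 + \<eta>) * a \<le> 2 * a" using \<eta> a_ge1 by (intro mult_right_mono) auto
      then have "CF * exp ((1 + \<eta>) * a) \<le> CF * exp (2 * a)" using CF by simp
      then have N2: "real N \<le> CF * exp (2 * a)" using Nz(3) by linarith
      have N1: "N \<ge> 1" using Nz by simp
      have "3 * T0 \<le> 2 ^ x \<and> V + N + 5 * q \<le> oddlcm x"
        by (rule size[rule_format]) (use k(1,2) N1 a_ge1 N2 T0_def X_def V_def x(1) in \<open>auto simp only: u_def\<close>)
      then have big: "3 * T0 \<le> 2 ^ x" "V + N + 5 * q \<le> oddlcm x" by blast+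
      define R where "R = k * (N * N + 289 * V + 289 * (V + N + 5 * q) * kill_cost x) + 2886 * T0 + 102 * T0 ^ 2"
      have thr: "alpha_threshold (of_nat p / of_nat q) R" unfolding R_def by (rule threshold[OF big])
      define \<kappa> where "\<kappa> = real (kill_cost x)"
      have "kill_cost x \<ge> 1" unfolding kill_cost_def using x6 by (simp add: Suc_le_eq)
      then have \<kappa>1: "\<kappa> \<ge> 1" by (simp add: \<kappa>_def)
      have R: "real R \<le> 10 ^ 12 * (real k ^ 2 * real N ^ 2 + real x ^ 2 + real k ^ 2 * real N * \<kappa>
          + real k * real N * real x ^ 5 * \<kappa> + real k * real q * \<kappa>)"
      proof -
        have "real R = real k * (real N * real N + 289 * real V + 289 * (real V + real N + 5 * real q) * \<kappa>)
            + 2886 * real T0 + 102 * real T0 ^ 2"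
          unfolding R_def \<kappa>_def by simp
        also have "\<dots> \<le> 10 ^ 12 * (real k ^ 2 * real N ^ 2 + real x ^ 2 + real k ^ 2 * real N * \<kappa>
          + real k * real N * real x ^ 5 * \<kappa> + real k * real q * \<kappa>)"
        proof (rule estimate_total)
          show "real T0 = 4624 * real k * (real N + 1) + real x" unfolding T0_def by (simp add: algebra_simps)
          show "real X = real N + real x + 8 * real x ^ 2" unfolding X_def by simp
          show "real V = 19 * real T0 + 10 * real X * real x ^ 3" unfolding V_def by simp
        qed (use k N1 x6 q1 \<kappa>1 in auto)
        finally show ?thesis .
      qed
      define E where "E = real k ^ 2 * real N ^ 2 + real x ^ 2 + real k ^ 2 * real N * \<kappa>
          + real k * real N * real x ^ 5 * \<kappa> + real k * real q * \<kappa>"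
      have R: "real R \<le> 10 ^ 12 * E" using R unfolding E_def .
      define M where "M = real q * \<kappa> + real x ^ 16"
      define Q where "Q = real q * clog (real q) ^ 3 / clog (clog (real q))"
      define Z where "Z = (exp 1 + \<epsilon>) powr (2 * A)"
      have x3': "x \<ge> 3" using x6 by linarith
      have M: "M \<le> CC * (Q + exp (2 * a))"
        unfolding M_def Q_def
      proof (rule cost[rule_format], intro conjI)
        show "\<kappa> \<le> CK * real x ^ 3 / ln (real x)" unfolding \<kappa>_def using CK(2) x3' by blast
        show "1 \<le> real q" "1 \<le> a" by (rule q1, rule a_ge1)
        show "3 \<le> real x" using x6 by linarith
        show "clog (real q) \<le> real x" using ux by (simp only: u_def)
        show "real x \<le> 2 * C1 * (clog (real q) + a)" using x2 by (simp only: u_def)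
      qed
      have Q1: "Q \<ge> 1"
      proof -
        have "clog u * 1 \<le> u * u ^ 2" using clog_le_self[OF u1] u1 by (intro mult_mono) auto
        then have "1 * clog u \<le> real q * u ^ 3" using q1 u1 clog_ge_1[of u]
          by (intro mult_mono) (auto simp: power3_eq_cube power2_eq_square)
        then show ?thesis unfolding Q_def u_def[symmetric] using clog_ge_1[of u] by (simp add: pos_le_divide_eq)
      qed
      have Z0: "Z \<ge> 0" unfolding Z_def by simp
      have \<kappa>6: "\<kappa> \<le> 6 * real x ^ 3"
      proof -
        have "kill_cost x \<le> 6 * x ^ 3" using x3' by (intro kill_cost_le) simp
        then have "real (kill_cost x) \<le> real (6 * x ^ 3)" by (rule of_nat_mono)
        then show ?thesis by (simp add: \<kappa>_def)
      qed
      have x8: "real x ^ 5 * \<kappa> \<le> 6 * real x ^ 8"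
      proof -
        have "real x ^ 5 * \<kappa> \<le> real x ^ 5 * (6 * real x ^ 3)" using \<kappa>6 by (intro mult_left_mono) auto
        also have "\<dots> = 6 * real x ^ 8" by (simp flip: power_add)
        finally show ?thesis .
      qed
      have xp: "real x ^ 2 \<le> real x ^ 16" "real x ^ 6 \<le> real x ^ 16" "real x ^ 8 \<le> real x ^ 16"
        using x6 by (auto intro!: power_increasing)
      have x16: "real x ^ 16 \<ge> 0" by simp
      have qk0: "real q * \<kappa> \<ge> 0" using \<kappa>1 by simp
      have "real R < (c1 + c2 + 1) * (Q / min A 1) + (c1 + c2 + 1) * Z"
      proof (cases "A \<ge> 1")
        case True
        then have k1: "k = 1" "a = A" using k(4) by (auto simp: a_def)
        have NZ: "real N ^ 2 \<le> CF ^ 2 * Z" and aZ: "exp (2 * a) \<le> Z"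
        proof -
          have pos: "exp 1 + \<epsilon> > 0" using assms by (simp add: add_pos_pos)
          have "exp (2 * ((1 + \<eta>) * a)) \<le> exp (2 * (A * ln (exp 1 + \<epsilon>)))"
            using lne a_ge1 unfolding k1(2) by (simp add: mult.commute mult_left_mono)
          also have "\<dots> = Z" unfolding Z_def powr_def using pos by (simp add: mult.assoc)
          finally have e: "exp (2 * ((1 + \<eta>) * a)) \<le> Z" .
          have "real N ^ 2 \<le> (CF * exp ((1 + \<eta>) * a)) ^ 2" using Nz(3) by (intro power_mono) auto
          also have "\<dots> = CF ^ 2 * exp (2 * ((1 + \<eta>) * a))"
            by (simp add: power_mult_distrib exp_double)
          also have "\<dots> \<le> CF ^ 2 * Z" using e by (intro mult_left_mono) auto
          finally show "real N ^ 2 \<le> CF ^ 2 * Z" .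
          have "1 * a \<le> (1 + \<eta>) * a" using \<eta> a_ge1 by (intro mult_right_mono) auto
          then have "exp (2 * a) \<le> exp (2 * ((1 + \<eta>) * a))" by simp
          then show "exp (2 * a) \<le> Z" using e by linarith
        qed
        \<comment> \<open>The mixed terms N * \<kappa> and N * x^8 are split into N^2, paid for by
          Z, and powers of x, paid for by M; the square of x^8 is why M contains x^16.\<close>
        have amgm: "s * t \<le> s ^ 2 + t ^ 2" if "s \<ge> 0" "t \<ge> 0" for s t :: real
        proof -
          have "0 \<le> (s - t) ^ 2" by simp
          moreover have "0 \<le> s * t" using that by simp
          ultimately show ?thesis by (simp add: power2_eq_square algebra_simps)
        qed
        have f1: "real N * \<kappa> \<le> real N ^ 2 + \<kappa> ^ 2" using amgm \<kappa>1 by simp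
        have f2: "\<kappa> ^ 2 \<le> 36 * real x ^ 6"
        proof -
          have "\<kappa> ^ 2 \<le> (6 * real x ^ 3) ^ 2" using \<kappa>6 \<kappa>1 by (intro power_mono) auto
          also have "\<dots> = 36 * real x ^ 6" by (simp add: power_mult_distrib flip: power_mult)
          finally show ?thesis .
        qed
        have f3: "real N * real x ^ 5 * \<kappa> \<le> 6 * (real N * real x ^ 8)"
          using mult_left_mono[OF x8, of "real N"] by (simp add: mult.assoc mult.left_commute)
        have f4: "real N * real x ^ 8 \<le> real N ^ 2 + real x ^ 16"
          using amgm[of "real N" "real x ^ 8"] by (simp flip: power_mult)
        \<comment> \<open>8 = 1 + 1 + 6 counts N^2, and 43 = 1 + 36 + 6 counts x^16.\<close>
        have lin: "n2 + y2 + nk + nxk + t \<le> 8 * n2 + 43 * (t + y16)"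
          if "nk \<le> n2 + k2" "k2 \<le> 36 * y6" "nxk \<le> 6 * nx" "nx \<le> n2 + y16" "y2 \<le> y16" "y6 \<le> y16" "0 \<le> t"
          for n2 y2 nk nxk t y16 k2 y6 nx :: real using that by argo
        have "E = real N ^ 2 + real x ^ 2 + real N * \<kappa> + real N * real x ^ 5 * \<kappa> + real q * \<kappa>"
          unfolding E_def k1(1) by simp
        also have "\<dots> \<le> 8 * real N ^ 2 + 43 * M"
          unfolding M_def by (rule lin[OF f1 f2 f3 f4 xp(1,2) qk0])
        also have "\<dots> \<le> 8 * (CF ^ 2 * Z) + 43 * (CC * (Q + Z))"
        proof -
          have "CC * (Q + exp (2 * a)) \<le> CC * (Q + Z)" using aZ CC by (intro mult_left_mono) auto
          then show ?thesis using NZ M by linarith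
        qed
        also have "\<dots> \<le> (8 * CF ^ 2 + 43 * CC) * (Q + Z)"
        proof -
          have "CF ^ 2 * Z \<le> CF ^ 2 * (Q + Z)" using Q1 by (intro mult_left_mono) auto
          then show ?thesis by (simp add: algebra_simps)
        qed
        finally have "10 ^ 12 * E \<le> 10 ^ 12 * ((8 * CF ^ 2 + 43 * CC) * (Q + Z))"
          by (rule mult_left_mono) simp
        with R have "real R \<le> 10 ^ 12 * ((8 * CF ^ 2 + 43 * CC) * (Q + Z))" by (rule order_trans)
        then have "real R \<le> c1 * (Q + Z)" unfolding c1_def by (simp only: mult.assoc)
        also have "\<dots> < (c1 + c2 + 1) * (Q + Z)" using c12 Q1 Z0 by (intro mult_strict_right_mono) auto
        finally show ?thesis using True by (simp add: min_def distrib_left)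
      next
        case False
        then have A1: "A < 1" "a \<le> 2" using k(4) by (auto simp: a_def)
        have Nn: "real N \<le> n0"
        proof -
          have "CF * exp (2 * a) \<le> CF * exp 4" using A1 CF by simp
          then show ?thesis using N2 by (simp add: n0_def)
        qed
        have k0: "real k \<ge> 0" "real k \<ge> 1" using k(1) by simp_all
        have kq: "real k \<le> real q" using k(2) by simp
        have M0: "M \<ge> 0" "real q * \<kappa> \<le> M" "real x ^ 16 \<le> M" using qk0 x16 by (simp_all add: M_def)
        have "real q * 1 \<le> real q * \<kappa>" using \<kappa>1 by (intro mult_left_mono) auto
        then have qM: "real q \<le> M" using M0 by linarith
        have t1: "real k ^ 2 * real N ^ 2 \<le> real k * M * n0 ^ 2"
        proof -
          have "real k * real k * real N ^ 2 \<le> real k * M * n0 ^ 2"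
            using k0 kq qM Nn M0 by (intro mult_mono power_mono) auto
          then show ?thesis by (simp add: power2_eq_square)
        qed
        have t2: "real x ^ 2 \<le> real k * M"
          using mult_mono[of 1 "real k" "real x ^ 2" M] k0 xp M0 by simp
        have t3: "real k ^ 2 * real N * \<kappa> \<le> real k * M * n0"
        proof -
          have "real k * (real k * \<kappa>) * real N \<le> real k * (real q * \<kappa>) * n0"
            using kq \<kappa>1 Nn n0 by (intro mult_mono) auto
          also have "\<dots> \<le> real k * M * n0"
            using M0(2) n0 k0(1) by (intro mult_right_mono[OF mult_left_mono]) auto
          finally show ?thesis by (simp add: power2_eq_square mult_ac)
        qed
        have t4: "real k * real N * real x ^ 5 * \<kappa> \<le> 6 * (real k * M * n0)"
        proof -
          have "real x ^ 5 * \<kappa> \<le> 6 * M" using x8 xp M0 by linarith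
          then have "real k * (real x ^ 5 * \<kappa>) * real N \<le> real k * (6 * M) * n0"
            by (intro mult_mono[OF mult_left_mono[OF _ k0(1)] Nn]) (use M0 k0 in auto)
          then show ?thesis by (simp add: mult_ac)
        qed
        have t5: "real k * real q * \<kappa> \<le> real k * M" using M0 by (simp add: mult.assoc mult_left_mono)
        have kM: "real k * M \<ge> 0" using M0 by simp
        have "n0 * 1 \<le> n0 * n0" using n0 by (intro mult_left_mono) auto
        then have "real k * M * n0 \<le> real k * M * n0 ^ 2" using kM by (intro mult_left_mono) (auto simp: power2_eq_square)
        moreover have "real k * M * 1 \<le> real k * M * n0 ^ 2" using kM n0 by (intro mult_left_mono one_le_power) auto
        ultimately have "E \<le> 10 * (real k * M * n0 ^ 2)"
          unfolding E_def using t1 t2 t3 t4 t5 by linarith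
        then have "10 ^ 12 * E \<le> 10 ^ 12 * (10 * (real k * M * n0 ^ 2))" by (rule mult_left_mono) simp
        with R have R1: "real R \<le> 10 ^ 12 * (10 * (real k * M * n0 ^ 2))" by (rule order_trans)
        have "M \<le> CC * (Q + exp (2 * a))" by (rule M)
        also have "\<dots> \<le> CC * (2 * exp 4 * Q)"
        proof (intro mult_left_mono)
          have "exp (2 * a) \<le> exp 4" using A1 by simp
          moreover have "exp 4 * 1 \<le> exp 4 * Q" "1 * Q \<le> exp 4 * Q" using Q1 by (intro mult_mono; simp)+
          ultimately show "Q + exp (2 * a) \<le> 2 * exp 4 * Q" by linarith
        qed (use CC in simp)
        finally have M2: "M \<le> CC * (2 * exp 4 * Q)" .
        \<comment> \<open>Here k * A \<le> 2 becomes the factor 1 / min(\<alpha>, 1).\<close>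
        have k2: "real k \<le> 2 / A" using A1 A0 by (simp add: a_def pos_le_divide_eq)
        have "real k * M * n0 ^ 2 \<le> 2 / A * (CC * (2 * exp 4 * Q)) * n0 ^ 2"
          using k2 M2 M0 A0 by (intro mult_mono) auto
        also have "\<dots> = 4 * n0 ^ 2 * CC * exp 4 * (Q / A)" by (simp add: mult_ac)
        finally have "10 ^ 12 * (10 * (real k * M * n0 ^ 2)) \<le> 10 ^ 12 * (10 * (4 * n0 ^ 2 * CC * exp 4 * (Q / A)))"
          by simp
        also have "\<dots> = c2 * (Q / A)" unfolding c2_def by simp
        finally have "real R \<le> c2 * (Q / A)" using R1 by linarith
        also have "\<dots> < (c1 + c2 + 1) * (Q / A)" using c12 Q1 A0 by (intro mult_strict_right_mono) auto
        also have "\<dots> \<le> (c1 + c2 + 1) * (Q / A) + (c1 + c2 + 1) * Z" using c12 Z0 by simp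
        finally show ?thesis using A1 by (simp add: min_def)
      qed
      then show "\<exists>R. alpha_threshold (of_nat p / of_nat q) R \<and>
         real R < (c1 + c2 + 1) * (real q * clog (real q) ^ 3 / clog (clog (real q)) / min (real p / real q) 1)
           + (c1 + c2 + 1) * (exp 1 + \<epsilon>) powr (2 * (real p / real q))"
        using thr unfolding Q_def Z_def A_def by blast
    qed
  qed
qed

text \<open>The existence of a threshold is proved along with the bound rather than taken from
  Graham's theorem, so \<open>LEAST\<close> has its intended meaning. The fraction p / q may be in
  any form, not only in lowest terms.\<close>

theorem theorem1:
  fixes \<epsilon> :: real
  assumes "\<epsilon> > 0"
  shows "\<exists>c::real. \<forall>(\<alpha>::rat) (p::nat) (q::nat). p > 0 \<and> q > 0 \<and> \<alpha> = of_nat p / of_nat q \<longrightarrow>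
    (\<exists>N. alpha_threshold \<alpha> N) \<and>
    real (n_alpha \<alpha>) <
      c * real q * clog (real q) ^ 3 / (min (of_rat \<alpha>) 1 * clog (clog (real q)))
      + c * (exp 1 + \<epsilon>) powr (2 * of_rat \<alpha>)"
proof -
  obtain c :: real where c: "\<forall>p q. p > 0 \<and> q > 0 \<longrightarrow> (\<exists>R. alpha_threshold (of_nat p / of_nat q) R \<and>
       real R < c * (real q * clog (real q) ^ 3 / clog (clog (real q)) / min (real p / real q) 1)
         + c * (exp 1 + \<epsilon>) powr (2 * (real p / real q)))"
    using main_bound[OF assms] by (elim exE)
  show ?thesis
  proof (intro exI[of _ c] allI impI)
    fix \<alpha> :: rat and p q :: nat
    assume a: "p > 0 \<and> q > 0 \<and> \<alpha> = of_nat p / of_nat q"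
    have r: "of_rat \<alpha> = real p / real q" using a by (simp add: of_rat_divide)
    obtain R where R: "alpha_threshold \<alpha> R" "real R < c * (real q * clog (real q) ^ 3 / clog (clog (real q)) / min (real p / real q) 1)
         + c * (exp 1 + \<epsilon>) powr (2 * (real p / real q))"
      using c a by blast
    have "n_alpha \<alpha> \<le> R" unfolding n_alpha_def using R(1) by (rule Least_le)
    then have "real (n_alpha \<alpha>) \<le> real R" by simp
    also have "\<dots> < c * real q * clog (real q) ^ 3 / (min (of_rat \<alpha>) 1 * clog (clog (real q)))
      + c * (exp 1 + \<epsilon>) powr (2 * of_rat \<alpha>)"
      using R(2) unfolding r by (simp add: mult_ac)
    finally show "(\<exists>N. alpha_threshold \<alpha> N) \<and> real (n_alpha \<alpha>) <
      c * real q * clog (real q) ^ 3 / (min (of_rat \<alpha>) 1 * clog (clog (real q)))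
      + c * (exp 1 + \<epsilon>) powr (2 * of_rat \<alpha>)"
      using R(1) by blast
  qed
qed

end
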